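(* Let $N\ge5$ and $\alpha_1,\alpha_2>0$. If $\beta>\max\{\alpha_1,\alpha_2\}$ and $V_1,V_2\in L^{\frac{N}{2}}(\mathbb{R}^{N})$ are nonnegative functions satisfying $$|V_1|_{\frac{N}{2}}+|V_2|_{\frac{N}{2}}>0,$$ then $c =c_{\infty}$ and $c$ is not achieved.
   Context: $|\cdot|_q$ is the norm of $L^q(\mathbb{R}^N)$; $H=D^{1,2}(\mathbb{R}^N)\times D^{1,2}(\mathbb{R}^N)$; $u^+=\max\{u,0\}$. On $H$, $$ \begin{aligned} J(u,v)&=\frac{1}{2}\int_{\mathbb{R}^N}\big(|\nabla u|^{2}+|\nabla v|^{2}+V_1u^{2}+ V_2v^{2}\big)dx\\ &\quad-\frac{1}{4}\int_{\mathbb{R}^N}\int_{\mathbb{R}^N}\frac{\alpha_1|u^{+}(x)|^{2}|u^{+}(y)|^{2}+\alpha_2|v^{+}(x)|^{2}|v^{+}(y)|^{2}+2\beta|u^{+}(x)|^{2}|v^{+}(y)|^{2}}{|x-y|^{4}}dxdy, \end{aligned} $$ $\mathcal N=\{(u,v)\in H:(u,v)\ne(0,0),\ \langle J'(u,v),(u,v)\rangle=0\}$ and $c=\inf_{\mathcal N}J$. The quantity $c_\infty$ is the analogue of $c$ when $V_1=V_2=0$: $c_\infty=\inf_{\mathcal N_\infty}J_\infty$, where $J_\infty$, $\mathcal N_\infty$ are $J$, $\mathcal N$ with $V_1=V_2=0$. "$c$ is achieved" means $J(u,v)=c$ for some $(u,v)\in\mathcal N$. *)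

theory Defs
  imports "HOL-Analysis.Analysis"
begin

text \<open>
  Elements of Lebesgue and Sobolev spaces are represented by Borel functions, so equality of such
  elements is equality almost everywhere. The ambient space \<open>'a\<close> is an arbitrary Euclidean
  space of dimension \<open>N = DIM('a)\<close>.
\<close>

definition Lp :: "real \<Rightarrow> ('a::euclidean_space \<Rightarrow> real) set" where
  "Lp q = {f \<in> borel_measurable lborel. integrable lborel (\<lambda>x. \<bar>f x\<bar> powr q)}"

definition Lp_norm :: "real \<Rightarrow> ('a::euclidean_space \<Rightarrow> real) \<Rightarrow> real" where
  "Lp_norm q f = (LINT x|lborel. \<bar>f x\<bar> powr q) powr (1 / q)"

primrec k_times_cont_diff :: "nat \<Rightarrow> ('a::euclidean_space \<Rightarrow> real) \<Rightarrow> bool" where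
  "k_times_cont_diff 0 f \<longleftrightarrow> continuous_on UNIV f"
| "k_times_cont_diff (Suc k) f \<longleftrightarrow> (\<forall>x. f differentiable (at x)) \<and>
     (\<forall>b\<in>Basis. k_times_cont_diff k (\<lambda>x. frechet_derivative f (at x) b))"

definition test_function :: "('a::euclidean_space \<Rightarrow> real) \<Rightarrow> bool" where
  "test_function \<phi> \<longleftrightarrow> (\<forall>k. k_times_cont_diff k \<phi>) \<and> compact (closure {x. \<phi> x \<noteq> 0})"

definition locally_integrable ::
    "('a::euclidean_space \<Rightarrow> 'b::euclidean_space) \<Rightarrow> bool" where
  "locally_integrable f \<longleftrightarrow> f \<in> borel_measurable lborel \<and>
     (\<forall>K. compact K \<longrightarrow> set_integrable lborel K f)"

definition is_weak_gradient :: "('a::euclidean_space \<Rightarrow> real) \<Rightarrow> ('a \<Rightarrow> 'a) \<Rightarrow> bool" where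
  "is_weak_gradient u g \<longleftrightarrow> locally_integrable u \<and> locally_integrable g \<and>
     (\<forall>\<phi>. test_function \<phi> \<longrightarrow> (\<forall>b\<in>Basis.
        (LINT x|lborel. u x * frechet_derivative \<phi> (at x) b) =
        - (LINT x|lborel. (g x \<bullet> b) * \<phi> x)))"

text \<open>The weak gradient is unique up to null sets, so the choice below is immaterial.\<close>

definition weak_grad :: "('a::euclidean_space \<Rightarrow> real) \<Rightarrow> 'a \<Rightarrow> 'a" where
  "weak_grad u = (SOME g. is_weak_gradient u g)"

text \<open>
  \<open>D\<^sup>1\<^sup>,\<^sup>2 = {u \<in> L\<^sup>q. \<nabla>u \<in> L\<^sup>2}\<close> with the critical Sobolev
  exponent \<open>q = 2N/(N-2)\<close>, for \<open>N \<ge> 3\<close>.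
\<close>

definition D12 :: "('a::euclidean_space \<Rightarrow> real) set" where
  "D12 = {u \<in> Lp (2 * real DIM('a) / (real DIM('a) - 2)).
     (\<exists>g. is_weak_gradient u g) \<and> integrable lborel (\<lambda>x. (norm (weak_grad u x))\<^sup>2)}"

definition pos_part :: "real \<Rightarrow> real" where
  "pos_part t = max t 0"

definition J :: "real \<Rightarrow> real \<Rightarrow> real \<Rightarrow> ('a::euclidean_space \<Rightarrow> real) \<Rightarrow> ('a \<Rightarrow> real) \<Rightarrow>
    ('a \<Rightarrow> real) \<Rightarrow> ('a \<Rightarrow> real) \<Rightarrow> real" where
  "J \<alpha>1 \<alpha>2 \<beta> V1 V2 u v =
     1/2 * (LINT x|lborel. (norm (weak_grad u x))\<^sup>2 + (norm (weak_grad v x))\<^sup>2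
              + V1 x * (u x)\<^sup>2 + V2 x * (v x)\<^sup>2)
   - 1/4 * (LINT y|lborel. LINT x|lborel.
              (\<alpha>1 * \<bar>pos_part (u x)\<bar>\<^sup>2 * \<bar>pos_part (u y)\<bar>\<^sup>2
               + \<alpha>2 * \<bar>pos_part (v x)\<bar>\<^sup>2 * \<bar>pos_part (v y)\<bar>\<^sup>2
               + 2 * \<beta> * \<bar>pos_part (u x)\<bar>\<^sup>2 * \<bar>pos_part (v y)\<bar>\<^sup>2)
              / (norm (x - y)) ^ 4)"

text \<open>
  \<open>J_deriv \<alpha>1 \<alpha>2 \<beta> V1 V2 u v \<phi> \<psi> d\<close> says that
  \<open>\<langle>J'(u,v), (\<phi>,\<psi>)\<rangle>\<close> exists, as the derivative of \<open>J\<close> at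
  \<open>(u,v)\<close> in the direction \<open>(\<phi>,\<psi>)\<close>, and has the value \<open>d\<close>.
\<close>

definition J_deriv :: "real \<Rightarrow> real \<Rightarrow> real \<Rightarrow> ('a::euclidean_space \<Rightarrow> real) \<Rightarrow> ('a \<Rightarrow> real) \<Rightarrow>
    ('a \<Rightarrow> real) \<Rightarrow> ('a \<Rightarrow> real) \<Rightarrow> ('a \<Rightarrow> real) \<Rightarrow> ('a \<Rightarrow> real) \<Rightarrow> real \<Rightarrow> bool" where
  "J_deriv \<alpha>1 \<alpha>2 \<beta> V1 V2 u v \<phi> \<psi> d \<longleftrightarrow>
     ((\<lambda>t. J \<alpha>1 \<alpha>2 \<beta> V1 V2 (\<lambda>x. u x + t * \<phi> x) (\<lambda>x. v x + t * \<psi> x))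
        has_real_derivative d) (at 0)"

definition Nehari :: "real \<Rightarrow> real \<Rightarrow> real \<Rightarrow> ('a::euclidean_space \<Rightarrow> real) \<Rightarrow> ('a \<Rightarrow> real) \<Rightarrow>
    (('a \<Rightarrow> real) \<times> ('a \<Rightarrow> real)) set" where
  "Nehari \<alpha>1 \<alpha>2 \<beta> V1 V2 = {(u, v). u \<in> D12 \<and> v \<in> D12 \<and>
     \<not> ((AE x in lborel. u x = 0) \<and> (AE x in lborel. v x = 0)) \<and>
     J_deriv \<alpha>1 \<alpha>2 \<beta> V1 V2 u v u v 0}"

definition c_level :: "real \<Rightarrow> real \<Rightarrow> real \<Rightarrow> ('a::euclidean_space \<Rightarrow> real) \<Rightarrow> ('a \<Rightarrow> real) \<Rightarrow> real" where
  "c_level \<alpha>1 \<alpha>2 \<beta> V1 V2 =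
     (INF (u, v) \<in> Nehari \<alpha>1 \<alpha>2 \<beta> V1 V2. J \<alpha>1 \<alpha>2 \<beta> V1 V2 u v)"

definition c_achieved :: "real \<Rightarrow> real \<Rightarrow> real \<Rightarrow> ('a::euclidean_space \<Rightarrow> real) \<Rightarrow> ('a \<Rightarrow> real) \<Rightarrow> bool" where
  "c_achieved \<alpha>1 \<alpha>2 \<beta> V1 V2 \<longleftrightarrow>
     (\<exists>(u, v) \<in> Nehari \<alpha>1 \<alpha>2 \<beta> V1 V2. J \<alpha>1 \<alpha>2 \<beta> V1 V2 u v = c_level \<alpha>1 \<alpha>2 \<beta> V1 V2)"

end

theory Submission
  imports Defs "HOL-Real_Asymp.Real_Asymp"
begin

text \<open>
  Since \<open>V\<^sub>1, V\<^sub>2 \<ge> 0\<close>, projecting a point of \<open>\<N>\<close> radially onto \<open>\<N>\<^sub>\<infinity>\<close> does not increase the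
  energy, so \<open>c\<^sub>\<infinity> \<le> c\<close>; conversely the potential terms of the translates of a fixed pair vanish in
  the limit, so \<open>c \<le> c\<^sub>\<infinity>\<close>. If \<open>c\<close> were achieved at \<open>(u, v)\<close>, equality in the first argument would give
  \<open>\<integral>V\<^sub>1 u\<^sup>2 = \<integral>V\<^sub>2 v\<^sup>2 = 0\<close>, and \<open>(u, v)\<close> would minimize the problem without potentials. Replacing \<open>u\<close> by
  \<open>u + t\<phi>\<close> with a test function \<open>\<phi> \<ge> 0\<close> does not decrease the interaction term, so minimality makes \<open>u\<close> weakly
  superharmonic, and likewise \<open>v\<close>. By the strong maximum principle each of them is positive or zero
  almost everywhere; zero is excluded because \<open>\<beta> > max \<alpha>\<^sub>1 \<alpha>\<^sub>2\<close> makes a suitable pair \<open>(a v, b v)\<close> with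
  \<open>a\<^sup>2 + b\<^sup>2 = 1\<close> strictly better than \<open>(0, v)\<close>. Hence \<open>V\<^sub>1 = V\<^sub>2 = 0\<close> almost everywhere, a contradiction.
\<close>

subsection \<open>Smooth functions\<close>

text \<open>On \<open>\<N>\<close> one has J = K/4 with K the quadratic part, and radial projection
  turns the minimum of J into that of the scale-invariant quotient K^2/(4 C), C the interaction,
  over pairs with C > 0. All comparisons are made on this quotient. Minimality is exploited
  one-sidedly: C is never differentiated in the direction \<open>\<phi>\<close>; it only has to be
  monotone, and then the Dirichlet part cannot drop, which fixes the sign of its linear term in t.
  The obstacle is that a divergent Bochner integral has the value 0, so monotonicity of C
  presupposes finite energy. For the given pair this is read off from C > 0; for the test function
  it follows from bounds on the potential of a ball, where N >= 5 makes |x|^(-4) integrable at the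
  origin. The maximum principle rests on averages of u against t^N p(t (y - x)), which increase with
  t when u is superharmonic. Letting t tend to 0 gives nonnegativity, because u lies in some L^q;
  letting t tend to infinity gives u itself, up to the mass of p.\<close>

lemma k_times_SucD: "k_times_cont_diff (Suc k) f \<Longrightarrow> k_times_cont_diff k f"
proof (induction k arbitrary: f)
  case 0
  then show ?case
    by (auto simp: continuous_on_eq_continuous_at intro: differentiable_imp_continuous_within)
next
  case (Suc k)
  then show ?case by (metis k_times_cont_diff.simps(2))
qed

text \<open>\<open>k_times_cont_diff\<close> speaks of the chosen \<open>frechet_derivative\<close>;
  by uniqueness any explicitly known derivative \<open>D\<close> may take its place.\<close>

lemma k_times_SucI:
  assumes "\<And>x. (f has_derivative D x) (at x)"
    and "\<And>b. b \<in> Basis \<Longrightarrow> k_times_cont_diff k (\<lambda>x. D x b)"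
  shows "k_times_cont_diff (Suc k) f"
proof -
  have "frechet_derivative f (at x) = D x" for x
    using assms(1) frechet_derivative_at by metis
  then show ?thesis
    using assms by (auto simp: differentiable_def)
qed

lemma k_times_has_derivative:
  "k_times_cont_diff (Suc k) f \<Longrightarrow> (f has_derivative frechet_derivative f (at x)) (at x)"
  by (simp add: frechet_derivative_works)

lemma k_times_const: "k_times_cont_diff k (\<lambda>x. c)"
proof (induction k arbitrary: c)
  case (Suc k)
  show ?case by (rule k_times_SucI[where D="\<lambda>_ _. 0"]) (auto intro: Suc)
qed simp

lemma k_times_add:
  "k_times_cont_diff k f \<Longrightarrow> k_times_cont_diff k g \<Longrightarrow> k_times_cont_diff k (\<lambda>x. f x + g x)"
proof (induction k arbitrary: f g)
  case (Suc k)
  show ?case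
    by (rule k_times_SucI[where
          D="\<lambda>x b. frechet_derivative f (at x) b + frechet_derivative g (at x) b"])
      (use Suc in \<open>auto intro!: has_derivative_add k_times_has_derivative[OF Suc.prems(1)]
         k_times_has_derivative[OF Suc.prems(2)]\<close>)
qed (auto intro: continuous_intros)

lemma k_times_mult:
  "k_times_cont_diff k f \<Longrightarrow> k_times_cont_diff k g \<Longrightarrow> k_times_cont_diff k (\<lambda>x. f x * g x)"
proof (induction k arbitrary: f g)
  case (Suc k)
  show ?case
    by (rule k_times_SucI[where
          D="\<lambda>x b. f x * frechet_derivative g (at x) b + frechet_derivative f (at x) b * g x"])
      (use Suc.prems k_times_SucD[OF Suc.prems(1)] k_times_SucD[OF Suc.prems(2)] in
        \<open>auto intro!: has_derivative_mult k_times_has_derivative[OF Suc.prems(1)]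
           k_times_has_derivative[OF Suc.prems(2)] k_times_add Suc.IH\<close>)
qed (auto intro: continuous_intros)

lemma k_times_inner: "k_times_cont_diff k (\<lambda>x::'a::euclidean_space. (x - a) \<bullet> b)"
proof (cases k)
  case (Suc j)
  show ?thesis unfolding Suc
    by (rule k_times_SucI[where D="\<lambda>x h. h \<bullet> b"])
      (auto intro!: derivative_eq_intros simp: k_times_const)
qed (auto intro!: continuous_intros)

lemma k_times_translate:
  "k_times_cont_diff k f \<Longrightarrow> k_times_cont_diff k (\<lambda>x. f (x + z))"
proof (induction k arbitrary: f)
  case 0
  then show ?case by (auto intro!: continuous_on_compose2[of UNIV f] continuous_intros)
next
  case (Suc k)
  have "((\<lambda>x. f (x + z)) has_derivative frechet_derivative f (at (x + z))) (at x)" for x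
    by (rule has_derivative_compose[where f="\<lambda>x. x + z" and f'="\<lambda>h. h"])
      (auto intro!: derivative_eq_intros k_times_has_derivative[OF Suc.prems])
  then show ?case
    by (rule k_times_SucI) (use Suc in \<open>auto dest: Suc.IH[rotated]\<close>)
qed

text \<open>This family is closed under differentiation, up to linear combinations; \<open>m = 0\<close> is
  the usual profile of a bump function.\<close>

definition flat :: "nat \<Rightarrow> real \<Rightarrow> real" where
  "flat m t = (if t > 0 then exp (- 1 / t) / t ^ m else 0)"

lemma flat_nonneg: "flat m t \<ge> 0"
  by (simp add: flat_def)

lemma flat_pos: "t > 0 \<Longrightarrow> flat m t > 0"
  by (simp add: flat_def)

lemma flat_eq_0: "t \<le> 0 \<Longrightarrow> flat m t = 0"
  by (simp add: flat_def)

lemma flat_tendsto_0: "(flat m \<longlongrightarrow> 0) (at 0)"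
proof -
  have "((\<lambda>t::real. exp (- 1 / t) / t ^ m) \<longlongrightarrow> 0) (at_right 0)"
    by real_asymp
  then have "(flat m \<longlongrightarrow> 0) (at_right 0)"
    by (rule Lim_transform_eventually) (auto simp: eventually_at_right_less flat_def
        intro!: eventually_mono[OF eventually_at_right_less[of 0]])
  moreover have "(flat m \<longlongrightarrow> 0) (at_left 0)"
    by (rule Lim_transform_eventually[of "\<lambda>_. 0"])
      (auto simp: eventually_at_filter flat_def)
  ultimately show ?thesis
    using filterlim_split_at by blast
qed

text \<open>Away from 0 this is calculus. At 0 the difference quotient of \<open>flat m\<close> is
  \<open>flat (m + 1)\<close>, whose limit is covered by \<open>flat_tendsto_0\<close>.\<close>

lemma flat_deriv: "(flat m has_real_derivative flat (m + 2) t - real m * flat (m + 1) t) (at t)"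
proof -
  consider "t > 0" | "t < 0" | "t = 0" by linarith
  then show ?thesis
  proof cases
    case 1
    have "((\<lambda>t. exp (- 1 / t)) has_real_derivative exp (- 1 / t) / t\<^sup>2) (at t)"
      using 1 by (auto intro!: derivative_eq_intros simp: field_simps power2_eq_square)
    from DERIV_divide[OF this DERIV_pow[of m t]] 1
    have "((\<lambda>t. exp (- 1 / t) / t ^ m) has_real_derivative
        exp (- 1 / t) / t ^ (m + 2) - real m * (exp (- 1 / t) / t ^ (m + 1))) (at t)"
      by (cases m) (auto elim!: DERIV_cong simp: divide_simps power2_eq_square power_add algebra_simps)
    then show ?thesis
      by (rule has_field_derivative_transform_within_open[where S="{0<..}",
            THEN DERIV_cong])
        (use 1 in \<open>auto simp: flat_def\<close>)
  next
    case 2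
    have "((\<lambda>t. 0) has_real_derivative 0) (at t)" by simp
    then show ?thesis
      by (rule has_field_derivative_transform_within_open[where S="{..<0}",
            THEN DERIV_cong])
        (use 2 in \<open>auto simp: flat_def\<close>)
  next
    case 3
    have "flat m h / h = flat (m + 1) h" for h
      by (simp add: flat_def)
    then show ?thesis
      using flat_tendsto_0[of "m + 1"] 3 by (simp add: DERIV_def flat_eq_0)
  qed
qed

text \<open>\<open>m\<close> must vary in the induction: differentiation replaces
  \<open>flat m\<close> by a combination of \<open>flat (m + 1)\<close> and
  \<open>flat (m + 2)\<close>, times a derivative of \<open>p\<close>.\<close>

lemma k_times_flat:
  "(\<And>j. k_times_cont_diff j p) \<Longrightarrow> k_times_cont_diff k (\<lambda>x. flat m (p x))"
proof (induction k arbitrary: m)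
  case 0
  have "continuous_on UNIV (flat m)" for m
    by (auto simp: continuous_on_eq_continuous_at intro: DERIV_isCont[OF flat_deriv])
  then show ?case
    using 0[of 0] by (auto intro: continuous_on_compose2)
next
  case (Suc k)
  have "((\<lambda>x. flat m (p x)) has_derivative
      (\<lambda>b. (flat (m + 2) (p x) + (- real m) * flat (m + 1) (p x)) * frechet_derivative p (at x) b))
      (at x)" for x
    using has_derivative_compose[OF k_times_has_derivative[OF Suc.prems]
        flat_deriv[THEN has_field_derivative_imp_has_derivative]]
    by simp
  then show ?case
  proof (rule k_times_SucI)
    fix b :: 'a assume "b \<in> Basis"
    then show "k_times_cont_diff k (\<lambda>x. (flat (m + 2) (p x) + (- real m) * flat (m + 1) (p x)) *
        frechet_derivative p (at x) b)"
      using Suc.prems[of "Suc k"]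
      by (intro k_times_mult k_times_add k_times_const Suc) auto
  qed
qed

section \<open>Operations on test functions\<close>

lemma test_function_partial:
  assumes "test_function \<phi>" and b: "b \<in> Basis"
  shows "test_function (\<lambda>x. frechet_derivative \<phi> (at x) b)"
proof -
  have "k_times_cont_diff (Suc k) \<phi>" for k
    using assms(1) by (simp only: test_function_def)
  then have "k_times_cont_diff k (\<lambda>x. frechet_derivative \<phi> (at x) b)" for k
    using b by simp
  \<comment> \<open>Off its closed support \<open>\<phi>\<close> vanishes in an open neighbourhood,
    so the derivative there is 0.\<close>
  moreover have "frechet_derivative \<phi> (at x) b = 0" if "x \<notin> closure {x. \<phi> x \<noteq> 0}" for x
  proof -
    have "((\<lambda>x. 0) has_derivative (\<lambda>h. 0)) (at x)" by simp
    then have "(\<phi> has_derivative (\<lambda>h. 0)) (at x)"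
      by (rule has_derivative_transform_within_open[where s="- closure {x. \<phi> x \<noteq> 0}"])
        (use that closure_subset[of "{x. \<phi> x \<noteq> 0}"] in \<open>auto simp: open_Compl\<close>)
    then show ?thesis
      using frechet_derivative_at by metis
  qed
  then have "{x. frechet_derivative \<phi> (at x) b \<noteq> 0} \<subseteq> closure {x. \<phi> x \<noteq> 0}"
    by blast
  then have "bounded {x. frechet_derivative \<phi> (at x) b \<noteq> 0}"
    using assms(1) by (auto simp: test_function_def intro: bounded_subset compact_imp_bounded)
  ultimately show ?thesis
    by (simp add: test_function_def compact_closure)
qed

lemma test_function_mult:
  assumes "test_function \<phi>" "test_function \<psi>"
  shows "test_function (\<lambda>x. \<phi> x * \<psi> x)"
proof -
  have "bounded {x. \<phi> x * \<psi> x \<noteq> 0}"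
    using assms(1) by (auto simp: test_function_def compact_closure intro: bounded_subset)
  then show ?thesis
    using assms by (simp add: test_function_def compact_closure k_times_mult)
qed

lemma test_function_has_derivative:
  "test_function \<phi> \<Longrightarrow> (\<phi> has_derivative frechet_derivative \<phi> (at x)) (at x)"
  using k_times_has_derivative[of 0 \<phi>] by (simp only: test_function_def)

lemma test_function_continuous: "test_function \<phi> \<Longrightarrow> continuous_on UNIV \<phi>"
  by (simp only: test_function_def flip: k_times_cont_diff.simps(1))

lemma test_function_support:
  assumes "test_function \<phi>"
  obtains R where "R > 0" "\<And>x. norm x > R \<Longrightarrow> \<phi> x = 0"
proof -
  have "bounded {x. \<phi> x \<noteq> 0}"
    using assms by (simp add: test_function_def compact_closure)
  then obtain R where "R > 0" "\<And>x. \<phi> x \<noteq> 0 \<Longrightarrow> norm x \<le> R"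
    by (auto simp: bounded_pos)
  then show thesis
    using that[of R] by force
qed

lemma continuous_compact_support_bounded:
  fixes f :: "'a::euclidean_space \<Rightarrow> real"
  assumes "continuous_on UNIV f" "\<And>x. norm x > R \<Longrightarrow> f x = 0"
  obtains B where "B \<ge> 0" "\<And>x. \<bar>f x\<bar> \<le> B"
proof -
  have "compact (f ` cball 0 R)"
    by (intro compact_continuous_image continuous_on_subset[OF assms(1)]) auto
  then obtain B where B: "B > 0" "\<And>x. norm x \<le> R \<Longrightarrow> \<bar>f x\<bar> \<le> B"
    by (auto dest!: compact_imp_bounded simp: bounded_pos)
  have "\<bar>f x\<bar> \<le> B" for x
    using B assms(2)[of x] by (cases "norm x \<le> R") auto
  then show thesis
    using that[of B] B(1) by simp
qed

lemma test_function_bounded: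
  assumes "test_function \<phi>"
  obtains B where "B \<ge> 0" "\<And>x. \<bar>\<phi> x\<bar> \<le> B"
proof -
  obtain R where "\<And>x. norm x > R \<Longrightarrow> \<phi> x = 0"
    using test_function_support[OF assms] by blast
  then show thesis
    using continuous_compact_support_bounded[OF test_function_continuous[OF assms]] that by blast
qed

lemma test_function_translate:
  assumes "test_function \<phi>"
  shows "test_function (\<lambda>x. \<phi> (x + z))"
    and "frechet_derivative (\<lambda>x. \<phi> (x + z)) (at x) = frechet_derivative \<phi> (at (x + z))"
proof -
  obtain R where R: "R > 0" "\<And>x. norm x > R \<Longrightarrow> \<phi> x = 0"
    using test_function_support[OF assms] by blast
  have "norm x \<le> R + norm z" if "\<phi> (x + z) \<noteq> 0" for x
    using R(2)[of "x + z"] that norm_triangle_ineq4[of "x + z" z] by fastforce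
  then have "bounded {x. \<phi> (x + z) \<noteq> 0}"
    by (auto simp: bounded_iff)
  then show "test_function (\<lambda>x. \<phi> (x + z))"
    using assms k_times_translate by (auto simp: test_function_def compact_closure)
  have "((\<lambda>x. \<phi> (x + z)) has_derivative frechet_derivative \<phi> (at (x + z))) (at x)"
    by (rule has_derivative_compose[where f="\<lambda>x. x + z" and f'="\<lambda>h. h"])
      (auto intro!: derivative_eq_intros test_function_has_derivative[OF assms])
  then show "frechet_derivative (\<lambda>x. \<phi> (x + z)) (at x) = frechet_derivative \<phi> (at (x + z))"
    using frechet_derivative_at by metis
qed

section \<open>Bump functions and their Laplacians\<close>

lemma paraboloid_has_derivative:
  "((\<lambda>y::'a::real_inner. 1 - (norm (y - x))\<^sup>2 / r\<^sup>2) has_derivative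
    (\<lambda>h. (- 2 / r\<^sup>2) * ((y - x) \<bullet> h))) (at y)"
proof -
  have "((\<lambda>y. 1 - (1 / r\<^sup>2) * ((y - x) \<bullet> (y - x))) has_derivative
      (\<lambda>h. (- 2 / r\<^sup>2) * ((y - x) \<bullet> h))) (at y)"
    by (rule derivative_eq_intros refl)+ (simp add: inner_commute)
  then show ?thesis by (simp add: power2_norm_eq_inner)
qed

lemma k_times_paraboloid:
  "k_times_cont_diff k (\<lambda>y::'a::euclidean_space. 1 - (norm (y - x))\<^sup>2 / r\<^sup>2)"
proof (cases k)
  case (Suc j)
  show ?thesis unfolding Suc
  proof (rule k_times_SucI[where D="\<lambda>y h. (- 2 / r\<^sup>2) * ((y - x) \<bullet> h)"])
    show "((\<lambda>y. 1 - (norm (y - x))\<^sup>2 / r\<^sup>2) has_derivative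
        (\<lambda>h. (- 2 / r\<^sup>2) * ((y - x) \<bullet> h))) (at y)" for y
      by (rule paraboloid_has_derivative)
  qed (intro k_times_mult k_times_const k_times_inner)
qed (auto simp: continuous_on_eq_continuous_at
    intro: has_derivative_continuous paraboloid_has_derivative)

text \<open>For r > 0 the usual smooth bump exp(-1/(1 - |y - x|^2/r^2)), positive exactly on the
  open ball of radius r about x.\<close>

definition bump :: "'a::euclidean_space \<Rightarrow> real \<Rightarrow> 'a \<Rightarrow> real" where
  "bump x r y = flat 0 (1 - (norm (y - x))\<^sup>2 / r\<^sup>2)"

lemma paraboloid_nonpos:
  "r > 0 \<Longrightarrow> norm (y - x) \<ge> r \<Longrightarrow> 1 - (norm (y - x))\<^sup>2 / r\<^sup>2 \<le> 0"
  by (simp add: power_mono)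

lemma test_function_bump:
  assumes "r > 0"
  shows "test_function (bump x r)"
proof -
  have "{y. bump x r y \<noteq> 0} \<subseteq> cball x r"
  proof
    fix y assume "y \<in> {y. bump x r y \<noteq> 0}"
    then have "\<not> norm (y - x) \<ge> r"
      using paraboloid_nonpos[OF assms, of y x] flat_eq_0 by (metis bump_def mem_Collect_eq)
    then show "y \<in> cball x r" by (simp add: dist_norm norm_minus_commute)
  qed
  then have "compact (closure {y. bump x r y \<noteq> 0})"
    using bounded_subset compact_closure by blast
  moreover have "k_times_cont_diff k (bump x r)" for k
    unfolding bump_def[abs_def] by (intro k_times_flat k_times_paraboloid)
  ultimately show ?thesis
    by (simp add: test_function_def)
qed

lemma frechet_derivative_bump:
  assumes "r > 0"
  shows "frechet_derivative (bump x r) (at y) b =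
    - 2 / r\<^sup>2 * flat 2 (1 - (norm (y - x))\<^sup>2 / r\<^sup>2) * ((y - x) \<bullet> b)"
proof -
  from has_derivative_compose[OF paraboloid_has_derivative
      flat_deriv[of 0, THEN has_field_derivative_imp_has_derivative]]
  have "(bump x r has_derivative
      (\<lambda>h. flat 2 (1 - (norm (y - x))\<^sup>2 / r\<^sup>2) * ((- 2 / r\<^sup>2) * ((y - x) \<bullet> h)))) (at y)"
    by (simp add: bump_def[abs_def] numeral_2_eq_2)
  from frechet_derivative_at[OF this, symmetric] show ?thesis
    by simp
qed

lemma frechet_derivative2_bump:
  fixes x y :: "'a::euclidean_space"
  assumes "r > 0"
  defines "s \<equiv> \<lambda>y. 1 - (norm (y - x))\<^sup>2 / r\<^sup>2"
  shows "frechet_derivative (\<lambda>y. frechet_derivative (bump x r) (at y) b) (at y) b =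
    4 / r ^ 4 * (flat 4 (s y) - 2 * flat 3 (s y)) * ((y - x) \<bullet> b)\<^sup>2
    - 2 / r\<^sup>2 * flat 2 (s y) * (b \<bullet> b)"
proof -
  have s: "(s has_derivative (\<lambda>h. (- 2 / r\<^sup>2) * ((y - x) \<bullet> h))) (at y)"
    unfolding s_def by (rule paraboloid_has_derivative)
  have D: "((\<lambda>y. flat 2 (s y)) has_derivative
      (\<lambda>h. (flat 4 (s y) - 2 * flat 3 (s y)) * ((- 2 / r\<^sup>2) * ((y - x) \<bullet> h)))) (at y)"
    using has_derivative_compose[OF s flat_deriv[of 2, THEN has_field_derivative_imp_has_derivative]]
    by (simp add: eval_nat_numeral)
  have "((\<lambda>y. (y - x) \<bullet> b) has_derivative (\<lambda>h. h \<bullet> b)) (at y)"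
    by (auto intro!: derivative_eq_intros)
  from has_derivative_mult[OF has_derivative_mult_right[OF D, of "- 2 / r\<^sup>2"] this]
  have "((\<lambda>y. - 2 / r\<^sup>2 * flat 2 (s y) * ((y - x) \<bullet> b)) has_derivative
      (\<lambda>h. - 2 / r\<^sup>2 * flat 2 (s y) * (h \<bullet> b) + - 2 / r\<^sup>2 *
        ((flat 4 (s y) - 2 * flat 3 (s y)) * ((- 2 / r\<^sup>2) * ((y - x) \<bullet> h))) * ((y - x) \<bullet> b))) (at y)" .
  from frechet_derivative_at[OF this, symmetric] show ?thesis
    unfolding frechet_derivative_bump[OF assms(1)] s_def
    using assms(1) by (simp add: power2_eq_square field_simps power4_eq_xxxx)
qed

text \<open>Summation over the basis turns the squared coordinates into |y - x|^2 and each
  \<open>b \<bullet> b\<close> into 1. With r = 1/t the result is, up to a factor, what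
  differentiating the mollifier in t produces.\<close>

lemma laplacian_bump:
  fixes x y :: "'a::euclidean_space"
  assumes "r > 0"
  defines "s \<equiv> 1 - (norm (y - x))\<^sup>2 / r\<^sup>2"
  shows "(\<Sum>b\<in>Basis. frechet_derivative (\<lambda>y. frechet_derivative (bump x r) (at y) b) (at y) b) =
    4 / r ^ 4 * (flat 4 s - 2 * flat 3 s) * (norm (y - x))\<^sup>2 - 2 * DIM('a) / r\<^sup>2 * flat 2 s"
proof -
  have "(norm (y - x))\<^sup>2 = (\<Sum>b\<in>Basis. ((y - x) \<bullet> b)\<^sup>2)"
    unfolding power2_norm_eq_inner euclidean_inner[of "y - x" "y - x"] by (simp add: power2_eq_square)
  then show ?thesis
    unfolding frechet_derivative2_bump[OF assms(1)] s_def
    by (simp add: sum_subtractf sum_distrib_left)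
qed

subsection \<open>Integration against continuous functions of compact support\<close>

lemma integral_translate:
  fixes f :: "'a::euclidean_space \<Rightarrow> 'b::{banach,second_countable_topology}"
  assumes [measurable]: "f \<in> borel_measurable borel"
  shows "(LINT x|lborel. f (z + x)) = (LINT x|lborel. f x)"
    and "integrable lborel (\<lambda>x. f (z + x)) \<longleftrightarrow> integrable lborel f"
proof -
  have "(LINT x|lborel. f x) = (LINT x|distr lborel borel ((+) z). f x)"
    by (simp add: lborel_distr_plus)
  then show "(LINT x|lborel. f (z + x)) = (LINT x|lborel. f x)"
    by (simp add: integral_distr)
  have "integrable lborel f \<longleftrightarrow> integrable (distr lborel borel ((+) z)) f"
    by (simp add: lborel_distr_plus)
  then show "integrable lborel (\<lambda>x. f (z + x)) \<longleftrightarrow> integrable lborel f"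
    by (simp add: integrable_distr_eq)
qed

lemma nn_integral_translate:
  assumes [measurable]: "f \<in> borel_measurable borel"
  shows "(\<integral>\<^sup>+x. f (z + x) \<partial>lborel) = (\<integral>\<^sup>+x. f x \<partial>lborel)"
proof -
  have "(\<integral>\<^sup>+x. f x \<partial>lborel) = (\<integral>\<^sup>+x. f x \<partial>distr lborel borel ((+) z))"
    by (simp add: lborel_distr_plus)
  then show ?thesis
    by (simp add: nn_integral_distr)
qed

lemma integral_affine:
  fixes f :: "'a::euclidean_space \<Rightarrow> real"
  assumes [measurable]: "f \<in> borel_measurable borel" and c: "c \<noteq> 0"
  shows "(LINT x|lborel. f x) = \<bar>c\<bar> ^ DIM('a) * (LINT x|lborel. f (t + c *\<^sub>R x))"
  by (subst lborel_affine[OF c, of t]) (simp add: integral_density integral_distr)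

lemma integrable_bounded_support:
  fixes f :: "'a::euclidean_space \<Rightarrow> real"
  assumes [measurable]: "f \<in> borel_measurable borel"
    and "\<And>x. \<bar>f x\<bar> \<le> B" "\<And>x. norm x > R \<Longrightarrow> f x = 0"
  shows "integrable lborel f"
proof (rule Bochner_Integration.integrable_bound)
  show "integrable lborel (\<lambda>x::'a. B * indicator (cball 0 R) x)"
    by (intro integrable_mult_right integrable_real_indicator)
      (use emeasure_lborel_cball_finite in \<open>auto simp: less_top\<close>)
  show "AE x in lborel. norm (f x) \<le> norm (B * indicator (cball 0 R) x)"
    using assms(2,3) by (intro AE_I2) (auto simp: indicator_def not_le intro: order_trans[OF _ abs_ge_self])
qed simp

lemma integrable_continuous_support:
  fixes f :: "'a::euclidean_space \<Rightarrow> real"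
  assumes "continuous_on UNIV f" "\<And>x. norm x > R \<Longrightarrow> f x = 0"
  shows "integrable lborel f"
  using continuous_compact_support_bounded[OF assms]
    integrable_bounded_support[OF borel_measurable_continuous_onI[OF assms(1)]] assms(2) by metis

lemma locally_integrable_integrable_mult:
  fixes f :: "'a::euclidean_space \<Rightarrow> real"
  assumes f: "locally_integrable f" and [measurable]: "h \<in> borel_measurable borel"
    and h: "\<And>x. \<bar>h x\<bar> \<le> B" "\<And>x. norm x > R \<Longrightarrow> h x = 0"
  shows "integrable lborel (\<lambda>x. f x * h x)"
proof (rule Bochner_Integration.integrable_bound)
  have [measurable]: "f \<in> borel_measurable borel"
    using f by (simp add: locally_integrable_def)
  have "integrable lborel (\<lambda>x. indicator (cball 0 R) x *\<^sub>R f x)"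
    using f by (auto simp: locally_integrable_def set_integrable_def)
  then show "integrable lborel (\<lambda>x. B * (indicator (cball 0 R) x *\<^sub>R f x))"
    by (rule integrable_mult_right)
  show "(\<lambda>x. f x * h x) \<in> borel_measurable lborel" by simp
  have "B \<ge> 0" using h(1)[of 0] by linarith
  then show "AE x in lborel. norm (f x * h x) \<le> norm (B * (indicator (cball 0 R) x *\<^sub>R f x))"
    using h by (intro AE_I2)
      (auto simp: indicator_def not_le abs_mult mult.commute[of B] intro!: mult_left_mono)
qed

lemma locally_integrable_lincomb:
  fixes f g :: "'a::euclidean_space \<Rightarrow> real"
  assumes "locally_integrable f" "locally_integrable g"
  shows "locally_integrable (\<lambda>x. c * f x + d * g x)"
proof -
  have "set_integrable lborel K (\<lambda>x. c * f x + d * g x)" if "compact K" for K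
    using assms that by (intro set_integral_add set_integrable_mult_right)
      (auto simp: locally_integrable_def)
  then show ?thesis
    using assms by (auto simp: locally_integrable_def)
qed

lemma locally_integrable_of_bounded_on_balls:
  fixes f :: "'a::euclidean_space \<Rightarrow> real"
  assumes [measurable]: "f \<in> borel_measurable borel"
    and "\<And>R. \<exists>B. \<forall>x. norm x \<le> R \<longrightarrow> \<bar>f x\<bar> \<le> B"
  shows "locally_integrable f"
proof -
  have "set_integrable lborel K f" if K: "compact K" for K
  proof -
    obtain R where R: "\<And>x. x \<in> K \<Longrightarrow> norm x \<le> R"
      using K compact_imp_bounded bounded_iff by metis
    obtain B where B: "\<And>x. norm x \<le> R \<Longrightarrow> \<bar>f x\<bar> \<le> B"
      using assms(2) by blast
    have [measurable]: "K \<in> sets borel" using K by (simp add: borel_compact)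
    have "\<bar>indicator K x * f x\<bar> \<le> max 0 B" for x
      using R B by (fastforce simp: indicator_def)
    moreover have "indicator K x * f x = 0" if "norm x > R" for x
      using R that by (fastforce simp: indicator_def)
    ultimately show ?thesis
      unfolding set_integrable_def real_scaleR_def
      by (intro integrable_bounded_support[of _ "max 0 B" R]) auto
  qed
  then show ?thesis
    by (simp add: locally_integrable_def)
qed

lemma locally_integrable_inner:
  assumes "locally_integrable g"
  shows "locally_integrable (\<lambda>x. g x \<bullet> b)"
proof -
  have "set_integrable lborel K (\<lambda>x. g x \<bullet> b)" if "compact K" for K
  proof -
    have "integrable lborel (\<lambda>x. indicator K x *\<^sub>R g x)"
      using assms that by (auto simp: locally_integrable_def set_integrable_def)
    from integrable_inner_left[OF this, of b] show ?thesis
      by (simp add: set_integrable_def)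
  qed
  then show ?thesis
    using assms by (auto simp: locally_integrable_def)
qed

section \<open>From inequalities between integrals to inequalities almost everywhere\<close>

text \<open>If g were negative on a set of positive measure, inner regularity would give a closed
  subset that still has positive measure. Its indicator is a limit of continuous tent functions, so
  the integral of the negative function g over it would be nonnegative.\<close>

lemma AE_nonneg_of_continuous_tests:
  fixes g :: "'a::euclidean_space \<Rightarrow> real"
  assumes g: "locally_integrable g"
    and pos: "\<And>\<psi> R. continuous_on UNIV \<psi> \<Longrightarrow> (\<And>x. \<psi> x \<ge> 0) \<Longrightarrow> (\<And>x. norm x > R \<Longrightarrow> \<psi> x = 0) \<Longrightarrow>
      0 \<le> (LINT x|lborel. g x * \<psi> x)"
  shows "AE x in lborel. g x \<ge> 0"
proof -
  have [measurable]: "g \<in> borel_measurable borel"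
    using g by (simp add: locally_integrable_def)
  have null: "emeasure lborel ({x. g x < 0} \<inter> cball 0 (real n)) = 0" for n
  proof (rule ccontr)
    define A where "A = {x. g x < 0} \<inter> cball 0 (real n)"
    have A [measurable]: "A \<in> sets borel" unfolding A_def by measurable
    assume "emeasure lborel ({x. g x < 0} \<inter> cball 0 (real n)) \<noteq> 0"
    then have "emeasure lborel A > 0" by (simp add: A_def zero_less_iff_neq_zero)
    moreover have "emeasure lborel A < \<infinity>"
      by (rule le_less_trans[OF emeasure_mono emeasure_lborel_cball_finite[of 0 "real n"]])
        (auto simp: A_def)
    ultimately obtain e where e: "e > 0" "emeasure lborel A = ennreal e"
      by (cases "emeasure lborel A") auto
    have AL: "A \<in> sets lebesgue"
      by (rule sets_completionI_sets) (simp add: A)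
    \<comment> \<open>The tolerance is the measure of A itself, so C cannot be a null set.\<close>
    obtain C where C: "closed C" "C \<subseteq> A" "A - C \<in> lmeasurable" "emeasure lebesgue (A - C) < ennreal e"
      by (rule sets_lebesgue_inner_closed[OF AL e(1)])
    have [measurable]: "C \<in> sets borel" using C(1) by simp
    have "emeasure lborel (A - C) < ennreal e"
      using C(4) by simp
    moreover have "emeasure lborel A = emeasure lborel C + emeasure lborel (A - C)"
      using C(2) by (subst plus_emeasure) (auto simp: Un_absorb1)
    ultimately have Cpos: "emeasure lborel C \<noteq> 0"
      using e(2) by auto
    then have "C \<noteq> {}" by auto
    \<comment> \<open>Tents equal to 1 on C that vanish at distance 1/(k + 1) from it. They decrease
      to the indicator because C is closed, and all of them live in the ball of radius n +
      1.\<close>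
    define \<psi> where "\<psi> k x = max 0 (1 - real (Suc k) * infdist x C)" for k x
    have cont: "continuous_on UNIV (\<psi> k)" for k
      unfolding \<psi>_def by (intro continuous_intros continuous_on_infdist)
    have supp: "\<psi> k x = 0" if x: "norm x > real n + 1" for k x
    proof -
      obtain y where y: "y \<in> C" "infdist x C = dist x y"
        using infdist_attains_inf[OF C(1) \<open>C \<noteq> {}\<close>] by blast
      then have "norm y \<le> real n" using C(2) by (auto simp: A_def)
      then have "dist x y \<ge> 1"
        using x norm_triangle_ineq2[of x y] by (simp add: dist_norm)
      then have "real (Suc k) * infdist x C \<ge> 1"
        using y(2) mult_mono[of 1 "real (Suc k)" 1 "dist x y"] by simp
      then show ?thesis by (simp add: \<psi>_def)
    qed
    have nn: "0 \<le> \<psi> k x" and le1: "\<psi> k x \<le> 1" for k x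
      by (auto simp: \<psi>_def infdist_nonneg)
    have "(\<lambda>k. LINT x|lborel. g x * \<psi> k x) \<longlonglongrightarrow> (LINT x|lborel. g x * indicator C x)"
    proof (rule integral_dominated_convergence[where
          w="\<lambda>x. \<bar>indicator (cball 0 (real n + 1)) x *\<^sub>R g x\<bar>"])
      have [measurable]: "\<psi> k \<in> borel_measurable borel" for k
        using cont by (rule borel_measurable_continuous_onI)
      show "(\<lambda>x. g x * \<psi> k x) \<in> borel_measurable lborel" for k by simp
      show "integrable lborel (\<lambda>x. \<bar>indicator (cball 0 (real n + 1)) x *\<^sub>R g x\<bar>)"
        using g by (auto simp: locally_integrable_def set_integrable_def)
      have "(\<lambda>k. \<psi> k x) \<longlonglongrightarrow> indicator C x" for x
      proof (cases "x \<in> C")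
        case True
        then show ?thesis by (simp add: \<psi>_def)
      next
        case False
        then have "infdist x C > 0"
          using infdist_pos_not_in_closed[OF C(1) \<open>C \<noteq> {}\<close>] by simp
        then obtain K :: nat where "1 < real K * infdist x C"
          using ex_less_of_nat_mult by blast
        then have "1 < real (Suc K) * infdist x C"
          using \<open>infdist x C > 0\<close> by (simp add: distrib_right)
        then have "\<psi> k x = 0" if "k \<ge> K" for k
          using that mult_right_mono[of "real (Suc K)" "real (Suc k)" "infdist x C"]
          by (simp add: \<psi>_def infdist_nonneg)
        then show ?thesis
          using False by (intro tendsto_eventually) (auto simp: eventually_sequentially)
      qed
      then show "AE x in lborel. (\<lambda>k. g x * \<psi> k x) \<longlonglongrightarrow> g x * indicator C x"
        by (intro AE_I2 tendsto_intros)
      show "AE x in lborel. norm (g x * \<psi> k x) \<le> \<bar>indicator (cball 0 (real n + 1)) x *\<^sub>R g x\<bar>" for k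
        using supp nn le1 by (intro AE_I2) (auto simp: indicator_def abs_mult not_le mult_left_le)
    qed simp
    then have "0 \<le> (LINT x|lborel. g x * indicator C x)"
      using LIMSEQ_le_const pos[OF cont nn supp] by blast
    then have "(LINT x|lborel. - (g x * indicator C x)) \<le> 0" by simp
    moreover have nn': "AE x in lborel. 0 \<le> - (g x * indicator C x)"
      using C(2) by (intro AE_I2) (auto simp: A_def indicator_def)
    moreover have int: "integrable lborel (\<lambda>x. - (g x * indicator C x))"
    proof -
      have "norm x > real n \<Longrightarrow> indicator C x = (0::real)" for x
        using C(2) by (auto simp: A_def indicator_def)
      then show ?thesis
        using locally_integrable_integrable_mult[OF g, of "indicator C" 1 "real n"]
        by (auto simp: indicator_def)
    qed
    ultimately have "(LINT x|lborel. - (g x * indicator C x)) = 0"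
      by (metis antisym integral_nonneg_AE)
    then have "AE x in lborel. - (g x * indicator C x) = 0"
      using integral_nonneg_eq_0_iff_AE[OF int nn'] by blast
    then have "AE x in lborel. x \<notin> C"
      by eventually_elim (use C(2) in \<open>auto simp: A_def indicator_def split: if_splits\<close>)
    then have "emeasure lborel C = 0"
      using AE_iff_measurable[of C lborel "\<lambda>x. x \<notin> C"] by simp
    with Cpos show False ..
  qed
  have "AE x in lborel. x \<notin> {x. g x < 0} \<inter> cball 0 (real n)" for n
    using null[of n] by (intro AE_not_in) (auto simp: null_sets_def)
  then have "AE x in lborel. \<forall>n. x \<notin> {x. g x < 0} \<inter> cball 0 (real n)"
    unfolding AE_all_countable by blast
  then show ?thesis
    by eventually_elim (use real_arch_simple not_le in \<open>fastforce\<close>)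
qed

lemma integrable_tensor:
  fixes f g :: "'a::euclidean_space \<Rightarrow> real"
  assumes "integrable lborel f" "integrable lborel g"
  shows "integrable (lborel \<Otimes>\<^sub>M lborel) (\<lambda>(x, y). f x * g y)"
proof (rule lborel_pair.Fubini_integrable)
  have [measurable]: "f \<in> borel_measurable borel" "g \<in> borel_measurable borel"
    using assms by auto
  show "(\<lambda>(x, y). f x * g y) \<in> borel_measurable (lborel \<Otimes>\<^sub>M lborel)" by simp
  show "integrable lborel (\<lambda>x. LINT y|lborel. norm (case (x, y) of (x, y) \<Rightarrow> f x * g y))"
    using assms by (simp add: abs_mult)
  show "AE x in lborel. integrable lborel (\<lambda>y. case (x, y) of (x, y) \<Rightarrow> f x * g y)"
    using assms by simp
qed

text \<open>Test with \<open>\<psi> \<ge> 0\<close> and let Fubini move the mollification from u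
  onto \<open>\<psi>\<close>. There it converges pointwise and boundedly by continuity, so dominated
  convergence applies to a merely locally integrable u. The kernel is not normalized, whence the
  factor on the right.\<close>

lemma AE_le_of_mollified:
  fixes u h \<eta> :: "'a::euclidean_space \<Rightarrow> real"
  assumes u: "locally_integrable u" and h: "locally_integrable h"
    and \<eta>: "continuous_on UNIV \<eta>" "\<And>z. \<eta> z \<ge> 0" "\<And>z. norm z > 1 \<Longrightarrow> \<eta> z = 0"
    and le: "\<And>\<epsilon> x. 0 < \<epsilon> \<Longrightarrow> \<epsilon> \<le> 1 \<Longrightarrow>
      h x \<le> (LINT y|lborel. u y * (\<eta> ((1 / \<epsilon>) *\<^sub>R (y - x)) / \<epsilon> ^ DIM('a)))"
  shows "AE x in lborel. h x \<le> (LINT z|lborel. \<eta> z) * u x"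
proof -
  define m where "m = (LINT z|lborel. \<eta> z)"
  have [measurable]: "u \<in> borel_measurable borel" "h \<in> borel_measurable borel"
    using u h by (auto simp: locally_integrable_def)
  have [measurable]: "\<eta> \<in> borel_measurable borel"
    using \<eta>(1) by (rule borel_measurable_continuous_onI)
  obtain B where B: "\<And>z. \<bar>\<eta> z\<bar> \<le> B" "B \<ge> 0"
    using continuous_compact_support_bounded[OF \<eta>(1,3)] by blast
  have int\<eta>: "integrable lborel \<eta>"
    using \<eta>(1,3) by (rule integrable_continuous_support)
  have "AE x in lborel. m * u x + (- 1) * h x \<ge> 0"
  proof (rule AE_nonneg_of_continuous_tests[OF locally_integrable_lincomb[OF u h]])
    fix \<psi> :: "'a \<Rightarrow> real" and R
    assume \<psi>: "continuous_on UNIV \<psi>" "\<And>x. \<psi> x \<ge> 0" "\<And>x. norm x > R \<Longrightarrow> \<psi> x = 0"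
    have [measurable]: "\<psi> \<in> borel_measurable borel"
      using \<psi>(1) by (rule borel_measurable_continuous_onI)
    obtain B' where B': "\<And>x. \<bar>\<psi> x\<bar> \<le> B'" "B' \<ge> 0"
      using continuous_compact_support_bounded[OF \<psi>(1,3)] by blast
    note int\<psi> = locally_integrable_integrable_mult[OF _ _ B'(1) \<psi>(3)]
    \<comment> \<open>The mollified test function; the substitution x = y -
      \<open>\<epsilon>\<close> z below produces it from the kernel centred at x.\<close>
    define \<Psi> where "\<Psi> \<epsilon> y = (LINT z|lborel. \<eta> z * \<psi> (y - \<epsilon> *\<^sub>R z))" for \<epsilon> y
    \<comment> \<open>For \<open>\<epsilon> \<le> 1\<close> everything stays in the ball of radius R
      + 1, which allows one dominating function for all scales.\<close>
    have supp: "\<eta> z * \<psi> (y - \<epsilon> *\<^sub>R z) = 0" if "norm y > R + 1" "0 < \<epsilon>" "\<epsilon> \<le> 1" for y z \<epsilon>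
    proof (cases "norm z > 1")
      case False
      then have "\<epsilon> * norm z \<le> 1 * 1"
        using that by (intro mult_mono) auto
      then have "norm (y - \<epsilon> *\<^sub>R z) > R"
        using that norm_triangle_ineq2[of y "\<epsilon> *\<^sub>R z"] by simp
      then show ?thesis using \<psi>(3) by simp
    qed (simp add: \<eta>(3))
    have bound: "(LINT x|lborel. h x * \<psi> x) \<le> (LINT y|lborel. u y * \<Psi> \<epsilon> y)"
      if \<epsilon>: "0 < \<epsilon>" "\<epsilon> \<le> 1" for \<epsilon>
    proof -
      let ?F = "\<lambda>x y. u y * (\<eta> ((1 / \<epsilon>) *\<^sub>R (y - x)) / \<epsilon> ^ DIM('a)) * \<psi> x"
      have intF: "integrable (lborel \<Otimes>\<^sub>M lborel) (\<lambda>(x, y). ?F x y)"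
      proof (rule Bochner_Integration.integrable_bound)
        have "integrable lborel (\<lambda>y. u y * indicator (cball 0 (R + 1)) y)"
          by (rule locally_integrable_integrable_mult[OF u, of _ 1 "R + 1"])
            (auto simp: indicator_def)
        moreover have "integrable lborel (\<lambda>x. B / \<epsilon> ^ DIM('a) * \<psi> x)"
          using integrable_continuous_support[OF \<psi>(1,3)] by simp
        ultimately show "integrable (lborel \<Otimes>\<^sub>M lborel)
            (\<lambda>(x, y). (B / \<epsilon> ^ DIM('a) * \<psi> x) * (u y * indicator (cball 0 (R + 1)) y))"
          by (intro integrable_tensor)
        have "\<bar>?F x y\<bar> \<le> \<bar>(B / \<epsilon> ^ DIM('a) * \<psi> x) * (u y * indicator (cball 0 (R + 1)) y)\<bar>" for x y
        proof (cases "norm y > R + 1")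
          case True
          have "\<eta> ((1 / \<epsilon>) *\<^sub>R (y - x)) * \<psi> (y - \<epsilon> *\<^sub>R ((1 / \<epsilon>) *\<^sub>R (y - x))) = 0"
            by (rule supp[OF True \<epsilon>])
          then show ?thesis using \<epsilon> by auto
        next
          case False
          then have "\<bar>u y\<bar> * \<bar>\<psi> x\<bar> * \<bar>\<eta> ((1 / \<epsilon>) *\<^sub>R (y - x))\<bar> / \<epsilon> ^ DIM('a)
              \<le> \<bar>u y\<bar> * \<bar>\<psi> x\<bar> * B / \<epsilon> ^ DIM('a)"
            using \<epsilon> B by (intro divide_right_mono mult_left_mono) auto
          then show ?thesis
            using False \<epsilon> B(2) by (simp add: abs_mult mult_ac not_less)
        qed
        then show "AE x in lborel \<Otimes>\<^sub>M lborel. norm (case x of (x, y) \<Rightarrow> ?F x y) \<le>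
          norm (case x of (x, y) \<Rightarrow> (B / \<epsilon> ^ DIM('a) * \<psi> x) * (u y * indicator (cball 0 (R + 1)) y))"
          by (intro AE_I2) auto
      qed simp
      have "(LINT x|lborel. h x * \<psi> x) \<le> (LINT x|lborel. LINT y|lborel. ?F x y)"
      proof (rule integral_mono)
        show "integrable lborel (\<lambda>x. h x * \<psi> x)" by (rule int\<psi>[OF h]) simp
        show "integrable lborel (\<lambda>x. LINT y|lborel. ?F x y)"
          using lborel_pair.integrable_fst[OF intF] by simp
        show "h x * \<psi> x \<le> (LINT y|lborel. ?F x y)" for x
          using mult_right_mono[OF le[OF \<epsilon>] \<psi>(2)] by simp
      qed
      also have "\<dots> = (LINT y|lborel. LINT x|lborel. ?F x y)"
        by (rule lborel_pair.Fubini_integral[OF intF, symmetric])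
      also have "\<dots> = (LINT y|lborel. u y * \<Psi> \<epsilon> y)"
      proof (rule Bochner_Integration.integral_cong)
        fix y
        have "(LINT x|lborel. ?F x y) =
            u y * ((LINT x|lborel. \<eta> ((1 / \<epsilon>) *\<^sub>R (y - x)) * \<psi> x) / \<epsilon> ^ DIM('a))"
          by (simp flip: integral_mult_right_zero integral_divide_zero add: mult_ac)
        also have "(LINT x|lborel. \<eta> ((1 / \<epsilon>) *\<^sub>R (y - x)) * \<psi> x) = \<epsilon> ^ DIM('a) * \<Psi> \<epsilon> y"
          using \<epsilon> by (subst integral_affine[of _ "- \<epsilon>" y]) (auto simp: \<Psi>_def)
        finally show "(LINT x|lborel. ?F x y) = u y * \<Psi> \<epsilon> y"
          using \<epsilon> by simp
      qed simp
      finally show ?thesis .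
    qed
    let ?e = "\<lambda>n. 1 / real (Suc n)"
    have \<Psi>_lim: "(\<lambda>n. \<Psi> (?e n) y) \<longlonglongrightarrow> m * \<psi> y" for y
    proof -
      have "(\<lambda>n. \<Psi> (?e n) y) \<longlonglongrightarrow> (LINT z|lborel. \<eta> z * \<psi> y)"
        unfolding \<Psi>_def
      proof (rule integral_dominated_convergence[where w="\<lambda>z. B' * \<eta> z"])
        have "(\<lambda>n. y - ?e n *\<^sub>R z) \<longlonglongrightarrow> y - 0 *\<^sub>R z" for z
          by (intro tendsto_intros LIMSEQ_Suc lim_1_over_n)
        then have "(\<lambda>n. \<psi> (y - ?e n *\<^sub>R z)) \<longlonglongrightarrow> \<psi> y" for z
          using continuous_on_tendsto_compose[OF \<psi>(1), of "\<lambda>n. y - ?e n *\<^sub>R z" y] by simp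
        then show "AE z in lborel. (\<lambda>n. \<eta> z * \<psi> (y - ?e n *\<^sub>R z)) \<longlonglongrightarrow> \<eta> z * \<psi> y"
          by (intro AE_I2 tendsto_intros)
        show "AE z in lborel. norm (\<eta> z * \<psi> (y - ?e n *\<^sub>R z)) \<le> B' * \<eta> z" for n
          using B' \<eta>(2) by (intro AE_I2) (auto simp: abs_mult mult.commute[of B'] intro!: mult_left_mono)
      qed (use int\<eta> in auto)
      then show ?thesis by (simp add: m_def)
    qed
    have [measurable]: "\<Psi> \<epsilon> \<in> borel_measurable borel" for \<epsilon>
      unfolding \<Psi>_def by measurable
    have "(\<lambda>n. LINT y|lborel. u y * \<Psi> (?e n) y) \<longlonglongrightarrow> (LINT y|lborel. u y * (m * \<psi> y))"
    proof (rule integral_dominated_convergence[where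
          w="\<lambda>y. \<bar>u y * (B' * m * indicator (cball 0 (R + 1)) y)\<bar>"])
      have m0: "m \<ge> 0" unfolding m_def by (simp add: \<eta>(2))
      show "integrable lborel (\<lambda>y. \<bar>u y * (B' * m * indicator (cball 0 (R + 1)) y)\<bar>)"
        by (intro integrable_abs locally_integrable_integrable_mult[OF u, of _ "B' * m" "R + 1"])
          (use m0 B'(2) in \<open>auto simp: indicator_def\<close>)
      show "AE y in lborel. (\<lambda>n. u y * \<Psi> (?e n) y) \<longlonglongrightarrow> u y * (m * \<psi> y)"
        using \<Psi>_lim by (intro AE_I2 tendsto_intros)
      have "\<bar>\<Psi> (?e n) y\<bar> \<le> B' * m" for n y
      proof -
        have "\<bar>\<Psi> (?e n) y\<bar> \<le> (LINT z|lborel. B' * \<eta> z)"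
          unfolding \<Psi>_def
          by (rule integral_abs_bound[THEN order_trans], rule integral_mono)
            (use int\<eta> B' \<eta>(2) in \<open>auto simp: abs_mult mult.commute[of B'] intro!: mult_left_mono AE_I2
              Bochner_Integration.integrable_bound[OF int\<eta>[THEN integrable_mult_right, of B']]\<close>)
        then show ?thesis by (simp add: m_def)
      qed
      moreover have "\<Psi> (?e n) y = 0" if "norm y > R + 1" for n y
      proof -
        have "\<eta> z * \<psi> (y - ?e n *\<^sub>R z) = 0" for z
          by (rule supp[OF that]) auto
        then show ?thesis
          unfolding \<Psi>_def by (simp only: integral_zero)
      qed
      ultimately show "AE y in lborel. norm (u y * \<Psi> (?e n) y)
          \<le> \<bar>u y * (B' * m * indicator (cball 0 (R + 1)) y)\<bar>" for n
        using m0 B'(2) by (intro AE_I2) (auto simp: abs_mult indicator_def not_le intro!: mult_left_mono)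
    qed auto
    then have "(LINT x|lborel. h x * \<psi> x) \<le> (LINT y|lborel. u y * (m * \<psi> y))"
      by (rule LIMSEQ_le_const) (use bound in auto)
    moreover have "(LINT x|lborel. (m * u x + - 1 * h x) * \<psi> x) =
        (LINT x|lborel. u x * (m * \<psi> x)) - (LINT x|lborel. h x * \<psi> x)"
    proof -
      have [simp]: "integrable lborel (\<lambda>x. u x * \<psi> x)" "integrable lborel (\<lambda>x. h x * \<psi> x)"
        using int\<psi>[OF u, of "\<lambda>x. x"] int\<psi>[OF h, of "\<lambda>x. x"] by auto
      have "(LINT x|lborel. (m * u x + - 1 * h x) * \<psi> x) =
          (LINT x|lborel. m * (u x * \<psi> x) - h x * \<psi> x)"
        by (simp add: algebra_simps)
      also have "\<dots> = m * (LINT x|lborel. u x * \<psi> x) - (LINT x|lborel. h x * \<psi> x)"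
        by simp
      also have "m * (LINT x|lborel. u x * \<psi> x) = (LINT x|lborel. u x * (m * \<psi> x))"
        by (simp add: mult_ac flip: integral_mult_right_zero)
      finally show ?thesis .
    qed
    ultimately show "0 \<le> (LINT x|lborel. (m * u x + - 1 * h x) * \<psi> x)" by simp
  qed
  then show ?thesis by (simp add: m_def)
qed

subsection \<open>Weak gradients\<close>

lemma test_function_line_deriv:
  assumes "test_function \<phi>"
  shows "((\<lambda>t. \<phi> (x + t *\<^sub>R b)) has_real_derivative frechet_derivative \<phi> (at (x + t *\<^sub>R b)) b) (at t)"
proof -
  have "((\<lambda>t. x + t *\<^sub>R b) has_derivative (\<lambda>h. h *\<^sub>R b)) (at t)"
    by (auto intro!: derivative_eq_intros)
  from has_derivative_compose[OF this test_function_has_derivative[OF assms]]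
  have "((\<lambda>t. \<phi> (x + t *\<^sub>R b)) has_derivative
      (\<lambda>h. frechet_derivative \<phi> (at (x + t *\<^sub>R b)) (h *\<^sub>R b))) (at t)" .
  moreover have "(\<lambda>h. frechet_derivative \<phi> (at (x + t *\<^sub>R b)) (h *\<^sub>R b)) =
      (*) (frechet_derivative \<phi> (at (x + t *\<^sub>R b)) b)"
    using linear_scale[OF has_derivative_linear[OF test_function_has_derivative[OF assms]]]
    by (simp add: fun_eq_iff mult.commute)
  ultimately show ?thesis
    by (simp add: has_field_derivative_def)
qed

text \<open>The difference quotients have integral zero by translation invariance.\<close>

lemma integral_partial_test_function:
  fixes \<phi> :: "'a::euclidean_space \<Rightarrow> real"
  assumes \<phi>: "test_function \<phi>" and b: "b \<in> Basis"
  shows "(LINT x|lborel. frechet_derivative \<phi> (at x) b) = 0"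
proof -
  let ?D = "\<lambda>x. frechet_derivative \<phi> (at x) b"
  let ?q = "\<lambda>n x. (\<phi> (x + (1 / real (Suc n)) *\<^sub>R b) - \<phi> x) * real (Suc n)"
  have D: "test_function ?D" using \<phi> b by (rule test_function_partial)
  obtain B where B: "B \<ge> 0" "\<And>x. \<bar>?D x\<bar> \<le> B" using test_function_bounded[OF D] by blast
  obtain R where R: "R > 0" "\<And>x. norm x > R \<Longrightarrow> \<phi> x = 0" using test_function_support[OF \<phi>] by blast
  have cont: "continuous_on UNIV \<phi>" using \<phi> by (rule test_function_continuous)
  have [measurable]: "\<phi> \<in> borel_measurable borel" "?D \<in> borel_measurable borel"
    using cont test_function_continuous[OF D] by (auto intro: borel_measurable_continuous_onI)
  have "(\<lambda>n. LINT x|lborel. ?q n x) \<longlonglongrightarrow> (LINT x|lborel. ?D x)"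
  proof (rule integral_dominated_convergence[where w="\<lambda>x. B * indicator (cball 0 (R + 1)) x"])
    show "integrable lborel (\<lambda>x. B * indicator (cball 0 (R + 1)) x)"
      by (rule integrable_bounded_support[of _ B "R + 1"]) (use B in \<open>auto simp: indicator_def\<close>)
    have "(\<lambda>n. ?q n x) \<longlonglongrightarrow> ?D x" for x
    proof -
      have "((\<lambda>h. (\<phi> (x + h *\<^sub>R b) - \<phi> x) / h) \<longlongrightarrow> ?D x) (at 0)"
        using test_function_line_deriv[OF \<phi>, of x b 0] by (simp add: DERIV_def)
      moreover have "filterlim (\<lambda>n. 1 / real (Suc n)) (at 0) sequentially"
        using LIMSEQ_Suc[OF lim_1_over_n] by (auto simp: filterlim_at)
      ultimately have "(\<lambda>n. (\<phi> (x + (1 / real (Suc n)) *\<^sub>R b) - \<phi> x) / (1 / real (Suc n))) \<longlonglongrightarrow> ?D x"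
        by (rule filterlim_compose)
      then show ?thesis by simp
    qed
    then show "AE x in lborel. (\<lambda>n. ?q n x) \<longlonglongrightarrow> ?D x" by simp
    have "\<bar>?q n x\<bar> \<le> B * indicator (cball 0 (R + 1)) x" for n x
    proof (cases "norm x > R + 1")
      case True
      have "norm ((1 / real (Suc n)) *\<^sub>R b) \<le> 1" using b by simp
      moreover have "norm x \<le> norm (x + v) + norm v" for v
        using norm_triangle_ineq4[of "x + v" v] by simp
      ultimately have "norm (x + (1 / real (Suc n)) *\<^sub>R b) > R"
        using True by (smt (verit))
      then show ?thesis using R(2) True by simp
    next
      case False
      \<comment> \<open>The mean value theorem bounds the quotients by the bound B of the partial
        derivative, uniformly in n.\<close>
      have "\<exists>z. 0 < z \<and> z < 1 / real (Suc n) \<and>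
          \<phi> (x + (1 / real (Suc n)) *\<^sub>R b) - \<phi> (x + 0 *\<^sub>R b) =
          (1 / real (Suc n) - 0) * ?D (x + z *\<^sub>R b)"
        by (rule MVT2) (auto intro: test_function_line_deriv[OF \<phi>])
      then obtain z where "\<phi> (x + (1 / real (Suc n)) *\<^sub>R b) - \<phi> (x + 0 *\<^sub>R b) =
          (1 / real (Suc n) - 0) * ?D (x + z *\<^sub>R b)"
        by blast
      then have "?q n x = ?D (x + z *\<^sub>R b)" by simp
      then show ?thesis using False B(2) by (simp add: not_less)
    qed
    then show "AE x in lborel. norm (?q n x) \<le> B * indicator (cball 0 (R + 1)) x" for n
      by simp
  qed auto
  moreover have "(LINT x|lborel. ?q n x) = 0" for n
  proof -
    have int: "integrable lborel \<phi>" by (rule integrable_continuous_support[OF cont R(2)])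
    then show ?thesis
      using integral_translate[of \<phi> "(1 / real (Suc n)) *\<^sub>R b"] by (simp add: add.commute)
  qed
  ultimately show ?thesis
    by (simp add: LIMSEQ_const_iff)
qed

lemma test_function_measurable: "test_function \<phi> \<Longrightarrow> \<phi> \<in> borel_measurable borel"
  by (intro borel_measurable_continuous_onI test_function_continuous)

lemma test_function_integrable_mult:
  assumes "locally_integrable f" "test_function \<phi>"
  shows "integrable lborel (\<lambda>x. f x * \<phi> x)"
proof -
  obtain B where B: "\<And>x. \<bar>\<phi> x\<bar> \<le> B" using test_function_bounded[OF assms(2)] by blast
  obtain R where R: "\<And>x. norm x > R \<Longrightarrow> \<phi> x = 0" using test_function_support[OF assms(2)] by blast
  show ?thesis
    using B R by (rule locally_integrable_integrable_mult[OF assms(1) test_function_measurable[OF assms(2)]])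
qed

lemma locally_integrable_test_function:
  assumes "test_function \<phi>"
  shows "locally_integrable \<phi>"
proof -
  obtain B where "\<And>x. \<bar>\<phi> x\<bar> \<le> B" using test_function_bounded[OF assms] by blast
  then show ?thesis
    by (intro locally_integrable_of_bounded_on_balls test_function_measurable[OF assms]) auto
qed

definition grad :: "('a::euclidean_space \<Rightarrow> real) \<Rightarrow> 'a \<Rightarrow> 'a" where
  "grad \<phi> x = (\<Sum>b\<in>Basis. frechet_derivative \<phi> (at x) b *\<^sub>R b)"

lemma grad_inner: "b \<in> Basis \<Longrightarrow> grad \<phi> x \<bullet> b = frechet_derivative \<phi> (at x) b"
  by (simp add: grad_def inner_sum_left_Basis)

lemma locally_integrable_of_inner:
  fixes g :: "'a::euclidean_space \<Rightarrow> 'a"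
  assumes "\<And>b. b \<in> Basis \<Longrightarrow> locally_integrable (\<lambda>x. g x \<bullet> b)"
  shows "locally_integrable g"
proof -
  have *: "g = (\<lambda>x. \<Sum>b\<in>Basis. (g x \<bullet> b) *\<^sub>R b)"
    by (simp add: euclidean_representation)
  have "set_integrable lborel K g" if "compact K" for K
  proof -
    have "integrable lborel (\<lambda>x. \<Sum>b\<in>Basis. (indicator K x *\<^sub>R (g x \<bullet> b)) *\<^sub>R b)"
      using assms that by (intro Bochner_Integration.integrable_sum integrable_scaleR_left)
        (auto simp: locally_integrable_def set_integrable_def)
    then show ?thesis
      unfolding set_integrable_def
      by (subst *) (simp add: scaleR_sum_right)
  qed
  moreover have "g \<in> borel_measurable lborel"
    using assms by (subst *) (auto simp: locally_integrable_def intro!: borel_measurable_sum borel_measurable_scaleR)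
  ultimately show ?thesis by (simp add: locally_integrable_def)
qed

text \<open>Integration by parts: the product rule splits the partial derivative of
  \<open>\<phi> x * \<psi> x\<close>, whose integral is 0.\<close>

lemma is_weak_gradient_test_function:
  fixes \<phi> :: "'a::euclidean_space \<Rightarrow> real"
  assumes \<phi>: "test_function \<phi>"
  shows "is_weak_gradient \<phi> (grad \<phi>)"
  unfolding is_weak_gradient_def
proof (intro conjI allI impI ballI)
  show "locally_integrable \<phi>" using \<phi> by (rule locally_integrable_test_function)
  show "locally_integrable (grad \<phi>)"
    by (rule locally_integrable_of_inner)
      (simp add: grad_inner locally_integrable_test_function test_function_partial \<phi>)
  fix \<psi> :: "'a \<Rightarrow> real" and b :: 'a
  assume \<psi>: "test_function \<psi>" and b: "b \<in> Basis"
  have "frechet_derivative (\<lambda>x. \<phi> x * \<psi> x) (at x) b =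
      \<phi> x * frechet_derivative \<psi> (at x) b + frechet_derivative \<phi> (at x) b * \<psi> x" for x
    using frechet_derivative_at[OF has_derivative_mult[OF test_function_has_derivative[OF \<phi>]
          test_function_has_derivative[OF \<psi>]], symmetric, of x] by simp
  then have "(LINT x|lborel. \<phi> x * frechet_derivative \<psi> (at x) b + frechet_derivative \<phi> (at x) b * \<psi> x) = 0"
    using integral_partial_test_function[OF test_function_mult[OF \<phi> \<psi>] b] by simp
  then have "(LINT x|lborel. \<phi> x * frechet_derivative \<psi> (at x) b)
      + (LINT x|lborel. frechet_derivative \<phi> (at x) b * \<psi> x) = 0"
    by (subst (asm) Bochner_Integration.integral_add)
      (auto intro!: test_function_integrable_mult locally_integrable_test_function
        test_function_partial \<phi> \<psi> b)
  then show "(LINT x|lborel. \<phi> x * frechet_derivative \<psi> (at x) b) =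
      - (LINT x|lborel. (grad \<phi> x \<bullet> b) * \<psi> x)"
    by (simp add: grad_inner b)
qed

lemma integral_pos_of_pos_on_ball:
  fixes \<eta> :: "'a::euclidean_space \<Rightarrow> real"
  assumes \<eta>: "continuous_on UNIV \<eta>" "\<And>z. \<eta> z \<ge> 0" "\<And>z. norm z > 1 \<Longrightarrow> \<eta> z = 0"
    and pos: "\<And>z. norm z < 1 \<Longrightarrow> \<eta> z > 0"
  shows "(LINT z|lborel. \<eta> z) > 0"
proof -
  have int: "integrable lborel \<eta>"
    using \<eta>(1,3) by (rule integrable_continuous_support)
  have "(LINT z|lborel. \<eta> z) \<noteq> 0"
  proof
    assume "(LINT z|lborel. \<eta> z) = 0"
    then have "AE z in lborel. \<eta> z = 0"
      using integral_nonneg_eq_0_iff_AE[OF int] \<eta>(2) by simp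
    then have "AE z in lborel. z \<notin> ball (0::'a) 1"
    proof eventually_elim
      case (elim z)
      then show ?case using pos[of z] by auto
    qed
    then have "emeasure lborel (ball (0::'a) 1) = 0"
      by (intro null_setsD1) (simp add: AE_iff_null_sets)
    then show False
      using unit_ball_vol_pos[of "real DIM('a)"] by (simp add: emeasure_ball)
  qed
  then show ?thesis
    using Bochner_Integration.integral_nonneg[of lborel \<eta>] \<eta>(2) by (simp add: less_le)
qed

text \<open>The fundamental lemma of the calculus of variations. Rescaled bumps are test functions,
  so all mollifications of f and of -f vanish, and comparison with h = 0 gives both signs.\<close>

lemma AE_eq_0_of_test_functions:
  fixes f :: "'a::euclidean_space \<Rightarrow> real"
  assumes f: "locally_integrable f"
    and 0: "\<And>\<phi>. test_function \<phi> \<Longrightarrow> (LINT x|lborel. f x * \<phi> x) = 0"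
  shows "AE x in lborel. f x = 0"
proof -
  let ?\<eta> = "bump (0::'a) 1"
  define m where "m = (LINT z|lborel. ?\<eta> z)"
  have \<eta>: "continuous_on UNIV ?\<eta>" "\<And>z. ?\<eta> z \<ge> 0" "\<And>z. norm z > 1 \<Longrightarrow> ?\<eta> z = 0"
    using test_function_continuous[OF test_function_bump[of 1 "0::'a"]]
    by (auto simp: bump_def flat_nonneg intro!: flat_eq_0 power_mono[of 1 _ 2, simplified])
  have m: "m > 0"
    unfolding m_def using \<eta>
    by (rule integral_pos_of_pos_on_ball) (auto simp: bump_def abs_square_less_1 intro!: flat_pos)
  have scaled: "?\<eta> ((1 / \<epsilon>) *\<^sub>R (y - x)) = bump x \<epsilon> y" if "\<epsilon> > 0" for \<epsilon> x y
    using that by (simp add: bump_def power_mult_distrib power_divide)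
  have nonneg: "AE x in lborel. 0 \<le> m * g x"
    if g: "locally_integrable g" and g0: "\<And>\<phi>. test_function \<phi> \<Longrightarrow> (LINT x|lborel. g x * \<phi> x) = 0"
    for g :: "'a \<Rightarrow> real"
    unfolding m_def
  proof (rule AE_le_of_mollified[OF g _ \<eta>])
    show "locally_integrable (\<lambda>x::'a. 0::real)"
      by (rule locally_integrable_of_bounded_on_balls) auto
    fix \<epsilon> :: real and x :: 'a assume "0 < \<epsilon>" "\<epsilon> \<le> 1"
    then have "(LINT y|lborel. g y * (?\<eta> ((1 / \<epsilon>) *\<^sub>R (y - x)) / \<epsilon> ^ DIM('a))) =
        (LINT y|lborel. g y * bump x \<epsilon> y) / \<epsilon> ^ DIM('a)"
      by (simp add: scaled)
    then show "0 \<le> (LINT y|lborel. g y * (?\<eta> ((1 / \<epsilon>) *\<^sub>R (y - x)) / \<epsilon> ^ DIM('a)))"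
      using g0[OF test_function_bump] \<open>0 < \<epsilon>\<close> by simp
  qed auto
  have "AE x in lborel. 0 \<le> m * f x" using f 0 by (rule nonneg)
  moreover have "AE x in lborel. 0 \<le> m * (- f x)"
    using locally_integrable_lincomb[OF f f, of "-1" 0] 0 by (intro nonneg) auto
  ultimately show ?thesis
    by eventually_elim (use m in \<open>auto simp: zero_le_mult_iff mult_le_0_iff\<close>)
qed

lemma weak_gradient_unique:
  fixes u :: "'a::euclidean_space \<Rightarrow> real"
  assumes "is_weak_gradient u g" "is_weak_gradient u h"
  shows "AE x in lborel. g x = h x"
proof -
  have "AE x in lborel. g x \<bullet> b + (-1) * (h x \<bullet> b) = 0" if b: "b \<in> Basis" for b
  proof (rule AE_eq_0_of_test_functions)
    have gh: "locally_integrable (\<lambda>x. g x \<bullet> b)" "locally_integrable (\<lambda>x. h x \<bullet> b)"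
      using assms by (auto simp: is_weak_gradient_def intro: locally_integrable_inner)
    then show "locally_integrable (\<lambda>x. g x \<bullet> b + (-1) * (h x \<bullet> b))"
      using locally_integrable_lincomb[of _ _ 1 "-1"] by simp
    fix \<phi> :: "'a \<Rightarrow> real" assume \<phi>: "test_function \<phi>"
    have "(LINT x|lborel. (g x \<bullet> b) * \<phi> x) = (LINT x|lborel. (h x \<bullet> b) * \<phi> x)"
      using assms \<phi> b by (auto simp: is_weak_gradient_def)
    then have "(LINT x|lborel. (g x \<bullet> b) * \<phi> x - (h x \<bullet> b) * \<phi> x) = 0"
      using test_function_integrable_mult[OF gh(1) \<phi>] test_function_integrable_mult[OF gh(2) \<phi>]
      by simp
    then show "(LINT x|lborel. (g x \<bullet> b + (-1) * (h x \<bullet> b)) * \<phi> x) = 0"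
      by (simp add: left_diff_distrib)
  qed
  then have "AE x in lborel. \<forall>b\<in>Basis. g x \<bullet> b + (-1) * (h x \<bullet> b) = 0"
    by (intro AE_finite_allI) auto
  then show ?thesis
    by eventually_elim (simp add: euclidean_eq_iff[where 'a='a])
qed

lemma is_weak_gradient_weak_grad: "is_weak_gradient u g \<Longrightarrow> is_weak_gradient u (weak_grad u)"
  unfolding weak_grad_def by (rule someI[where P="is_weak_gradient u"])

text \<open>Lets a computation replace the chosen \<open>weak_grad\<close> by a concretely known
  weak gradient.\<close>

lemma weak_grad_AE_eq: "is_weak_gradient u g \<Longrightarrow> AE x in lborel. weak_grad u x = g x"
  using weak_gradient_unique is_weak_gradient_weak_grad by blast

lemma is_weak_gradient_lincomb:
  assumes "is_weak_gradient u g" "is_weak_gradient v h"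
  shows "is_weak_gradient (\<lambda>x. c * u x + d * v x) (\<lambda>x. c *\<^sub>R g x + d *\<^sub>R h x)"
  unfolding is_weak_gradient_def
proof (intro conjI allI impI ballI)
  have loc: "locally_integrable u" "locally_integrable v"
    and loc': "\<And>b. locally_integrable (\<lambda>x. g x \<bullet> b)" "\<And>b. locally_integrable (\<lambda>x. h x \<bullet> b)"
    using assms by (auto simp: is_weak_gradient_def intro: locally_integrable_inner)
  show "locally_integrable (\<lambda>x. c * u x + d * v x)"
    using loc by (rule locally_integrable_lincomb)
  show "locally_integrable (\<lambda>x. c *\<^sub>R g x + d *\<^sub>R h x)"
    by (rule locally_integrable_of_inner)
      (use locally_integrable_lincomb[OF loc'] in \<open>simp add: inner_add_left\<close>)
  fix \<phi> :: "'a \<Rightarrow> real" and b :: 'a assume \<phi>: "test_function \<phi>" and b: "b \<in> Basis"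
  note [simp] = test_function_integrable_mult[OF _ \<phi>]
    test_function_integrable_mult[OF _ test_function_partial[OF \<phi> b]] loc loc'
  have "(LINT x|lborel. (c * u x + d * v x) * frechet_derivative \<phi> (at x) b) =
      c * (LINT x|lborel. u x * frechet_derivative \<phi> (at x) b)
      + d * (LINT x|lborel. v x * frechet_derivative \<phi> (at x) b)"
    by (simp add: distrib_right mult.assoc)
  also have "\<dots> = - (c * (LINT x|lborel. (g x \<bullet> b) * \<phi> x) + d * (LINT x|lborel. (h x \<bullet> b) * \<phi> x))"
    using assms \<phi> b by (simp add: is_weak_gradient_def)
  also have "\<dots> = - (LINT x|lborel. ((c *\<^sub>R g x + d *\<^sub>R h x) \<bullet> b) * \<phi> x)"
    by (simp add: distrib_right mult.assoc inner_add_left)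
  finally show "(LINT x|lborel. (c * u x + d * v x) * frechet_derivative \<phi> (at x) b) =
      - (LINT x|lborel. ((c *\<^sub>R g x + d *\<^sub>R h x) \<bullet> b) * \<phi> x)" .
qed

lemma locally_integrable_translate:
  fixes f :: "'a::euclidean_space \<Rightarrow> 'b::euclidean_space"
  assumes "locally_integrable f"
  shows "locally_integrable (\<lambda>x. f (z + x))"
proof -
  have [measurable]: "f \<in> borel_measurable borel"
    using assms by (simp add: locally_integrable_def)
  have "set_integrable lborel K (\<lambda>x. f (z + x))" if K: "compact K" for K
  proof -
    have c: "compact ((+) z ` K)" using K by (rule compact_translation)
    have [measurable]: "(+) z ` K \<in> sets borel" using c by (rule borel_compact)
    have "integrable lborel (\<lambda>x. indicator ((+) z ` K) x *\<^sub>R f x)"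
      using assms c by (simp add: locally_integrable_def set_integrable_def)
    then have "integrable lborel (\<lambda>x. indicator ((+) z ` K) (z + x) *\<^sub>R f (z + x))"
      by (subst integral_translate(2)[of "\<lambda>x. indicator ((+) z ` K) x *\<^sub>R f x"]) auto
    moreover have "indicator ((+) z ` K) (z + x) = (indicator K x :: real)" for x
      by (auto simp: indicator_def)
    ultimately show ?thesis by (simp add: set_integrable_def)
  qed
  then show ?thesis by (simp add: locally_integrable_def)
qed

lemma is_weak_gradient_translate:
  fixes u :: "'a::euclidean_space \<Rightarrow> real"
  assumes "is_weak_gradient u g"
  shows "is_weak_gradient (\<lambda>x. u (z + x)) (\<lambda>x. g (z + x))"
  unfolding is_weak_gradient_def
proof (intro conjI allI impI ballI)
  have loc: "locally_integrable u" "locally_integrable g"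
    using assms by (auto simp: is_weak_gradient_def)
  then show "locally_integrable (\<lambda>x. u (z + x))" "locally_integrable (\<lambda>x. g (z + x))"
    by (auto intro: locally_integrable_translate)
  have [measurable]: "u \<in> borel_measurable borel" "g \<in> borel_measurable borel"
    using loc by (auto simp: locally_integrable_def)
  fix \<phi> :: "'a \<Rightarrow> real" and b :: 'a assume \<phi>: "test_function \<phi>" and b: "b \<in> Basis"
  define \<psi> where "\<psi> = (\<lambda>x. \<phi> (x + (- z)))"
  have \<psi>: "test_function \<psi>" "\<And>x. frechet_derivative \<psi> (at x) b = frechet_derivative \<phi> (at (x + (- z))) b"
    using test_function_translate[OF \<phi>, of "- z"] by (auto simp: \<psi>_def)
  have [measurable]: "\<psi> \<in> borel_measurable borel"
    "(\<lambda>x. frechet_derivative \<phi> (at (x - z)) b) \<in> borel_measurable borel"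
    "(\<lambda>x. \<phi> (x - z)) \<in> borel_measurable borel"
    using \<psi> \<psi>_def test_function_measurable[OF test_function_partial[OF \<psi>(1) b]]
    by (auto intro: test_function_measurable)
  have "(LINT x|lborel. u (z + x) * frechet_derivative \<phi> (at x) b) =
      (LINT x|lborel. u x * frechet_derivative \<psi> (at x) b)"
    by (subst (2) integral_translate(1)[symmetric, where z=z]) (auto simp: \<psi>(2))
  also have "\<dots> = - (LINT x|lborel. (g x \<bullet> b) * \<psi> x)"
    using assms \<psi>(1) b by (simp add: is_weak_gradient_def)
  also have "(LINT x|lborel. (g x \<bullet> b) * \<psi> x) = (LINT x|lborel. (g (z + x) \<bullet> b) * \<phi> x)"
    by (subst integral_translate(1)[symmetric, where z=z]) (auto simp: \<psi>_def)
  finally show "(LINT x|lborel. u (z + x) * frechet_derivative \<phi> (at x) b) =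
      - (LINT x|lborel. (g (z + x) \<bullet> b) * \<phi> x)" .
qed

subsection \<open>Superharmonic functions\<close>

text \<open>Differentiation under the integral sign. The mean value inequality bounds all difference
  quotients by \<open>w\<close>, and dominated convergence is applied along arbitrary sequences
  tending to t.\<close>

lemma has_real_derivative_integral:
  fixes G :: "real \<Rightarrow> 'a::euclidean_space \<Rightarrow> real"
  assumes "t \<in> {a<..<b}"
    and int: "\<And>t. t \<in> {a<..<b} \<Longrightarrow> integrable lborel (G t)"
    and D: "\<And>t y. t \<in> {a<..<b} \<Longrightarrow> ((\<lambda>t. G t y) has_real_derivative G' t y) (at t)"
    and [measurable]: "G' t \<in> borel_measurable borel"
    and w: "integrable lborel w" "\<And>t y. t \<in> {a<..<b} \<Longrightarrow> \<bar>G' t y\<bar> \<le> w y"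
  shows "((\<lambda>t. LINT y|lborel. G t y) has_real_derivative (LINT y|lborel. G' t y)) (at t)"
proof -
  let ?S = "{a<..<b}"
  have "((\<lambda>s. ((LINT y|lborel. G s y) - (LINT y|lborel. G t y)) / (s - t)) \<longlongrightarrow> (LINT y|lborel. G' t y))
      (at t within ?S)"
    unfolding tendsto_at_iff_sequentially comp_def
  proof (intro allI impI)
    fix X :: "nat \<Rightarrow> real" assume X: "\<forall>i. X i \<in> ?S - {t}" "X \<longlonglongrightarrow> t"
    have "(\<lambda>i. LINT y|lborel. (G (X i) y - G t y) / (X i - t)) \<longlonglongrightarrow> (LINT y|lborel. G' t y)"
    proof (rule integral_dominated_convergence[where w=w])
      show "(\<lambda>y. (G (X i) y - G t y) / (X i - t)) \<in> borel_measurable lborel" for i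
        using int[of "X i"] int[OF assms(1)] X(1) by (intro borel_measurable_divide borel_measurable_diff) auto
      have "(\<lambda>i. (G (X i) y - G t y) / (X i - t)) \<longlonglongrightarrow> G' t y" for y
      proof -
        have "((\<lambda>s. (G s y - G t y) / (s - t)) \<longlongrightarrow> G' t y) (at t within ?S)"
          using D[OF assms(1), of y] at_le[of ?S UNIV t]
          by (auto simp: has_field_derivative_iff intro: tendsto_mono)
        then show ?thesis
          using X by (auto simp: tendsto_at_iff_sequentially comp_def)
      qed
      then show "AE y in lborel. (\<lambda>i. (G (X i) y - G t y) / (X i - t)) \<longlonglongrightarrow> G' t y" by simp
      have "norm (G (X i) y - G t y) \<le> w y * norm (X i - t)" for i y
        by (rule field_differentiable_bound[of ?S "\<lambda>t. G t y" "\<lambda>t. G' t y"])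
          (use D w(2) X(1) assms(1) in \<open>auto intro: has_field_derivative_at_within\<close>)
      then show "AE y in lborel. norm ((G (X i) y - G t y) / (X i - t)) \<le> w y" for i
        using X(1) by (intro AE_I2) (auto simp: divide_le_eq)
    qed (use w in auto)
    moreover have "(LINT y|lborel. (G (X i) y - G t y) / (X i - t)) =
        ((LINT y|lborel. G (X i) y) - (LINT y|lborel. G t y)) / (X i - t)" for i
      using int[of "X i"] int[OF assms(1)] X(1) by simp
    ultimately show "(\<lambda>i. ((LINT y|lborel. G (X i) y) - (LINT y|lborel. G t y)) / (X i - t))
        \<longlonglongrightarrow> (LINT y|lborel. G' t y)" by (simp only:)
  qed
  then show ?thesis
    using assms(1) at_within_open[of t ?S] by (simp add: has_field_derivative_iff)
qed

section \<open>A radial mollifier and its derivative in the scale\<close>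

text \<open>\<open>flat 2\<close> is the derivative of \<open>flat 0\<close>. Hence y - x times the
  mollifier built from it is a multiple of the gradient of a bump. The derivative in the scale t is
  1/t times the divergence of this field, and so a multiple of a Laplacian.\<close>

definition profile :: "'a::euclidean_space \<Rightarrow> real" where
  "profile z = flat 2 (1 - (norm z)\<^sup>2)"

text \<open>The mollifier at scale \<open>1 / t\<close>.\<close>

definition mollifier :: "real \<Rightarrow> 'a::euclidean_space \<Rightarrow> 'a \<Rightarrow> real" where
  "mollifier t x y = t ^ DIM('a) * profile (t *\<^sub>R (y - x))"

definition mollifier' :: "real \<Rightarrow> 'a::euclidean_space \<Rightarrow> 'a \<Rightarrow> real" where
  "mollifier' t x y = (let s = 1 - t\<^sup>2 * (norm (y - x))\<^sup>2 in
     real DIM('a) * t ^ (DIM('a) - 1) * flat 2 s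
     - 2 * t ^ (DIM('a) + 1) * (norm (y - x))\<^sup>2 * (flat 4 s - 2 * flat 3 s))"

lemma mollifier_deriv: "((\<lambda>t. mollifier t x y) has_real_derivative mollifier' t x y) (at t)"
proof -
  let ?s = "\<lambda>t. 1 - t\<^sup>2 * (norm (y - x))\<^sup>2"
  have "(?s has_real_derivative - (2 * t * (norm (y - x))\<^sup>2)) (at t)"
    by (auto intro!: derivative_eq_intros)
  from DERIV_chain2[OF flat_deriv[of 2 "?s t"] this]
  have "((\<lambda>t. flat 2 (?s t)) has_real_derivative
      (flat 4 (?s t) - 2 * flat 3 (?s t)) * - (2 * t * (norm (y - x))\<^sup>2)) (at t)"
    by (simp add: eval_nat_numeral)
  from DERIV_mult[OF DERIV_pow[of "DIM('a)"] this]
  have "((\<lambda>t. t ^ DIM('a) * flat 2 (?s t)) has_real_derivative mollifier' t x y) (at t)"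
    by (simp add: mollifier'_def Let_def algebra_simps)
  then show ?thesis
    by (simp add: mollifier_def profile_def power_mult_distrib)
qed

text \<open>The derivative of the mollifier in \<open>t\<close> is a negative multiple of the Laplacian of a bump
  function, so the averages of a superharmonic function increase with \<open>t\<close>.\<close>

lemma mollifier'_laplacian:
  fixes x y :: "'a::euclidean_space"
  assumes "t > 0"
  shows "t ^ 3 * mollifier' t x y = - (t ^ DIM('a) / 2) *
    (\<Sum>b\<in>Basis. frechet_derivative (\<lambda>y. frechet_derivative (bump x (1 / t)) (at y) b) (at y) b)"
proof -
  \<comment> \<open>The power \<open>DIM('a) - 1\<close> uses truncated subtraction; writing the
    dimension as a successor makes it harmless.\<close>
  obtain n where n: "DIM('a) = Suc n"
    using DIM_positive[where 'a='a] by (metis Suc_pred)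
  show ?thesis
    using assms unfolding laplacian_bump[of "1 / t" x y, simplified, OF assms] mollifier'_def Let_def n
    by (simp add: field_simps power2_eq_square eval_nat_numeral)
qed

lemma flat_continuous: "continuous_on S (flat m)"
  by (auto simp: continuous_on_eq_continuous_within
      intro!: continuous_at_imp_continuous_at_within DERIV_isCont[OF flat_deriv])

lemma flat_measurable [measurable]: "flat m \<in> borel_measurable borel"
  by (rule borel_measurable_continuous_onI[OF flat_continuous])

lemma flat_bounded: obtains C where "C \<ge> 0" "\<And>t. t \<le> 1 \<Longrightarrow> flat m t \<le> C"
proof -
  have "compact (flat m ` {0..1})"
    by (intro compact_continuous_image flat_continuous) simp
  then obtain C where C: "C > 0" "\<And>t. t \<in> {0..1} \<Longrightarrow> norm (flat m t) \<le> C"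
    by (auto dest!: compact_imp_bounded simp: bounded_pos)
  have "flat m t \<le> C" if "t \<le> 1" for t
    using C(2)[of t] C(1) that flat_eq_0[of t m] by (cases "t \<le> 0") auto
  then show thesis using that[of C] C(1) by simp
qed

lemma profile_continuous: "continuous_on UNIV (profile :: 'a::euclidean_space \<Rightarrow> real)"
  unfolding profile_def[abs_def]
  by (rule continuous_on_compose2[OF flat_continuous[of UNIV]]) (auto intro!: continuous_intros)

lemma profile_measurable [measurable]: "profile \<in> borel_measurable borel"
  by (rule borel_measurable_continuous_onI[OF profile_continuous])

lemma profile_nonneg: "profile z \<ge> 0"
  by (simp add: profile_def flat_nonneg)

lemma profile_pos: "norm z < 1 \<Longrightarrow> profile z > 0"
  by (auto simp: profile_def abs_square_less_1 intro!: flat_pos)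

lemma profile_eq_0: "norm z \<ge> 1 \<Longrightarrow> profile z = 0"
  using power_mono[of 1 "norm z" 2] by (auto simp: profile_def intro!: flat_eq_0)

lemma profile_bounded: obtains C where "C \<ge> 0" "\<And>z::'a::euclidean_space. profile z \<le> C"
proof -
  obtain C where "C \<ge> 0" "\<And>t. t \<le> 1 \<Longrightarrow> flat 2 t \<le> C" using flat_bounded[of 2] by blast
  then show thesis using that[of C] by (simp add: profile_def)
qed

lemma integral_profile_pos: "(LINT z|lborel. profile (z::'a::euclidean_space)) > 0"
  by (rule integral_pos_of_pos_on_ball)
    (auto simp: profile_continuous profile_nonneg profile_eq_0 profile_pos)

lemma mollifier_nonneg: "t \<ge> 0 \<Longrightarrow> mollifier t x y \<ge> 0"
  by (simp add: mollifier_def profile_nonneg)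

lemma mollifier_support: "t > 0 \<Longrightarrow> norm y > norm x + 1 / t \<Longrightarrow> mollifier t x y = 0"
proof -
  assume t: "t > 0" and y: "norm y > norm x + 1 / t"
  then have "norm (y - x) \<ge> 1 / t" using norm_triangle_ineq2[of y x] by linarith
  then have "t * norm (y - x) \<ge> 1" using t by (simp add: field_simps)
  then have "norm (t *\<^sub>R (y - x)) \<ge> 1" using t by simp
  then show ?thesis by (simp add: mollifier_def profile_eq_0)
qed

lemma mollifier_measurable [measurable]:
  "(\<lambda>y. mollifier t x y) \<in> borel_measurable borel"
  "(\<lambda>(x, y). mollifier t x y) \<in> borel_measurable (borel \<Otimes>\<^sub>M borel)"
  unfolding mollifier_def by measurable

lemma mollifier'_measurable [measurable]: "(\<lambda>y. mollifier' t x y) \<in> borel_measurable borel"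
  unfolding mollifier'_def Let_def by measurable

text \<open>Supplies the dominating function for differentiating the averages: scales above a keep
  the support within distance 1/a of x, and scales below b bound the powers of t.\<close>

lemma mollifier'_bound:
  fixes x :: "'a::euclidean_space"
  assumes "0 < a" "a < b"
  obtains C where "\<And>t y. t \<in> {a<..<b} \<Longrightarrow> \<bar>mollifier' t x y\<bar> \<le> C * indicator (cball 0 (norm x + 1 / a)) y"
proof -
  obtain C2 C3 C4 where C: "C2 \<ge> 0" "\<And>t. t \<le> 1 \<Longrightarrow> flat 2 t \<le> C2" "C3 \<ge> 0" "\<And>t. t \<le> 1 \<Longrightarrow> flat 3 t \<le> C3"
    "C4 \<ge> 0" "\<And>t. t \<le> 1 \<Longrightarrow> flat 4 t \<le> C4"
    by (rule flat_bounded[of 2], rule flat_bounded[of 3], rule flat_bounded[of 4]) blast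
  define C where "C = real DIM('a) * b ^ (DIM('a) - 1) * C2 + 2 * b ^ (DIM('a) + 1) * (1 / a)\<^sup>2 * (C4 + 2 * C3)"
  have "\<bar>mollifier' t x y\<bar> \<le> C * indicator (cball 0 (norm x + 1 / a)) y" if t: "t \<in> {a<..<b}" for t y
  proof (cases "norm (y - x) \<ge> 1 / t")
    case True
    then have "t * norm (y - x) \<ge> 1" using t assms by (simp add: field_simps)
    then have "1 - t\<^sup>2 * (norm (y - x))\<^sup>2 \<le> 0"
      using power_mono[of 1 "t * norm (y - x)" 2] by (simp add: power_mult_distrib)
    then have "mollifier' t x y = 0" by (simp add: mollifier'_def Let_def flat_eq_0)
    moreover have "C \<ge> 0" unfolding C_def using C assms by auto
    ultimately show ?thesis by simp
  next
    case False
    then have ya: "norm (y - x) \<le> 1 / a"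
      using t assms frac_le[of 1 1 a t] by auto
    then have "norm y \<le> norm x + 1 / a" using norm_triangle_ineq2[of y x] by linarith
    moreover have "\<bar>mollifier' t x y\<bar> \<le> C"
    proof -
      define s where "s = 1 - t\<^sup>2 * (norm (y - x))\<^sup>2"
      have s: "s \<le> 1" by (simp add: s_def)
      have "\<bar>real DIM('a) * t ^ (DIM('a) - 1) * flat 2 s\<bar> \<le> real DIM('a) * b ^ (DIM('a) - 1) * C2"
        using t assms C(2)[OF s] flat_nonneg[of 2 s]
        by (auto simp: abs_mult intro!: mult_mono power_mono)
      moreover have "\<bar>flat 4 s - 2 * flat 3 s\<bar> \<le> C4 + 2 * C3"
        using C(4,6)[OF s] flat_nonneg[of 3 s] flat_nonneg[of 4 s] C by linarith
      then have "\<bar>2 * t ^ (DIM('a) + 1) * (norm (y - x))\<^sup>2 * (flat 4 s - 2 * flat 3 s)\<bar>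
          \<le> 2 * b ^ (DIM('a) + 1) * (1 / a)\<^sup>2 * (C4 + 2 * C3)"
        unfolding abs_mult using t assms ya
        by (intro mult_mono) (auto intro!: power_mono mult_mono simp del: power_Suc)
      ultimately show ?thesis
        unfolding mollifier'_def Let_def s_def[symmetric] C_def by linarith
    qed
    ultimately show ?thesis by simp
  qed
  then show thesis using that by blast
qed

section \<open>Averages of superharmonic functions and the strong maximum principle\<close>

text \<open>The inequality -\<open>\<Delta>\<close>u >= 0 in the sense of distributions:
  \<open>super\<close> pairs u with the Laplacian of a nonnegative test function.\<close>

locale superharmonic =
  fixes u :: "'a::euclidean_space \<Rightarrow> real"
  assumes loc: "locally_integrable u"
    and super: "\<And>\<phi>. test_function \<phi> \<Longrightarrow> (\<And>x. \<phi> x \<ge> 0) \<Longrightarrow>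
      (LINT y|lborel. u y * (\<Sum>b\<in>Basis.
        frechet_derivative (\<lambda>y. frechet_derivative \<phi> (at y) b) (at y) b)) \<le> 0"
begin

definition avg :: "real \<Rightarrow> 'a \<Rightarrow> real" where
  "avg t x = (LINT y|lborel. u y * mollifier t x y)"

lemma u_measurable [measurable]: "u \<in> borel_measurable borel"
  using loc by (simp add: locally_integrable_def)

lemma mollifier_bounded:
  obtains C where "C \<ge> 0" "\<And>t x y. t > 0 \<Longrightarrow> \<bar>mollifier t x (y::'a)\<bar> \<le> C * t ^ DIM('a)"
proof -
  obtain C where C: "C \<ge> 0" "\<And>z::'a. profile z \<le> C" using profile_bounded by blast
  then have "\<bar>mollifier t x y\<bar> \<le> C * t ^ DIM('a)" if "t > 0" for t x and y :: 'a
    using that profile_nonneg[of "t *\<^sub>R (y - x)"] by (simp add: mollifier_def abs_mult mult.commute[of C])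
  then show thesis using that C(1) by blast
qed

lemma integrable_avg:
  assumes "t > 0"
  shows "integrable lborel (\<lambda>y. u y * mollifier t x y)"
proof -
  obtain C where "\<And>y. \<bar>mollifier t x (y::'a)\<bar> \<le> C * t ^ DIM('a)"
    using mollifier_bounded assms by metis
  then show ?thesis
    using mollifier_support[OF assms]
    by (intro locally_integrable_integrable_mult[OF loc, of _ "C * t ^ DIM('a)" "norm x + 1 / t"]) auto
qed

lemma avg_mono:
  assumes "0 < s" "s \<le> t"
  shows "avg s x \<le> avg t x"
proof (rule DERIV_nonneg_imp_nondecreasing[OF assms(2)])
  fix r assume r: "s \<le> r" "r \<le> t"
  \<comment> \<open>An open range of scales around [s, t] that stays away from 0, as the domination
    requires.\<close>
  define a b where "a = s / 2" "b = t + 1"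
  have ab: "0 < a" "a < b" "r \<in> {a<..<b}" using assms r by (auto simp: a_b_def)
  obtain C where C: "\<And>t y. t \<in> {a<..<b} \<Longrightarrow>
      \<bar>mollifier' t x y\<bar> \<le> C * indicator (cball 0 (norm x + 1 / a)) y"
    using mollifier'_bound[OF ab(1,2), of x] by blast
  have "((\<lambda>t. LINT y|lborel. u y * mollifier t x y) has_real_derivative
      (LINT y|lborel. u y * mollifier' r x y)) (at r)"
  proof (rule has_real_derivative_integral[OF ab(3), where
        w="\<lambda>y. \<bar>u y * (C * indicator (cball 0 (norm x + 1 / a)) y)\<bar>"])
    show "integrable lborel (\<lambda>y. u y * mollifier t x y)" if "t \<in> {a<..<b}" for t
      using that ab by (intro integrable_avg) simp
    show "((\<lambda>t. u y * mollifier t x y) has_real_derivative u y * mollifier' t x y) (at t)" for t y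
      by (rule DERIV_cmult[OF mollifier_deriv])
    show "integrable lborel (\<lambda>y. \<bar>u y * (C * indicator (cball 0 (norm x + 1 / a)) y)\<bar>)"
      by (intro integrable_abs locally_integrable_integrable_mult[OF loc, of _ "\<bar>C\<bar>" "norm x + 1 / a"])
        (auto simp: indicator_def)
    show "\<bar>u y * mollifier' t x y\<bar> \<le> \<bar>u y * (C * indicator (cball 0 (norm x + 1 / a)) y)\<bar>"
      if "t \<in> {a<..<b}" for t y
      unfolding abs_mult[of "u y"] using C[OF that, of y] by (intro mult_left_mono) auto
  qed auto
  moreover have "(LINT y|lborel. u y * mollifier' r x y) \<ge> 0"
  proof -
    let ?L = "\<lambda>y. \<Sum>b\<in>Basis. frechet_derivative (\<lambda>y. frechet_derivative (bump x (1 / r)) (at y) b) (at y) b"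
    have r0: "r > 0" using assms r by simp
    have "r ^ 3 * (LINT y|lborel. u y * mollifier' r x y) =
        (LINT y|lborel. u y * (r ^ 3 * mollifier' r x y))"
      by (simp add: mult_ac flip: integral_mult_right_zero)
    also have "\<dots> = (LINT y|lborel. - (r ^ DIM('a) / 2) * (u y * ?L y))"
      unfolding mollifier'_laplacian[OF r0] by (simp add: mult_ac)
    also have "\<dots> = - (r ^ DIM('a) / 2) * (LINT y|lborel. u y * ?L y)"
      by (rule integral_mult_right_zero)
    also have "\<dots> \<ge> 0"
      using super[OF test_function_bump[of "1 / r" x]] r0
      by (intro mult_nonpos_nonpos) (auto simp: bump_def flat_nonneg)
    finally show ?thesis using r0 by (simp add: zero_le_mult_iff)
  qed
  ultimately show "\<exists>y. ((\<lambda>a. avg a x) has_real_derivative y) (at r) \<and> 0 \<le> y"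
    unfolding avg_def by blast
qed

lemma avg_measurable [measurable]: "avg t \<in> borel_measurable borel"
  unfolding avg_def[abs_def] by measurable

lemma locally_integrable_avg:
  assumes t: "t > 0"
  shows "locally_integrable (avg t)"
proof (rule locally_integrable_of_bounded_on_balls)
  fix R
  obtain C where C: "C \<ge> 0" "\<And>x y. \<bar>mollifier t x (y::'a)\<bar> \<le> C * t ^ DIM('a)"
    using mollifier_bounded t by metis
  let ?w = "\<lambda>y. \<bar>u y * (C * t ^ DIM('a) * indicator (cball 0 (R + 1 / t)) y)\<bar>"
  have int: "integrable lborel ?w"
    by (intro integrable_abs locally_integrable_integrable_mult[OF loc, of _ "C * t ^ DIM('a)" "R + 1 / t"])
      (use C t in \<open>auto simp: indicator_def\<close>)
  have "\<bar>avg t x\<bar> \<le> (LINT y|lborel. ?w y)" if x: "norm x \<le> R" for x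
  proof -
    have "\<bar>u y * mollifier t x y\<bar> \<le> ?w y" for y
    proof (cases "norm y > R + 1 / t")
      case True
      then have "mollifier t x y = 0" using x by (intro mollifier_support[OF t]) simp
      then show ?thesis by simp
    next
      case False
      then show ?thesis
        using C(2)[of x y] C(1) t by (auto simp: abs_mult intro!: mult_left_mono)
    qed
    then show ?thesis
      unfolding avg_def using int integrable_avg[OF t]
      by (intro integral_abs_bound[THEN order_trans] integral_mono) auto
  qed
  then show "\<exists>B. \<forall>x. norm x \<le> R \<longrightarrow> \<bar>avg t x\<bar> \<le> B" by blast
qed measurable

text \<open>For \<open>\<epsilon> \<le> 1\<close> the scale \<open>1 / \<epsilon>\<close> is at
  least t, so by monotonicity \<open>avg t x\<close> is a lower bound for all these mollifications,
  and \<open>AE_le_of_mollified\<close> passes to the limit.\<close>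

lemma AE_avg_le:
  assumes "0 < t" "t \<le> 1"
  shows "AE x in lborel. avg t x \<le> (LINT z|lborel. profile (z::'a)) * u x"
proof (rule AE_le_of_mollified[OF loc locally_integrable_avg[OF assms(1)] profile_continuous profile_nonneg])
  fix \<epsilon> :: real and x :: 'a assume \<epsilon>: "0 < \<epsilon>" "\<epsilon> \<le> 1"
  then have "avg t x \<le> avg (1 / \<epsilon>) x"
    using assms by (intro avg_mono) (auto intro: order_trans[of _ 1])
  then show "avg t x \<le> (LINT y|lborel. u y * (profile ((1 / \<epsilon>) *\<^sub>R (y - x)) / \<epsilon> ^ DIM('a)))"
    by (simp add: avg_def mollifier_def power_divide)
qed (simp add: profile_eq_0)

text \<open>Averages only decrease when the scale s is lowered, so a lower bound in the limit s to 0
  suffices. Split |u| at height \<open>\<kappa>\<close>: the low part contributes at most a constant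
  times \<open>\<kappa>\<close>, since s^N cancels the volume of the ball of radius 1/s, while the
  high part is controlled by |u|^q and carries a factor s^N. Finally \<open>\<kappa>\<close> tends
  to 0.\<close>

lemma avg_nonneg:
  assumes q: "q > 1" and int: "integrable lborel (\<lambda>x. \<bar>u x\<bar> powr q)" and t: "t > 0"
  shows "avg t x \<ge> 0"
proof -
  obtain C where C: "C \<ge> 0" "\<And>t x y. t > 0 \<Longrightarrow> \<bar>mollifier t x (y::'a)\<bar> \<le> C * t ^ DIM('a)"
    using mollifier_bounded by blast
  define V where "V = unit_ball_vol (real DIM('a))"
  define A where "A = (LINT x|lborel. \<bar>u x\<bar> powr q)"
  have main: "- avg t x \<le> C * V * \<kappa>" if \<kappa>: "\<kappa> > 0" for \<kappa>
  proof -
    \<comment> \<open>Where |u| exceeds \<open>\<kappa>\<close>, the negative exponent 1 - q makes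
      |u|^(1 - q) at most \<open>\<kappa> powr (1 - q)\<close>.\<close>
    have split: "\<bar>u y\<bar> \<le> \<kappa> + \<kappa> powr (1 - q) * \<bar>u y\<bar> powr q" for y
    proof (cases "\<bar>u y\<bar> \<le> \<kappa>")
      case True
      then show ?thesis by (simp add: add_increasing2)
    next
      case False
      have "\<bar>u y\<bar> = \<bar>u y\<bar> powr (1 - q) * \<bar>u y\<bar> powr q"
        using False \<kappa> by (simp flip: powr_add)
      also have "\<dots> \<le> \<kappa> powr (1 - q) * \<bar>u y\<bar> powr q"
        using False \<kappa> q by (intro mult_right_mono powr_mono2') auto
      finally show ?thesis using \<kappa> by simp
    qed
    have "- avg t x \<le> C * V * \<kappa> + C * \<kappa> powr (1 - q) * A * s ^ DIM('a)" if s: "0 < s" "s \<le> t" for s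
    proof -
      have "- avg t x \<le> - avg s x" using avg_mono[OF s] by simp
      also have "\<dots> \<le> (LINT y|lborel. \<bar>u y * mollifier s x y\<bar>)"
        unfolding avg_def using integral_abs_bound[of lborel "\<lambda>y. u y * mollifier s x y"] by linarith
      also have "\<dots> \<le> (LINT y|lborel. C * s ^ DIM('a) * \<kappa> * indicator (cball x (1 / s)) y
          + C * s ^ DIM('a) * \<kappa> powr (1 - q) * \<bar>u y\<bar> powr q)"
      proof (rule integral_mono)
        show "integrable lborel (\<lambda>y. \<bar>u y * mollifier s x y\<bar>)"
          using integrable_avg[OF s(1)] by (rule integrable_abs)
        show "integrable lborel (\<lambda>y. C * s ^ DIM('a) * \<kappa> * indicator (cball x (1 / s)) y
            + C * s ^ DIM('a) * \<kappa> powr (1 - q) * \<bar>u y\<bar> powr q)"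
          by (intro Bochner_Integration.integrable_add integrable_mult_right int integrable_real_indicator)
            (use emeasure_lborel_cball_finite in \<open>auto simp: less_top\<close>)
        show "\<bar>u y * mollifier s x y\<bar> \<le> C * s ^ DIM('a) * \<kappa> * indicator (cball x (1 / s)) y
            + C * s ^ DIM('a) * \<kappa> powr (1 - q) * \<bar>u y\<bar> powr q" for y
        proof (cases "y \<in> cball x (1 / s)")
          case True
          have "\<bar>u y * mollifier s x y\<bar> \<le> (\<kappa> + \<kappa> powr (1 - q) * \<bar>u y\<bar> powr q) * (C * s ^ DIM('a))"
            unfolding abs_mult using split[of y] C(2)[OF s(1), of x y] \<kappa> by (intro mult_mono) auto
          then show ?thesis using True by (simp add: algebra_simps)
        next
          case False
          then have "s * norm (y - x) \<ge> 1"
            using s by (simp add: dist_norm norm_minus_commute field_simps)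
          then have "norm (s *\<^sub>R (y - x)) \<ge> 1"
            using s by simp
          then show ?thesis using False C(1) s by (simp add: mollifier_def profile_eq_0)
        qed
      qed
      also have "\<dots> = C * s ^ DIM('a) * \<kappa> * measure lborel (cball x (1 / s)) + C * s ^ DIM('a) * \<kappa> powr (1 - q) * A"
        unfolding A_def by (subst Bochner_Integration.integral_add)
          (use emeasure_lborel_cball_finite int in \<open>auto simp: less_top intro!: integrable_mult_right integrable_real_indicator\<close>)
      also have "measure lborel (cball x (1 / s)) = V * (1 / s) ^ DIM('a)"
        using content_cball[of "1 / s" x] s by (simp add: V_def)
      finally show ?thesis using s by (simp add: field_simps power_divide)
    qed
    note bound = this
    have "((\<lambda>s. C * V * \<kappa> + C * \<kappa> powr (1 - q) * A * s ^ DIM('a)) \<longlongrightarrow>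
        C * V * \<kappa> + C * \<kappa> powr (1 - q) * A * 0 ^ DIM('a)) (at_right 0)"
      by (intro tendsto_intros)
    moreover have "eventually (\<lambda>s. - avg t x \<le> C * V * \<kappa> + C * \<kappa> powr (1 - q) * A * s ^ DIM('a)) (at_right 0)"
      using bound t by (auto simp: eventually_at_right_field intro!: exI[of _ t])
    ultimately have "- avg t x \<le> C * V * \<kappa> + C * \<kappa> powr (1 - q) * A * 0 ^ DIM('a)"
      by (intro tendsto_lowerbound[of _ _ "at_right 0"]) auto
    then show ?thesis by (simp add: zero_power)
  qed
  have "((\<lambda>\<kappa>. C * V * \<kappa>) \<longlongrightarrow> C * V * 0) (at_right 0)"
    by (intro tendsto_intros)
  moreover have "eventually (\<lambda>\<kappa>. - avg t x \<le> C * V * \<kappa>) (at_right 0)"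
    using main by (auto simp: eventually_at_right_field intro!: exI[of _ 1])
  ultimately have "- avg t x \<le> C * V * 0"
    by (intro tendsto_lowerbound[of _ _ "at_right 0"]) auto
  then show ?thesis by simp
qed

lemma AE_nonneg:
  assumes "q > 1" "integrable lborel (\<lambda>x. \<bar>u x\<bar> powr q)"
  shows "AE x in lborel. u x \<ge> 0"
proof -
  have "AE x in lborel. avg 1 x \<le> (LINT z|lborel. profile (z::'a)) * u x"
    by (rule AE_avg_le) auto
  then show ?thesis
  proof eventually_elim
    case (elim x)
    then have "0 \<le> (LINT z|lborel. profile (z::'a)) * u x"
      using avg_nonneg[OF assms, of 1 x] by linarith
    then show ?case
      using integral_profile_pos[where 'a='a] by (simp add: zero_le_mult_iff)
  qed
qed

text \<open>If u is not positive almost everywhere, some point x has u(x) <= 0 and satisfies the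
  bounds on the averages. The averages there are then <= 0 although u is nonnegative, so u vanishes
  on every ball about x on which one of the mollifiers is positive; these balls exhaust the
  space.\<close>

lemma strong_maximum_principle:
  assumes "q > 1" "integrable lborel (\<lambda>x. \<bar>u x\<bar> powr q)"
  shows "(AE x in lborel. u x = 0) \<or> (AE x in lborel. u x > 0)"
proof (rule disjCI)
  assume not_pos: "\<not> (AE x in lborel. u x > 0)"
  \<comment> \<open>Restricting to the countably many scales 1/(n + 1) yields one null set for all
    of them.\<close>
  have good: "AE x in lborel. \<forall>n. avg (1 / real (Suc n)) x \<le> (LINT z|lborel. profile (z::'a)) * u x"
    unfolding AE_all_countable by (intro allI AE_avg_le) auto
  have "\<exists>x. (\<forall>n. avg (1 / real (Suc n)) x \<le> (LINT z|lborel. profile (z::'a)) * u x) \<and> u x \<le> 0"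
  proof (rule ccontr)
    assume *: "\<not> ?thesis"
    have "AE x in lborel. u x > 0"
      by (rule AE_mp[OF good], rule AE_I2) (use * in \<open>meson not_less\<close>)
    with not_pos show False ..
  qed
  then obtain x where x: "\<And>n. avg (1 / real (Suc n)) x \<le> (LINT z|lborel. profile (z::'a)) * u x"
    "u x \<le> 0"
    by blast
  have "AE y in lborel. y \<in> ball x (real (Suc n)) \<longrightarrow> u y = 0" for n
  proof -
    let ?t = "1 / real (Suc n)"
    have le: "(LINT y|lborel. u y * mollifier ?t x y) \<le> 0"
      using x(1)[of n] x(2) integral_profile_pos[where 'a='a]
        mult_nonneg_nonpos[of "LINT z|lborel. profile (z::'a)" "u x"]
      by (simp add: avg_def del: of_nat_Suc)
    have nn: "AE y in lborel. 0 \<le> u y * mollifier ?t x y"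
      using AE_nonneg[OF assms] by eventually_elim (auto intro!: mult_nonneg_nonneg mollifier_nonneg)
    have "(LINT y|lborel. u y * mollifier ?t x y) = 0"
      using le integral_nonneg_AE[OF nn] by linarith
    then have "AE y in lborel. u y * mollifier ?t x y = 0"
      using integral_nonneg_eq_0_iff_AE[OF integrable_avg nn] by simp
    then show ?thesis
    proof eventually_elim
      case (elim y)
      have "mollifier ?t x y > 0" if "y \<in> ball x (real (Suc n))"
        using that by (auto simp: mollifier_def dist_norm norm_minus_commute
            intro!: profile_pos mult_pos_pos)
      with elim show ?case by auto
    qed
  qed
  then have "AE y in lborel. \<forall>n. y \<in> ball x (real (Suc n)) \<longrightarrow> u y = 0"
    unfolding AE_all_countable by blast
  then show "AE y in lborel. u y = 0"
  proof eventually_elim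
    case (elim y)
    obtain n where "dist x y < real n" using reals_Archimedean2 by blast
    then have "y \<in> ball x (real (Suc n))" by simp
    with elim show ?case by blast
  qed
qed

end

subsection \<open>The interaction energy\<close>

lemma ball_cball_borel [measurable]: "ball x r \<in> sets borel" "cball x r \<in> sets borel"
  by simp_all

text \<open>Replaces integration over dyadic shells: f is dominated by a series of multiples of ball
  indicators, a single term of which already suffices at each point.\<close>

lemma nn_integral_finite_of_ball_cover:
  fixes f :: "'a::euclidean_space \<Rightarrow> real"
  assumes [measurable]: "f \<in> borel_measurable borel"
    and cover: "\<And>y. f y \<noteq> 0 \<Longrightarrow> \<exists>k::nat. f y \<le> c k \<and> norm y < r k"
    and pos: "\<And>k. c k \<ge> 0" "\<And>k. r k \<ge> 0"
    and sum: "summable (\<lambda>k. c k * r k ^ DIM('a))"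
  shows "(\<integral>\<^sup>+y. ennreal (f y) \<partial>lborel) < \<infinity>"
proof -
  define V where "V = unit_ball_vol (real DIM('a))"
  have V: "V \<ge> 0" by (simp add: V_def)
  have "ennreal (f y) \<le> (\<Sum>k. ennreal (c k) * indicator (ball 0 (r k)) y)" for y
  proof (cases "f y = 0")
    case False
    then obtain k where k: "f y \<le> c k" "norm y < r k" using cover by blast
    have "ennreal (f y) \<le> (\<Sum>k\<in>{k}. ennreal (c k) * indicator (ball 0 (r k)) y)"
      using k pos by (auto intro: ennreal_leI)
    also have "\<dots> \<le> (\<Sum>k. ennreal (c k) * indicator (ball 0 (r k)) y)"
      by (rule sum_le_suminf) auto
    finally show ?thesis .
  qed simp
  then have "(\<integral>\<^sup>+y. ennreal (f y) \<partial>lborel) \<le>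
      (\<integral>\<^sup>+y. (\<Sum>k. ennreal (c k) * indicator (ball (0::'a) (r k)) y) \<partial>lborel)"
    by (intro nn_integral_mono)
  also have "\<dots> = (\<Sum>k. \<integral>\<^sup>+y. ennreal (c k) * indicator (ball (0::'a) (r k)) y \<partial>lborel)"
    by (rule nn_integral_suminf) measurable
  also have "\<dots> = (\<Sum>k. ennreal (V * (c k * r k ^ DIM('a))))"
  proof (intro suminf_cong)
    fix k
    have "(\<integral>\<^sup>+y. ennreal (c k) * indicator (ball (0::'a) (r k)) y \<partial>lborel) =
        ennreal (c k) * ennreal (V * r k ^ DIM('a))"
      using pos by (simp add: nn_integral_cmult emeasure_ball V_def)
    also have "\<dots> = ennreal (c k * (V * r k ^ DIM('a)))"
      using pos V by (intro ennreal_mult[symmetric]) auto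
    finally show "(\<integral>\<^sup>+y. ennreal (c k) * indicator (ball (0::'a) (r k)) y \<partial>lborel) =
        ennreal (V * (c k * r k ^ DIM('a)))"
      by (simp only: mult.left_commute)
  qed
  also have "\<dots> < \<infinity>"
  proof -
    have "(\<Sum>k. ennreal (V * (c k * r k ^ DIM('a)))) \<noteq> top"
      by (rule ennreal_suminf_neq_top[OF summable_mult[OF sum]]) (use pos V in simp)
    then show ?thesis by (simp only: less_top infinity_ennreal_def)
  qed
  finally show ?thesis .
qed

text \<open>On the shell 2^(-k-1) <= |y| < 2^(-k) the kernel is at most 16 times 16^k, and the
  enclosing ball has volume of order 2^(-kN). For N >= 5 the products are dominated by a geometric
  series of ratio 1/2.\<close>

lemma nn_integral_riesz_near_0:
  assumes "DIM('a::euclidean_space) \<ge> 5"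
  shows "(\<integral>\<^sup>+y. ennreal (indicator (ball (0::'a) 1) y / norm y ^ 4) \<partial>lborel) < \<infinity>"
proof (rule nn_integral_finite_of_ball_cover[where c="\<lambda>k. 16 * 16 ^ k" and r="\<lambda>k. (1 / 2) ^ k"])
  fix y :: 'a assume "indicator (ball 0 1) y / norm y ^ 4 \<noteq> (0::real)"
  then have y: "0 < norm y" "norm y < 1" by (auto simp: indicator_def split: if_splits)
  \<comment> \<open>The least n with 2^(-n) <= |y| is positive because |y| < 1, and its predecessor
    indexes the shell.\<close>
  define n where "n = (LEAST n. (1 / 2) ^ n \<le> norm y)"
  have "\<exists>n. (1 / 2) ^ n \<le> norm y"
    using real_arch_pow_inv[OF y(1), of "1 / 2"] by (auto intro: less_imp_le)
  then have n: "(1 / 2) ^ n \<le> norm y" unfolding n_def by (rule LeastI_ex)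
  have "n \<noteq> 0" using n y by (intro notI) simp
  then obtain k where k: "n = Suc k" by (cases n) auto
  have "\<not> (1 / 2) ^ k \<le> norm y"
    using not_less_Least[of k "\<lambda>n. (1 / 2) ^ n \<le> norm y"] k by (simp add: n_def)
  moreover have "((1 / 2) ^ Suc k) ^ 4 \<le> norm y ^ 4"
    using n k by (intro power_mono) auto
  then have "1 / norm y ^ 4 \<le> 1 / ((1 / 2) ^ Suc k) ^ 4"
    by (intro frac_le) auto
  then have "1 / norm y ^ 4 \<le> 16 * 16 ^ k"
  proof -
    have "((1 / 2 :: real) ^ Suc k) ^ 4 = ((1 / 2) ^ 4) ^ Suc k"
      by (metis power_mult mult.commute)
    also have "\<dots> = 1 / (16 * 16 ^ k)"
      by (simp add: power_divide)
    finally have "1 / ((1 / 2 :: real) ^ Suc k) ^ 4 = 16 * 16 ^ k"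
      by (simp only: divide_divide_eq_right)
    then show ?thesis
      using \<open>1 / norm y ^ 4 \<le> 1 / ((1 / 2) ^ Suc k) ^ 4\<close> by linarith
  qed
  ultimately show "\<exists>k. indicator (ball 0 1) y / norm y ^ 4 \<le> 16 * 16 ^ k \<and> norm y < (1 / 2) ^ k"
    using y by (intro exI[of _ k]) auto
next
  have le: "16 * 16 ^ k * ((1 / 2) ^ k) ^ DIM('a) \<le> 16 * (1 / 2 :: real) ^ k" for k
  proof -
    have "((1 / 2 :: real) ^ k) ^ DIM('a) \<le> ((1 / 2) ^ k) ^ 5"
      using assms by (intro power_decreasing) (auto simp: power_le_one)
    then have "16 ^ k * ((1 / 2) ^ k) ^ DIM('a) \<le> 16 ^ k * ((1 / 2 :: real) ^ k) ^ 5"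
      by (intro mult_left_mono) auto
    also have "\<dots> = (1 / 2 :: real) ^ k"
    proof -
      have "((1 / 2 :: real) ^ k) ^ 5 = ((1 / 2) ^ 5) ^ k"
        by (metis power_mult mult.commute)
      then have "16 ^ k * ((1 / 2 :: real) ^ k) ^ 5 = (16 * (1 / 2) ^ 5) ^ k"
        by (simp only: power_mult_distrib)
      also have "16 * (1 / 2 :: real) ^ 5 = 1 / 2"
        by (simp add: power_divide)
      finally show ?thesis .
    qed
    finally show ?thesis by simp
  qed
  show "summable (\<lambda>k. 16 * 16 ^ k * ((1 / 2) ^ k) ^ DIM('a) :: real)"
  proof (rule summable_comparison_test'[where g="\<lambda>k. 16 * (1 / 2 :: real) ^ k" and N=0])
    show "summable (\<lambda>k. 16 * (1 / 2 :: real) ^ k)"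
      by (intro summable_mult summable_geometric) simp
    fix k
    have "0 \<le> 16 * 16 ^ k * ((1 / 2 :: real) ^ k) ^ DIM('a)"
      by (intro mult_nonneg_nonneg zero_le_power) auto
    then show "norm (16 * 16 ^ k * ((1 / 2 :: real) ^ k) ^ DIM('a)) \<le> 16 * (1 / 2) ^ k"
      using le[of k] by (simp only: real_norm_def abs_of_nonneg)
  qed
qed auto

text \<open>The same argument on the shells 2^k <= |y| < 2^(k+1). The exponent 2N is 4 times N/2:
  the power in the kernel, raised to the exponent conjugate to N/(N - 2).\<close>

lemma nn_integral_inverse_power_at_infinity:
  "(\<integral>\<^sup>+y. ennreal (indicator (- ball (0::'a::euclidean_space) 1) y / norm y ^ (2 * DIM('a))) \<partial>lborel) < \<infinity>"
proof (rule nn_integral_finite_of_ball_cover[where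
      c="\<lambda>k. 1 / (2 ^ k) ^ (2 * DIM('a))" and r="\<lambda>k. 2 ^ Suc k"])
  fix y :: 'a assume "indicator (- ball 0 1) y / norm y ^ (2 * DIM('a)) \<noteq> (0::real)"
  then have y: "norm y \<ge> 1" by (auto simp: indicator_def split: if_splits)
  define n where "n = (LEAST n. norm y < 2 ^ n)"
  have "\<exists>n. norm y < 2 ^ n" using real_arch_pow[of 2 "norm y"] by auto
  then have n: "norm y < 2 ^ n" unfolding n_def by (rule LeastI_ex)
  have "n \<noteq> 0" using n y by (intro notI) simp
  then obtain k where k: "n = Suc k" by (cases n) auto
  have "\<not> norm y < 2 ^ k"
    using not_less_Least[of k "\<lambda>n. norm y < 2 ^ n"] k by (simp add: n_def)
  then have "(2 ^ k) ^ (2 * DIM('a)) \<le> norm y ^ (2 * DIM('a))"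
    by (intro power_mono) auto
  then have "1 / norm y ^ (2 * DIM('a)) \<le> 1 / (2 ^ k) ^ (2 * DIM('a))"
    by (intro frac_le) auto
  then show "\<exists>k. indicator (- ball 0 1) y / norm y ^ (2 * DIM('a)) \<le> 1 / (2 ^ k) ^ (2 * DIM('a)) \<and>
      norm y < 2 ^ Suc k"
    using y n k by (intro exI[of _ k]) auto
next
  let ?N = "DIM('a)"
  have eq: "1 / (2 ^ k) ^ (2 * ?N) * (2 ^ Suc k) ^ ?N = (2 :: real) ^ ?N * ((1 / 2) ^ ?N) ^ k" for k
  proof -
    have "((2::real) ^ Suc k) ^ ?N = 2 ^ ?N * (2 ^ k) ^ ?N"
      by (simp add: power_mult_distrib)
    moreover have "((2::real) ^ k) ^ (2 * ?N) = (2 ^ k) ^ ?N * (2 ^ k) ^ ?N"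
      by (simp add: mult_2 power_add)
    moreover have "((1 / 2 :: real) ^ ?N) ^ k = 1 / (2 ^ k) ^ ?N"
      by (simp add: power_divide power_mult[symmetric] mult.commute)
    ultimately show ?thesis by simp
  qed
  have "(1 / 2 :: real) ^ ?N < 1"
    by (simp add: power_less_one_iff)
  then show "summable (\<lambda>k. 1 / (2 ^ k) ^ (2 * ?N) * (2 ^ Suc k) ^ ?N :: real)"
    unfolding eq by (intro summable_mult summable_geometric) auto
qed auto

text \<open>Valued in \<open>ennreal\<close>, so that additivity and monotonicity hold before
  finiteness is known; \<open>coupling_eq_energy\<close> relates it to the Bochner integrals in
  J.\<close>

definition energy :: "('a::euclidean_space \<Rightarrow> real) \<Rightarrow> ('a \<Rightarrow> real) \<Rightarrow> ennreal" where
  "energy f g = (\<integral>\<^sup>+y. \<integral>\<^sup>+x. ennreal (f x * g y / norm (x - y) ^ 4) \<partial>lborel \<partial>lborel)"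

lemma energy_commute:
  assumes [measurable]: "f \<in> borel_measurable borel" "g \<in> borel_measurable borel"
  shows "energy f g = energy g f"
proof -
  have "energy f g = (\<integral>\<^sup>+x. \<integral>\<^sup>+y. ennreal (f x * g y / norm (x - y) ^ 4) \<partial>lborel \<partial>lborel)"
    unfolding energy_def by (rule lborel_pair.Fubini') measurable
  then show ?thesis
    by (simp add: energy_def norm_minus_commute mult.commute)
qed

lemma energy_mono:
  assumes "\<And>x. 0 \<le> f x" "\<And>x. f x \<le> f' x" "\<And>x. 0 \<le> g x" "\<And>x. g x \<le> g' x"
  shows "energy f g \<le> energy f' g'"
  unfolding energy_def
  by (intro nn_integral_mono ennreal_leI divide_right_mono mult_mono)
    (auto intro: assms order_trans[OF assms(1,2)] order_trans[OF assms(3,4)])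

lemma energy_add_left:
  assumes [measurable]: "f \<in> borel_measurable borel" "f' \<in> borel_measurable borel" "g \<in> borel_measurable borel"
    and nn: "\<And>x. 0 \<le> f x" "\<And>x. 0 \<le> f' x" "\<And>x. 0 \<le> g x"
  shows "energy (\<lambda>x. f x + f' x) g = energy f g + energy f' g"
proof -
  have "ennreal ((f x + f' x) * g y / norm (x - y) ^ 4) =
      ennreal (f x * g y / norm (x - y) ^ 4) + ennreal (f' x * g y / norm (x - y) ^ 4)" for x y
    using nn by (simp add: add_divide_distrib distrib_right flip: ennreal_plus)
  then show ?thesis
    unfolding energy_def by (simp add: nn_integral_add)
qed

lemma energy_add_right:
  assumes [measurable]: "f \<in> borel_measurable borel" "g' \<in> borel_measurable borel" "g \<in> borel_measurable borel"
    and nn: "\<And>x. 0 \<le> f x" "\<And>x. 0 \<le> g' x" "\<And>x. 0 \<le> g x"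
  shows "energy f (\<lambda>x. g x + g' x) = energy f g + energy f g'"
  using energy_add_left[of g g' f] nn
  by (simp add: energy_commute[of f])

lemma Young_le:
  fixes a b :: real
  assumes "p > 1" "r > 1" "1 / p + 1 / r = 1" "a \<ge> 0" "b \<ge> 0"
  shows "a * b \<le> a powr p + b powr r"
proof -
  have "a * b \<le> a powr p / p + b powr r / r"
    using Youngs_inequality[of p r a b] assms by simp
  also have "\<dots> \<le> a powr p / 1 + b powr r / 1"
    using assms by (intro add_mono divide_left_mono) auto
  finally show ?thesis by simp
qed

text \<open>Cut the kernel at distance 1 from x: the near part is a translate of the integral at the
  origin, and beyond it the kernel is at most 1, which leaves the volume of the ball.\<close>

lemma riesz_potential_of_ball_bounded:
  assumes N: "DIM('a::euclidean_space) \<ge> 5"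
  obtains C where "C \<ge> 0" "\<And>x::'a. (\<integral>\<^sup>+y. ennreal (indicator (cball 0 R) y / norm (x - y) ^ 4) \<partial>lborel) \<le> ennreal C"
proof -
  define c0 where "c0 = (\<integral>\<^sup>+y. ennreal (indicator (ball (0::'a) 1) y / norm y ^ 4) \<partial>lborel)"
  define M where "M = emeasure lborel (cball (0::'a) R)"
  have fin: "c0 + M < top"
    using nn_integral_riesz_near_0[OF N] emeasure_lborel_cball_finite[of "0::'a" R]
    by (simp add: c0_def M_def)
  have "(\<integral>\<^sup>+y. ennreal (indicator (cball 0 R) y / norm (x - y) ^ 4) \<partial>lborel) \<le> c0 + M" for x :: 'a
  proof -
    have "(\<integral>\<^sup>+y. ennreal (indicator (cball 0 R) y / norm (x - y) ^ 4) \<partial>lborel) \<le>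
      (\<integral>\<^sup>+y. ennreal (indicator (ball 0 1) (- x + y) / norm (- x + y) ^ 4) + indicator (cball 0 R) y \<partial>lborel)"
    proof (rule nn_integral_mono)
      fix y :: 'a
      have e: "norm (- x + y) = norm (x - y)" by (simp add: norm_minus_commute)
      show "ennreal (indicator (cball 0 R) y / norm (x - y) ^ 4) \<le>
        ennreal (indicator (ball 0 1) (- x + y) / norm (- x + y) ^ 4) + indicator (cball 0 R) y"
      proof (cases "norm (x - y) < 1")
        case True
        then have "ennreal (indicator (cball 0 R) y / norm (x - y) ^ 4) \<le>
            ennreal (indicator (ball 0 1) (- x + y) / norm (- x + y) ^ 4)"
          unfolding e by (intro ennreal_leI divide_right_mono) (auto simp: e indicator_def norm_minus_commute)
        then show ?thesis by (rule add_increasing2[rotated]) simp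
      next
        case False
        then have "ennreal (indicator (cball 0 R) y / norm (x - y) ^ 4) \<le> indicator (cball 0 R) y"
          by (auto simp: indicator_def divide_le_eq_1 ennreal_le_1 intro!: one_le_power)
        then show ?thesis by (rule add_increasing[rotated]) simp
      qed
    qed
    also have "\<dots> = (\<integral>\<^sup>+y. ennreal (indicator (ball 0 1) (- x + y) / norm (- x + y) ^ 4) \<partial>lborel) + M"
      by (subst nn_integral_add) (auto simp: M_def)
    also have "(\<integral>\<^sup>+y. ennreal (indicator (ball 0 1) (- x + y) / norm (- x + y) ^ 4) \<partial>lborel) = c0"
      unfolding c0_def
      by (rule nn_integral_translate[where f="\<lambda>y. ennreal (indicator (ball 0 1) y / norm y ^ 4)"]) measurable
    finally show ?thesis .
  qed
  moreover obtain C where "C \<ge> 0" "c0 + M = ennreal C"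
    using fin by (cases "c0 + M") auto
  ultimately show thesis using that by simp
qed

lemma riesz_potential_of_ball_decay:
  fixes x :: "'a::euclidean_space"
  assumes R: "R > 0" and x: "norm x \<ge> 2 * R"
  shows "(\<integral>\<^sup>+y. ennreal (indicator (cball 0 R) y / norm (x - y) ^ 4) \<partial>lborel) \<le>
    ennreal (16 * measure lborel (cball (0::'a) R) / norm x ^ 4)"
proof -
  have "(\<integral>\<^sup>+y. ennreal (indicator (cball 0 R) y / norm (x - y) ^ 4) \<partial>lborel) \<le>
      (\<integral>\<^sup>+y. ennreal (16 / norm x ^ 4) * indicator (cball (0::'a) R) y \<partial>lborel)"
  proof (rule nn_integral_mono)
    fix y :: 'a
    show "ennreal (indicator (cball 0 R) y / norm (x - y) ^ 4) \<le> ennreal (16 / norm x ^ 4) * indicator (cball 0 R) y"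
    proof (cases "norm y \<le> R")
      case True
      \<comment> \<open>Here |y| <= R <= |x|/2; the fourth power of the factor 2 is the constant
        16.\<close>
      then have "norm x / 2 \<le> norm (x - y)"
        using x norm_triangle_ineq2[of x y] by linarith
      then have "(norm x / 2) ^ 4 \<le> norm (x - y) ^ 4"
        by (intro power_mono) auto
      moreover have "norm x > 0" using R x by linarith
      ultimately have "1 / norm (x - y) ^ 4 \<le> 1 / (norm x / 2) ^ 4"
        by (intro divide_left_mono) (auto intro!: mult_pos_pos elim: less_le_trans[rotated])
      then show ?thesis using True by (auto simp: power_divide intro!: ennreal_leI)
    qed simp
  qed
  also have "\<dots> = ennreal (16 / norm x ^ 4) * emeasure lborel (cball (0::'a) R)"
    by (simp add: nn_integral_cmult)
  also have "emeasure lborel (cball (0::'a) R) = ennreal (measure lborel (cball (0::'a) R))"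
    using emeasure_lborel_cball_finite by (intro emeasure_eq_ennreal_measure) (auto simp: less_top)
  finally show ?thesis
    by (simp flip: ennreal_mult)
qed

text \<open>The potential of a ball is bounded and decays like |x|^(-4). Within radius 2R' the bound
  and w <= 1 + w^p suffice; outside, Young's inequality with the exponents p = N/(N - 2) and N/2
  leaves w^p and |x|^(-2N), both integrable there.\<close>

lemma energy_finite:
  fixes w f :: "'a::euclidean_space \<Rightarrow> real"
  assumes N: "DIM('a) \<ge> 5"
    and [measurable]: "w \<in> borel_measurable borel" "f \<in> borel_measurable borel"
    and w: "\<And>x. w x \<ge> 0" "integrable lborel (\<lambda>x. w x powr (real DIM('a) / (real DIM('a) - 2)))"
    and f: "\<And>y. 0 \<le> f y" "\<And>y. f y \<le> B" "\<And>y. norm y > R \<Longrightarrow> f y = 0"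
  shows "energy w f < \<infinity>"
proof -
  \<comment> \<open>At least 1, so that |x| >= 1 holds outside the ball of radius 2R' and the
    integral at infinity applies.\<close>
  define R' where "R' = max R 1"
  define p where "p = real DIM('a) / (real DIM('a) - 2)"
  define M where "M = 16 * measure lborel (cball (0::'a) R')"
  let ?K = "\<lambda>x. \<integral>\<^sup>+y. ennreal (indicator (cball 0 R') y / norm (x - y) ^ 4) \<partial>(lborel :: 'a measure)"
  let ?h = "\<lambda>x::'a. indicator (- ball 0 1) x / norm x ^ (2 * DIM('a))"
  have B: "B \<ge> 0" using f(1,2)[of 0] by linarith
  have M: "M \<ge> 0" by (simp add: M_def)
  have R': "R' \<ge> 1" by (simp add: R'_def)
  obtain C where C: "C \<ge> 0" "\<And>x::'a. ?K x \<le> ennreal C"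
    using riesz_potential_of_ball_bounded[OF N] by blast
  have p: "p > 1" "real DIM('a) / 2 > 1" "1 / p + 1 / (real DIM('a) / 2) = 1"
    using N by (auto simp: p_def field_simps)
  have pt: "ennreal (w x) * ?K x \<le>
      ennreal (C * (indicator (cball 0 (2 * R')) x + w x powr p) + M * (w x powr p + ?h x))" for x
  proof (cases "norm x < 2 * R'")
    case True
    have "w x \<le> 1 + w x powr p"
    proof (cases "w x \<le> 1")
      case False
      then have "w x powr 1 \<le> w x powr p" using p by (intro powr_mono) auto
      then show ?thesis using False by simp
    qed (simp add: add_increasing2)
    then have "w x * C \<le> (1 + w x powr p) * C"
      using C(1) by (intro mult_right_mono) auto
    also have "\<dots> \<le> C * (indicator (cball 0 (2 * R')) x + w x powr p) + M * (w x powr p + ?h x)"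
      using True M by (simp add: mult.commute[of C])
    finally have "ennreal (w x * C) \<le>
      ennreal (C * (indicator (cball 0 (2 * R')) x + w x powr p) + M * (w x powr p + ?h x))"
      by (rule ennreal_leI)
    moreover have "ennreal (w x) * ?K x \<le> ennreal (w x) * ennreal C"
      using C(2) by (intro mult_left_mono) auto
    ultimately show ?thesis
      using w(1) C(1) by (simp add: ennreal_mult)
  next
    case False
    then have x1: "norm x \<ge> 1" using R' by linarith
    have "ennreal (w x) * ?K x \<le> ennreal (w x) * ennreal (M / norm x ^ 4)"
      using riesz_potential_of_ball_decay[of R' x] False R' by (intro mult_left_mono) (auto simp: M_def)
    also have "\<dots> = ennreal (M * (w x * (1 / norm x ^ 4)))"
      using w(1) M by (simp add: mult_ac flip: ennreal_mult)
    also have "\<dots> \<le> ennreal (M * (w x powr p + ?h x))"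
    proof (intro ennreal_leI mult_left_mono M)
      have "(1 / norm x ^ 4) powr (real DIM('a) / 2) = ?h x"
      proof -
        have "norm x ^ 4 = norm x powr 4"
          using x1 by simp
        then have "(norm x ^ 4) powr (real DIM('a) / 2) = norm x powr real (2 * DIM('a))"
          by (simp only: powr_powr) simp
        also have "\<dots> = norm x ^ (2 * DIM('a))"
          using x1 by (intro powr_realpow) auto
        finally show ?thesis
          using x1 by (subst powr_divide) auto
      qed
      then show "w x * (1 / norm x ^ 4) \<le> w x powr p + ?h x"
        using Young_le[OF p w(1)[of x], of "1 / norm x ^ 4"] by simp
    qed
    also have "\<dots> \<le> ennreal (C * (indicator (cball 0 (2 * R')) x + w x powr p) + M * (w x powr p + ?h x))"
      using C(1) by (intro ennreal_leI) simp
    finally show ?thesis .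
  qed
  have "energy w f = (\<integral>\<^sup>+x. \<integral>\<^sup>+y. ennreal (w x * f y / norm (x - y) ^ 4) \<partial>lborel \<partial>lborel)"
    unfolding energy_def by (rule lborel_pair.Fubini') measurable
  also have "\<dots> \<le> (\<integral>\<^sup>+x. ennreal B * (ennreal (w x) * ?K x) \<partial>lborel)"
  proof (rule nn_integral_mono)
    fix x :: 'a
    have "(\<integral>\<^sup>+y. ennreal (w x * f y / norm (x - y) ^ 4) \<partial>lborel) \<le>
        (\<integral>\<^sup>+y. ennreal (B * w x) * ennreal (indicator (cball 0 R') y / norm (x - y) ^ 4) \<partial>lborel)"
    proof (rule nn_integral_mono)
      fix y :: 'a
      have "f y \<le> B * indicator (cball 0 R') y"
        using f(2)[of y] f(3)[of y] by (auto simp: indicator_def R'_def)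
      then have "w x * f y / norm (x - y) ^ 4 \<le> B * w x * (indicator (cball 0 R') y / norm (x - y) ^ 4)"
        using mult_left_mono[OF _ w(1)[of x], of "f y" "B * indicator (cball 0 R') y"]
          divide_right_mono[of "w x * f y" "w x * (B * indicator (cball 0 R') y)" "norm (x - y) ^ 4"]
        by (simp add: mult_ac)
      then show "ennreal (w x * f y / norm (x - y) ^ 4) \<le>
          ennreal (B * w x) * ennreal (indicator (cball 0 R') y / norm (x - y) ^ 4)"
        using B w(1) by (simp add: ennreal_leI flip: ennreal_mult)
    qed
    also have "\<dots> = ennreal (B * w x) * ?K x"
      by (rule nn_integral_cmult) measurable
    finally show "(\<integral>\<^sup>+y. ennreal (w x * f y / norm (x - y) ^ 4) \<partial>lborel) \<le> ennreal B * (ennreal (w x) * ?K x)"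
      using B w(1) by (simp add: ennreal_mult mult.assoc)
  qed
  also have "\<dots> = ennreal B * (\<integral>\<^sup>+x. ennreal (w x) * ?K x \<partial>lborel)"
    by (rule nn_integral_cmult) measurable
  also have "\<dots> < \<infinity>"
  proof -
    have "integrable lborel (\<lambda>x. C * (indicator (cball 0 (2 * R')) x + w x powr p) + M * (w x powr p + ?h x))"
    proof (intro Bochner_Integration.integrable_add integrable_mult_right)
      show "integrable lborel (indicator (cball 0 (2 * R')) :: 'a \<Rightarrow> real)"
        by (rule integrable_bounded_support[of _ 1 "2 * R'"]) (auto simp: indicator_def)
      show "integrable lborel ?h"
        using nn_integral_inverse_power_at_infinity[where 'a='a] by (intro integrableI_nonneg) auto
    qed (use w(2) in \<open>auto simp: p_def\<close>)
    then have "(\<integral>\<^sup>+x. ennreal (C * (indicator (cball 0 (2 * R')) x + w x powr p) + M * (w x powr p + ?h x)) \<partial>lborel) < \<infinity>"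
      using C(1) M by (subst (asm) integrable_iff_bounded) (auto simp: indicator_def)
    then have "(\<integral>\<^sup>+x. ennreal (w x) * ?K x \<partial>lborel) < \<infinity>"
      by (rule le_less_trans[rotated]) (intro nn_integral_mono pt)
    then show ?thesis
      by (simp add: ennreal_mult_less_top)
  qed
  finally show ?thesis .
qed

text \<open>Against the indicator of each ball the energy is finite, hence so is the inner integral
  for almost every y in that ball; \<open>g y\<close> enters only as a finite factor. This keeps the
  inner Bochner integrals in \<open>coupling\<close> from collapsing to 0.\<close>

lemma AE_potential_finite:
  fixes w g :: "'a::euclidean_space \<Rightarrow> real"
  assumes N: "DIM('a) \<ge> 5"
    and [measurable]: "w \<in> borel_measurable borel"
    and w: "\<And>x. w x \<ge> 0" "integrable lborel (\<lambda>x. w x powr (real DIM('a) / (real DIM('a) - 2)))"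
    and g: "\<And>y. g y \<ge> 0"
  shows "AE y in lborel. (\<integral>\<^sup>+x. ennreal (w x * g y / norm (x - y) ^ 4) \<partial>lborel) < \<infinity>"
proof -
  let ?i = "\<lambda>n. indicator (cball 0 (real n)) :: 'a \<Rightarrow> real"
  have "AE y in lborel. (\<integral>\<^sup>+x. ennreal (w x * ?i n y / norm (x - y) ^ 4) \<partial>lborel) \<noteq> \<infinity>" for n
  proof (rule nn_integral_noteq_infinite)
    show "(\<integral>\<^sup>+y. \<integral>\<^sup>+x. ennreal (w x * ?i n y / norm (x - y) ^ 4) \<partial>lborel \<partial>lborel) \<noteq> \<infinity>"
      using energy_finite[OF N _ _ w, of "?i n" 1 "real n"] by (auto simp: energy_def indicator_def)
  qed measurable
  then have "AE y in lborel. \<forall>n. (\<integral>\<^sup>+x. ennreal (w x * ?i n y / norm (x - y) ^ 4) \<partial>lborel) \<noteq> \<infinity>"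
    unfolding AE_all_countable by blast
  then show ?thesis
  proof eventually_elim
    case (elim y)
    obtain n where "norm y \<le> real n" using real_arch_simple by blast
    then have fin: "(\<integral>\<^sup>+x. ennreal (w x / norm (x - y) ^ 4) \<partial>lborel) < \<infinity>"
      using elim[THEN spec, of n] by (simp add: less_top)
    have "(\<integral>\<^sup>+x. ennreal (w x * g y / norm (x - y) ^ 4) \<partial>lborel) =
        (\<integral>\<^sup>+x. ennreal (g y) * ennreal (w x / norm (x - y) ^ 4) \<partial>lborel)"
      using g w(1) by (intro nn_integral_cong) (simp add: mult_ac flip: ennreal_mult)
    also have "\<dots> = ennreal (g y) * (\<integral>\<^sup>+x. ennreal (w x / norm (x - y) ^ 4) \<partial>lborel)"
      by (rule nn_integral_cmult) measurable
    finally show ?case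
      using fin by (simp add: ennreal_mult_less_top)
  qed
qed

subsection \<open>The space \<open>D\<^sup>1\<^sup>,\<^sup>2\<close>\<close>

abbreviation crit :: "'a::euclidean_space itself \<Rightarrow> real" where
  "crit _ \<equiv> 2 * real DIM('a) / (real DIM('a) - 2)"

definition dirichlet :: "('a::euclidean_space \<Rightarrow> real) \<Rightarrow> real" where
  "dirichlet u = (LINT x|lborel. (norm (weak_grad u x))\<^sup>2)"

definition potential :: "('a::euclidean_space \<Rightarrow> real) \<Rightarrow> ('a \<Rightarrow> real) \<Rightarrow> real" where
  "potential V u = (LINT x|lborel. V x * (u x)\<^sup>2)"

lemma LpD [measurable_dest]: "u \<in> Lp q \<Longrightarrow> u \<in> borel_measurable borel"
  by (simp add: Lp_def)

lemma Lp_integrable: "u \<in> Lp q \<Longrightarrow> integrable lborel (\<lambda>x. \<bar>u x\<bar> powr q)"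
  by (simp add: Lp_def)

lemma weak_gradient_measurable: "is_weak_gradient u g \<Longrightarrow> g \<in> borel_measurable borel"
  by (simp add: is_weak_gradient_def locally_integrable_def)

lemma D12_Lp:
  fixes u :: "'a::euclidean_space \<Rightarrow> real"
  shows "u \<in> D12 \<Longrightarrow> u \<in> Lp (crit TYPE('a))"
  by (simp add: D12_def)

lemma D12_measurable [measurable_dest]: "u \<in> D12 \<Longrightarrow> u \<in> borel_measurable borel"
  by (simp add: D12_def Lp_def)

lemma D12_weak_gradient: "u \<in> D12 \<Longrightarrow> is_weak_gradient u (weak_grad u)"
  by (auto simp: D12_def intro: is_weak_gradient_weak_grad)

lemma D12_integrable: "u \<in> D12 \<Longrightarrow> integrable lborel (\<lambda>x. (norm (weak_grad u x))\<^sup>2)"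
  by (simp add: D12_def)

lemma weak_grad_measurable: "u \<in> D12 \<Longrightarrow> weak_grad u \<in> borel_measurable borel"
  using D12_weak_gradient weak_gradient_measurable by blast

lemma dirichlet_eq:
  assumes "is_weak_gradient u g"
  shows "dirichlet u = (LINT x|lborel. (norm (g x))\<^sup>2)"
proof -
  have [measurable]: "g \<in> borel_measurable borel" "weak_grad u \<in> borel_measurable borel"
    using assms is_weak_gradient_weak_grad[OF assms] by (auto intro: weak_gradient_measurable)
  have "AE x in lborel. (norm (weak_grad u x))\<^sup>2 = (norm (g x))\<^sup>2"
    using weak_grad_AE_eq[OF assms] by eventually_elim simp
  then show ?thesis
    unfolding dirichlet_def by (intro integral_cong_AE) auto
qed

lemma D12_I:
  fixes u :: "'a::euclidean_space \<Rightarrow> real"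
  assumes "u \<in> Lp (crit TYPE('a))" "is_weak_gradient u g" "integrable lborel (\<lambda>x. (norm (g x))\<^sup>2)"
  shows "u \<in> D12"
proof -
  have [measurable]: "g \<in> borel_measurable borel" "weak_grad u \<in> borel_measurable borel"
    using assms is_weak_gradient_weak_grad[OF assms(2)] by (auto intro: weak_gradient_measurable)
  have "AE x in lborel. (norm (g x))\<^sup>2 = (norm (weak_grad u x))\<^sup>2"
    using weak_grad_AE_eq[OF assms(2)] by eventually_elim simp
  then have "integrable lborel (\<lambda>x. (norm (weak_grad u x))\<^sup>2)"
    using assms(3) by (subst (asm) integrable_cong_AE) auto
  then show ?thesis
    using assms by (auto simp: D12_def)
qed

lemma weak_gradient_cmult: "is_weak_gradient u g \<Longrightarrow> is_weak_gradient (\<lambda>x. c * u x) (\<lambda>x. c *\<^sub>R g x)"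
  using is_weak_gradient_lincomb[of u g u g c 0] by simp

lemma D12_cmult:
  fixes u :: "'a::euclidean_space \<Rightarrow> real"
  assumes u: "u \<in> D12"
  shows "(\<lambda>x. c * u x) \<in> D12"
proof (rule D12_I[OF _ weak_gradient_cmult[OF D12_weak_gradient[OF u]]])
  have "integrable lborel (\<lambda>x. \<bar>c\<bar> powr crit TYPE('a) * \<bar>u x\<bar> powr crit TYPE('a))"
    by (intro integrable_mult_right Lp_integrable D12_Lp u)
  then show "(\<lambda>x. c * u x) \<in> Lp (crit TYPE('a))"
    using D12_measurable[OF u] by (simp add: Lp_def abs_mult powr_mult)
  show "integrable lborel (\<lambda>x. (norm (c *\<^sub>R weak_grad u x))\<^sup>2)"
    using D12_integrable[OF u] by (simp add: power_mult_distrib)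
qed

lemma dirichlet_cmult: "u \<in> D12 \<Longrightarrow> dirichlet (\<lambda>x. c * u x) = c\<^sup>2 * dirichlet u"
  by (simp only: dirichlet_eq[OF weak_gradient_cmult[OF D12_weak_gradient]])
    (simp add: dirichlet_def power_mult_distrib)

lemma dirichlet_nonneg: "dirichlet u \<ge> 0"
  by (simp add: dirichlet_def)

lemma D12_translate:
  fixes u :: "'a::euclidean_space \<Rightarrow> real"
  assumes u: "u \<in> D12"
  shows "(\<lambda>x. u (z + x)) \<in> D12"
proof (rule D12_I[OF _ is_weak_gradient_translate[OF D12_weak_gradient[OF u]]])
  have [measurable]: "u \<in> borel_measurable borel" "weak_grad u \<in> borel_measurable borel"
    using u by (auto intro: D12_measurable weak_grad_measurable)
  show "(\<lambda>x. u (z + x)) \<in> Lp (crit TYPE('a))"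
    using D12_Lp[OF u] integral_translate(2)[of "\<lambda>x. \<bar>u x\<bar> powr crit TYPE('a)" z] by (simp add: Lp_def)
  show "integrable lborel (\<lambda>x. (norm (weak_grad u (z + x)))\<^sup>2)"
    using D12_integrable[OF u] integral_translate(2)[of "\<lambda>x. (norm (weak_grad u x))\<^sup>2" z] by simp
qed

lemma dirichlet_translate:
  assumes u: "u \<in> D12"
  shows "dirichlet (\<lambda>x. u (z + x)) = dirichlet u"
proof -
  have [measurable]: "weak_grad u \<in> borel_measurable borel" using u by (rule weak_grad_measurable)
  show ?thesis
    unfolding dirichlet_eq[OF is_weak_gradient_translate[OF D12_weak_gradient[OF u]]] dirichlet_def
    by (rule integral_translate(1)[where f="\<lambda>x. (norm (weak_grad u x))\<^sup>2"]) measurable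
qed

lemma grad_measurable:
  assumes "test_function \<phi>"
  shows "grad \<phi> \<in> borel_measurable borel"
  using weak_gradient_measurable is_weak_gradient_test_function[OF assms] by blast

lemma integrable_grad_sq:
  fixes \<phi> :: "'a::euclidean_space \<Rightarrow> real"
  assumes \<phi>: "test_function \<phi>"
  shows "integrable lborel (\<lambda>x. (norm (grad \<phi> x))\<^sup>2)"
proof -
  have "integrable lborel (\<lambda>x. \<Sum>b\<in>Basis. frechet_derivative \<phi> (at x) b * frechet_derivative \<phi> (at x) b)"
    by (intro Bochner_Integration.integrable_sum test_function_integrable_mult
        locally_integrable_test_function test_function_partial \<phi>)
  moreover have "(norm (grad \<phi> x))\<^sup>2 =
      (\<Sum>b\<in>Basis. frechet_derivative \<phi> (at x) b * frechet_derivative \<phi> (at x) b)" for x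
    unfolding power2_norm_eq_inner euclidean_inner[of "grad \<phi> x" "grad \<phi> x"]
    by (intro sum.cong refl) (simp add: grad_inner)
  ultimately show ?thesis by simp
qed

lemma integrable_weak_grad_grad:
  assumes u: "u \<in> D12" and \<phi>: "test_function \<phi>"
  shows "integrable lborel (\<lambda>x. weak_grad u x \<bullet> grad \<phi> x)"
proof (rule Bochner_Integration.integrable_bound)
  show "integrable lborel (\<lambda>x. (norm (weak_grad u x))\<^sup>2 + (norm (grad \<phi> x))\<^sup>2)"
    by (intro Bochner_Integration.integrable_add D12_integrable u integrable_grad_sq \<phi>)
  have [measurable]: "weak_grad u \<in> borel_measurable borel" "grad \<phi> \<in> borel_measurable borel"
    using u \<phi> by (auto intro: weak_grad_measurable grad_measurable)
  show "(\<lambda>x. weak_grad u x \<bullet> grad \<phi> x) \<in> borel_measurable lborel" by simp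
  have "\<bar>a \<bullet> b\<bar> \<le> (norm a)\<^sup>2 + (norm b)\<^sup>2" for a b :: 'a
  proof -
    have "\<bar>a \<bullet> b\<bar> \<le> norm a * norm b" by (rule Cauchy_Schwarz_ineq2)
    also have "\<dots> \<le> (norm a)\<^sup>2 + (norm b)\<^sup>2"
      using sum_squares_bound[of "norm a" "norm b"] mult_nonneg_nonneg[OF norm_ge_zero norm_ge_zero, of a b]
      by (simp only: mult.assoc)
    finally show ?thesis .
  qed
  then show "AE x in lborel. norm (weak_grad u x \<bullet> grad \<phi> x) \<le>
      norm ((norm (weak_grad u x))\<^sup>2 + (norm (grad \<phi> x))\<^sup>2)"
    by (intro AE_I2) simp
qed

lemma Lp_add_test_function:
  fixes u :: "'a::euclidean_space \<Rightarrow> real"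
  assumes u: "u \<in> Lp q" and \<phi>: "test_function \<phi>" and q: "q > 0"
  shows "(\<lambda>x. u x + t * \<phi> x) \<in> Lp q"
proof -
  obtain B where B: "B \<ge> 0" "\<And>x. \<bar>\<phi> x\<bar> \<le> B" using test_function_bounded[OF \<phi>] by blast
  obtain R where R: "\<And>x. norm x > R \<Longrightarrow> \<phi> x = 0" using test_function_support[OF \<phi>] by blast
  have [measurable]: "u \<in> borel_measurable borel" "\<phi> \<in> borel_measurable borel"
    using u \<phi> by (auto intro: LpD test_function_measurable)
  have int\<phi>: "integrable lborel (\<lambda>x. \<bar>\<phi> x\<bar> powr q)"
  proof (rule integrable_bounded_support)
    show "\<bar>\<bar>\<phi> x\<bar> powr q\<bar> \<le> B powr q" for x
      using B q by (simp add: powr_mono2)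
    show "\<bar>\<phi> x\<bar> powr q = 0" if "norm x > R" for x
      using R[OF that] by simp
  qed measurable
  have "integrable lborel (\<lambda>x. \<bar>u x + t * \<phi> x\<bar> powr q)"
  proof (rule Bochner_Integration.integrable_bound)
    show "integrable lborel (\<lambda>x. 2 powr q * (\<bar>u x\<bar> powr q + \<bar>t\<bar> powr q * \<bar>\<phi> x\<bar> powr q))"
      using Lp_integrable[OF u] int\<phi> by simp
    have "\<bar>a + t * b\<bar> powr q \<le> 2 powr q * (\<bar>a\<bar> powr q + \<bar>t\<bar> powr q * \<bar>b\<bar> powr q)" for a b :: real
    proof -
      have "\<bar>a + t * b\<bar> \<le> 2 * max \<bar>a\<bar> \<bar>t * b\<bar>" by linarith
      then have "\<bar>a + t * b\<bar> powr q \<le> (2 * max \<bar>a\<bar> \<bar>t * b\<bar>) powr q"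
        using q by (intro powr_mono2) auto
      also have "\<dots> = 2 powr q * max \<bar>a\<bar> \<bar>t * b\<bar> powr q"
        by (rule powr_mult)
      also have "max \<bar>a\<bar> \<bar>t * b\<bar> powr q \<le> \<bar>a\<bar> powr q + \<bar>t * b\<bar> powr q"
        by (simp add: max_def)
      also have "\<bar>t * b\<bar> powr q = \<bar>t\<bar> powr q * \<bar>b\<bar> powr q"
        by (simp add: abs_mult powr_mult)
      finally show ?thesis by simp
    qed
    then show "AE x in lborel. norm (\<bar>u x + t * \<phi> x\<bar> powr q) \<le>
        norm (2 powr q * (\<bar>u x\<bar> powr q + \<bar>t\<bar> powr q * \<bar>\<phi> x\<bar> powr q))"
      by (intro AE_I2) (simp add: abs_mult)
  qed measurable
  then show ?thesis by (simp add: Lp_def)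
qed

lemma crit_gt_1: "DIM('a::euclidean_space) \<ge> 5 \<Longrightarrow> crit TYPE('a) > 1"
  by (simp add: less_divide_eq)

lemma weak_gradient_add_test_function:
  assumes "is_weak_gradient u g" "test_function \<phi>"
  shows "is_weak_gradient (\<lambda>x. u x + t * \<phi> x) (\<lambda>x. g x + t *\<^sub>R grad \<phi> x)"
  using is_weak_gradient_lincomb[OF assms(1) is_weak_gradient_test_function[OF assms(2)], of 1 t] by simp

lemma norm_add_scaleR_sq:
  fixes a b :: "'a::real_inner"
  shows "(norm (a + t *\<^sub>R b))\<^sup>2 = (norm a)\<^sup>2 + 2 * t * (a \<bullet> b) + t\<^sup>2 * (norm b)\<^sup>2"
  unfolding power2_norm_eq_inner
  by (simp add: inner_add_left inner_add_right inner_commute power2_eq_square algebra_simps)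

lemma D12_add_test_function:
  fixes u :: "'a::euclidean_space \<Rightarrow> real"
  assumes N: "DIM('a) \<ge> 5" and u: "u \<in> D12" and \<phi>: "test_function \<phi>"
  shows "(\<lambda>x. u x + t * \<phi> x) \<in> D12"
    and "dirichlet (\<lambda>x. u x + t * \<phi> x) = dirichlet u + 2 * t * (LINT x|lborel. weak_grad u x \<bullet> grad \<phi> x)
      + t\<^sup>2 * (LINT x|lborel. (norm (grad \<phi> x))\<^sup>2)"
proof -
  note [simp] = D12_integrable[OF u] integrable_grad_sq[OF \<phi>] integrable_weak_grad_grad[OF u \<phi>]
  note wg = weak_gradient_add_test_function[OF D12_weak_gradient[OF u] \<phi>, of t]
  show "(\<lambda>x. u x + t * \<phi> x) \<in> D12"
    using D12_Lp[OF u] \<phi> crit_gt_1[OF N]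
    by (intro D12_I[OF _ wg] Lp_add_test_function) (auto simp: norm_add_scaleR_sq)
  show "dirichlet (\<lambda>x. u x + t * \<phi> x) = dirichlet u + 2 * t * (LINT x|lborel. weak_grad u x \<bullet> grad \<phi> x)
      + t\<^sup>2 * (LINT x|lborel. (norm (grad \<phi> x))\<^sup>2)"
    unfolding dirichlet_eq[OF wg] norm_add_scaleR_sq dirichlet_def by simp
qed

text \<open>Every partial derivative of \<open>\<phi>\<close> is again a test function, so the
  definition of the weak gradient applies to each of them separately.\<close>

lemma integral_laplacian_test_function:
  fixes u :: "'a::euclidean_space \<Rightarrow> real"
  assumes u: "u \<in> D12" and \<phi>: "test_function \<phi>"
  shows "(LINT x|lborel. u x * (\<Sum>b\<in>Basis.
      frechet_derivative (\<lambda>y. frechet_derivative \<phi> (at y) b) (at x) b)) =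
    - (LINT x|lborel. weak_grad u x \<bullet> grad \<phi> x)"
proof -
  let ?\<phi> = "\<lambda>b x. frechet_derivative \<phi> (at x) b"
  have loc: "locally_integrable u" "locally_integrable (\<lambda>x. weak_grad u x \<bullet> b)" for b
    using D12_weak_gradient[OF u] by (auto simp: is_weak_gradient_def intro: locally_integrable_inner)
  have test: "test_function (?\<phi> b)" if "b \<in> Basis" for b
    using \<phi> that by (rule test_function_partial)
  have "(LINT x|lborel. u x * (\<Sum>b\<in>Basis. frechet_derivative (?\<phi> b) (at x) b)) =
      (\<Sum>b\<in>Basis. (LINT x|lborel. u x * frechet_derivative (?\<phi> b) (at x) b))"
    unfolding sum_distrib_left
    by (rule Bochner_Integration.integral_sum) (rule test_function_integrable_mult[OF loc(1) test_function_partial[OF test]])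
  also have "\<dots> = (\<Sum>b\<in>Basis. - (LINT x|lborel. (weak_grad u x \<bullet> b) * ?\<phi> b x))"
    using D12_weak_gradient[OF u] test by (intro sum.cong refl) (auto simp: is_weak_gradient_def)
  also have "\<dots> = - (\<Sum>b\<in>Basis. (LINT x|lborel. (weak_grad u x \<bullet> b) * ?\<phi> b x))"
    by (rule sum_negf)
  also have "(\<Sum>b\<in>Basis. (LINT x|lborel. (weak_grad u x \<bullet> b) * ?\<phi> b x)) =
      (LINT x|lborel. (\<Sum>b\<in>Basis. (weak_grad u x \<bullet> b) * ?\<phi> b x))"
  proof (rule Bochner_Integration.integral_sum[symmetric])
    show "integrable lborel (\<lambda>x. (weak_grad u x \<bullet> b) * ?\<phi> b x)" if "b \<in> Basis" for b
      using loc(2) test[OF that] by (rule test_function_integrable_mult)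
  qed
  also have "\<dots> = (LINT x|lborel. weak_grad u x \<bullet> grad \<phi> x)"
  proof (intro Bochner_Integration.integral_cong refl)
    fix x
    show "(\<Sum>b\<in>Basis. (weak_grad u x \<bullet> b) * ?\<phi> b x) = weak_grad u x \<bullet> grad \<phi> x"
      unfolding euclidean_inner[of "weak_grad u x" "grad \<phi> x"] by (simp add: grad_inner)
  qed
  finally show ?thesis .
qed

lemma superharmonic_I:
  assumes u: "u \<in> D12"
    and "\<And>\<phi>. test_function \<phi> \<Longrightarrow> (\<And>x. \<phi> x \<ge> 0) \<Longrightarrow> (LINT x|lborel. weak_grad u x \<bullet> grad \<phi> x) \<ge> 0"
  shows "superharmonic u"
proof
  show "locally_integrable u"
    using D12_weak_gradient[OF u] by (simp add: is_weak_gradient_def)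
qed (use assms(2) in \<open>simp add: integral_laplacian_test_function[OF u]\<close>)

text \<open>With vanishing gradient every multiple of u is superharmonic, and membership in L^q
  makes both u and -u nonnegative. This yields a positive Dirichlet integral for nonzero
  pairs.\<close>

lemma dirichlet_eq_0D:
  fixes u :: "'a::euclidean_space \<Rightarrow> real"
  assumes N: "DIM('a) \<ge> 5" and u: "u \<in> D12" and 0: "dirichlet u = 0"
  shows "AE x in lborel. u x = 0"
proof -
  have [measurable]: "weak_grad u \<in> borel_measurable borel" using u by (rule weak_grad_measurable)
  have "AE x in lborel. (norm (weak_grad u x))\<^sup>2 = 0"
    using integral_nonneg_eq_0_iff_AE[OF D12_integrable[OF u]] 0 by (simp add: dirichlet_def)
  then have zero: "AE x in lborel. weak_grad u x = 0" by simp
  have nonneg: "AE x in lborel. c * u x \<ge> 0" for c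
  proof -
    have cu: "(\<lambda>x. c * u x) \<in> D12" using u by (rule D12_cmult)
    have "AE x in lborel. weak_grad (\<lambda>x. c * u x) x = c *\<^sub>R weak_grad u x"
      by (rule weak_grad_AE_eq[OF weak_gradient_cmult[OF D12_weak_gradient[OF u]]])
    with zero have *: "AE x in lborel. weak_grad (\<lambda>x. c * u x) x = 0"
      by eventually_elim simp
    have "superharmonic (\<lambda>x. c * u x)"
    proof (rule superharmonic_I[OF cu])
      fix \<phi> :: "'a \<Rightarrow> real" assume "test_function \<phi>"
      have "AE x in lborel. weak_grad (\<lambda>x. c * u x) x \<bullet> grad \<phi> x = 0"
        using * by eventually_elim simp
      then show "0 \<le> (LINT x|lborel. weak_grad (\<lambda>x. c * u x) x \<bullet> grad \<phi> x)"
        by (simp add: integral_eq_zero_AE)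
    qed
    then show ?thesis
      using superharmonic.AE_nonneg[OF _ crit_gt_1[OF N] Lp_integrable[OF D12_Lp[OF cu]]] by blast
  qed
  show ?thesis
    using nonneg[of 1] nonneg[of "-1"] by eventually_elim simp
qed

section \<open>Potential terms and their behaviour under translation\<close>

lemma conjugate_exponents:
  assumes "DIM('a::euclidean_space) \<ge> 5"
  shows "real DIM('a) / 2 > 1" "crit TYPE('a) / 2 > 1" "1 / (real DIM('a) / 2) + 1 / (crit TYPE('a) / 2) = 1"
  using assms by (auto simp: field_simps)

lemma sq_powr_half: "(a\<^sup>2) powr (q / 2) = \<bar>a\<bar> powr q" for a :: real
proof (cases "a = 0")
  case False
  then have "a\<^sup>2 = \<bar>a\<bar> powr 2" by simp
  then show ?thesis by (simp only: powr_powr) simp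
qed simp

text \<open>Young's inequality with the exponents N/2 and N/(N - 2), the latter being half the
  critical exponent.\<close>

lemma integrable_potential:
  fixes u V :: "'a::euclidean_space \<Rightarrow> real"
  assumes N: "DIM('a) \<ge> 5" and V: "V \<in> Lp (real DIM('a) / 2)" and u: "u \<in> Lp (crit TYPE('a))"
  shows "integrable lborel (\<lambda>x. V x * (u x)\<^sup>2)"
proof (rule Bochner_Integration.integrable_bound)
  show "integrable lborel (\<lambda>x. \<bar>V x\<bar> powr (real DIM('a) / 2) + \<bar>u x\<bar> powr (crit TYPE('a)))"
    using Lp_integrable[OF V] Lp_integrable[OF u] by simp
  show "(\<lambda>x. V x * (u x)\<^sup>2) \<in> borel_measurable lborel"
    using LpD[OF V] LpD[OF u] by measurable
  have "\<bar>V x\<bar> * (u x)\<^sup>2 \<le> \<bar>V x\<bar> powr (real DIM('a) / 2) + \<bar>u x\<bar> powr (crit TYPE('a))" for x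
    using Young_le[OF conjugate_exponents[OF N] abs_ge_zero zero_le_power2, of "V x" "u x"]
    unfolding sq_powr_half .
  then show "AE x in lborel. norm (V x * (u x)\<^sup>2) \<le>
      norm (\<bar>V x\<bar> powr (real DIM('a) / 2) + \<bar>u x\<bar> powr (crit TYPE('a)))"
    by (intro AE_I2) (simp add: abs_mult)
qed

lemma potential_cmult: "potential V (\<lambda>x. c * u x) = c\<^sup>2 * potential V u"
  by (simp add: potential_def power_mult_distrib mult_ac flip: integral_mult_right_zero)

lemma potential_nonneg: "AE x in lborel. V x \<ge> 0 \<Longrightarrow> potential V u \<ge> 0"
  unfolding potential_def by (intro integral_nonneg_AE) (auto elim: eventually_mono)

text \<open>The radius n/2 suits translation by n b with |b| = 1: for every x, one of x and n b + x
  has norm at least n/2.\<close>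

lemma integral_tail_tendsto_0:
  fixes f :: "'a::euclidean_space \<Rightarrow> real"
  assumes f: "integrable lborel f"
  shows "(\<lambda>n. LINT x|lborel. f x * indicator {x. norm x \<ge> real n / 2} x) \<longlonglongrightarrow> 0"
proof -
  have [measurable]: "f \<in> borel_measurable borel" using f by auto
  have "(\<lambda>n. LINT x|lborel. f x * indicator {x. norm x \<ge> real n / 2} x) \<longlonglongrightarrow> (LINT x::'a|lborel. (0::real))"
  proof (rule integral_dominated_convergence[where w="\<lambda>x. \<bar>f x\<bar>"])
    have "(\<lambda>n. f x * indicator {x. norm x \<ge> real n / 2} x) \<longlonglongrightarrow> 0" for x
    proof -
      obtain m :: nat where m: "2 * norm x < real m" using reals_Archimedean2 by blast
      have "f x * indicator {x. norm x \<ge> real n / 2} x = 0" if "n \<ge> m" for n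
      proof -
        have "real m \<le> real n" using that by simp
        then show ?thesis using m by (simp add: indicator_def)
      qed
      then show ?thesis
        by (intro tendsto_eventually) (auto simp: eventually_sequentially)
    qed
    then show "AE x in lborel. (\<lambda>n. f x * indicator {x. norm x \<ge> real n / 2} x) \<longlonglongrightarrow> 0" by simp
  qed (use f in \<open>auto simp: indicator_def\<close>)
  then show ?thesis by simp
qed

text \<open>Near the origin the translate of \<open>u\<close> is small in norm, far from it \<open>V\<close> is; Young's inequality
  is applied with opposite weights in the two regions.\<close>

lemma potential_translate_tendsto_0:
  fixes u V :: "'a::euclidean_space \<Rightarrow> real"
  assumes N: "DIM('a) \<ge> 5" and V: "V \<in> Lp (real DIM('a) / 2)" and u: "u \<in> Lp (crit TYPE('a))"
    and b: "b \<in> Basis"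
  shows "(\<lambda>n. potential V (\<lambda>x. u (real n *\<^sub>R b + x))) \<longlonglongrightarrow> 0"
proof -
  define r where "r = real DIM('a) / 2"
  define p where "p = crit TYPE('a) / 2"
  have rp: "r > 1" "p > 1" "1 / r + 1 / p = 1"
    unfolding r_def p_def by (rule conjugate_exponents[OF N])+
  have [measurable]: "V \<in> borel_measurable borel" "u \<in> borel_measurable borel"
    using V u by (auto intro: LpD)
  define f where "f x = \<bar>V x\<bar> powr r" for x
  define g where "g x = (u x)\<^sup>2 powr p" for x
  let ?z = "\<lambda>n. real n *\<^sub>R b"
  let ?I = "\<lambda>n. indicator {x. norm x \<ge> real n / 2} :: 'a \<Rightarrow> real"
  have [measurable]: "f \<in> borel_measurable borel" "g \<in> borel_measurable borel"
    unfolding f_def[abs_def] g_def[abs_def] by measurable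
  have f: "integrable lborel f"
    using Lp_integrable[OF V] by (simp add: f_def[abs_def] r_def)
  have g: "integrable lborel g"
    using Lp_integrable[OF u] unfolding g_def[abs_def] p_def sq_powr_half .
  have nn: "f x \<ge> 0" "g x \<ge> 0" for x by (auto simp: f_def g_def)
  have young: "\<bar>V x\<bar> * (u y)\<^sup>2 \<le> \<kappa> powr r * f x + (1 / \<kappa>) powr p * g y" if "\<kappa> > 0" for \<kappa> x y
  proof -
    have "(\<kappa> * \<bar>V x\<bar>) * ((1 / \<kappa>) * (u y)\<^sup>2) \<le> (\<kappa> * \<bar>V x\<bar>) powr r + ((1 / \<kappa>) * (u y)\<^sup>2) powr p"
      using that by (intro Young_le rp) auto
    also have "(\<kappa> * \<bar>V x\<bar>) powr r = \<kappa> powr r * f x"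
      unfolding f_def by (rule powr_mult)
    also have "((1 / \<kappa>) * (u y)\<^sup>2) powr p = (1 / \<kappa>) powr p * g y"
      unfolding g_def by (rule powr_mult)
    finally show ?thesis using that by simp
  qed
  \<comment> \<open>The first bracket is small for small \<open>\<kappa>\<close>, uniformly in n.
    The second consists of tails and tends to 0 as n grows with \<open>\<kappa>\<close>
    fixed.\<close>
  have bound: "\<bar>potential V (\<lambda>x. u (?z n + x))\<bar> \<le>
      (\<kappa> powr r * (LINT x|lborel. f x) + \<kappa> powr p * (LINT x|lborel. g x))
      + ((1 / \<kappa>) powr p * (LINT x|lborel. g x * ?I n x) + (1 / \<kappa>) powr r * (LINT x|lborel. f x * ?I n x))"
    if \<kappa>: "\<kappa> > 0" for n \<kappa>
  proof -
    let ?gz = "\<lambda>x. g (?z n + x)" and ?Iz = "\<lambda>x. ?I n (?z n + x)"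
    have iI: "integrable lborel (\<lambda>x. h x * ?I n x)" if "integrable lborel h" for h :: "'a \<Rightarrow> real"
      by (rule Bochner_Integration.integrable_bound[OF that]) (use that in \<open>auto simp: indicator_def\<close>)
    have ints [simp]: "integrable lborel f" "integrable lborel ?gz"
      "integrable lborel (\<lambda>x. ?gz x * ?Iz x)" "integrable lborel (\<lambda>x. f x * ?I n x)"
      using f g iI[OF f] iI[OF g] integral_translate(2)[of g "?z n"]
        integral_translate(2)[of "\<lambda>x. g x * ?I n x" "?z n"] by auto
    have pt: "\<bar>V x * (u (?z n + x))\<^sup>2\<bar> \<le>
        \<kappa> powr r * f x + \<kappa> powr p * ?gz x + (1 / \<kappa>) powr p * (?gz x * ?Iz x) + (1 / \<kappa>) powr r * (f x * ?I n x)" for x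
    proof (cases "norm x \<ge> real n / 2")
      case True
      have "\<bar>V x\<bar> * (u (?z n + x))\<^sup>2 \<le> (1 / \<kappa>) powr r * f x + (1 / (1 / \<kappa>)) powr p * ?gz x"
        using \<kappa> by (intro young) simp
      moreover have "0 \<le> \<kappa> powr r * f x" "0 \<le> (1 / \<kappa>) powr p * (?gz x * ?Iz x)"
        using nn by auto
      ultimately show ?thesis using True by (simp add: abs_mult)
    next
      case False
      have "norm (?z n) = real n" using b by simp
      moreover have "norm (?z n) \<le> norm (?z n + x) + norm x"
        using norm_triangle_ineq4[of "?z n + x" x] by simp
      ultimately have "norm (?z n + x) \<ge> real n / 2"
        using False by linarith
      moreover have "\<bar>V x\<bar> * (u (?z n + x))\<^sup>2 \<le> \<kappa> powr r * f x + (1 / \<kappa>) powr p * ?gz x"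
        using \<kappa> by (rule young)
      moreover have "0 \<le> \<kappa> powr p * ?gz x" "0 \<le> (1 / \<kappa>) powr r * (f x * ?I n x)"
        using nn by auto
      ultimately show ?thesis by (simp add: abs_mult)
    qed
    have "\<bar>potential V (\<lambda>x. u (?z n + x))\<bar> \<le> (LINT x|lborel. \<bar>V x * (u (?z n + x))\<^sup>2\<bar>)"
      unfolding potential_def by (rule integral_abs_bound)
    also have "\<dots> \<le> (LINT x|lborel. \<kappa> powr r * f x + \<kappa> powr p * ?gz x
        + (1 / \<kappa>) powr p * (?gz x * ?Iz x) + (1 / \<kappa>) powr r * (f x * ?I n x))"
    proof (rule integral_mono)
      show rhs: "integrable lborel (\<lambda>x. \<kappa> powr r * f x + \<kappa> powr p * ?gz x
        + (1 / \<kappa>) powr p * (?gz x * ?Iz x) + (1 / \<kappa>) powr r * (f x * ?I n x))"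
        by (intro Bochner_Integration.integrable_add integrable_mult_right ints)
      show "integrable lborel (\<lambda>x. \<bar>V x * (u (?z n + x))\<^sup>2\<bar>)"
        by (rule Bochner_Integration.integrable_bound[OF rhs])
          (use pt in \<open>auto intro!: AE_I2 intro: order_trans[OF _ abs_ge_self]\<close>)
    qed (rule pt)
    also have "\<dots> = \<kappa> powr r * (LINT x|lborel. f x) + \<kappa> powr p * (LINT x|lborel. ?gz x)
        + (1 / \<kappa>) powr p * (LINT x|lborel. ?gz x * ?Iz x) + (1 / \<kappa>) powr r * (LINT x|lborel. f x * ?I n x)"
      by (simp only: Bochner_Integration.integral_add Bochner_Integration.integrable_add
          integrable_mult_right ints integral_mult_right_zero)
    also have "(LINT x|lborel. ?gz x) = (LINT x|lborel. g x)"
      by (rule integral_translate(1)) measurable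
    also have "(LINT x|lborel. ?gz x * ?Iz x) = (LINT x|lborel. g x * ?I n x)"
      by (rule integral_translate(1)[where f="\<lambda>x. g x * ?I n x"]) measurable
    finally show ?thesis by simp
  qed
  show ?thesis
  proof (rule LIMSEQ_I)
    fix e :: real assume e: "e > 0"
    let ?A = "\<lambda>\<kappa>. \<kappa> powr r * (LINT x|lborel. f x) + \<kappa> powr p * (LINT x|lborel. g x)"
    have "((\<lambda>\<kappa>::real. \<kappa> powr s) \<longlongrightarrow> 0) (at_right 0)" if "s > 0" for s
      using that by real_asymp
    then have "(?A \<longlongrightarrow> 0 * (LINT x|lborel. f x) + 0 * (LINT x|lborel. g x)) (at_right 0)"
      using rp by (intro tendsto_intros) auto
    then have "eventually (\<lambda>\<kappa>. ?A \<kappa> < e / 2) (at_right 0)"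
      using e by (intro order_tendstoD(2)) auto
    moreover have "eventually (\<lambda>\<kappa>::real. \<kappa> > 0) (at_right 0)"
      by (rule eventually_at_right_less)
    ultimately have "eventually (\<lambda>\<kappa>. ?A \<kappa> < e / 2 \<and> \<kappa> > 0) (at_right (0::real))"
      by (rule eventually_conj)
    then obtain \<kappa> where \<kappa>: "?A \<kappa> < e / 2" "\<kappa> > 0"
      using eventually_happens[of _ "at_right (0::real)"] by auto
    have "(\<lambda>n. (1 / \<kappa>) powr p * (LINT x|lborel. g x * ?I n x) + (1 / \<kappa>) powr r * (LINT x|lborel. f x * ?I n x))
        \<longlonglongrightarrow> (1 / \<kappa>) powr p * 0 + (1 / \<kappa>) powr r * 0"
      by (intro tendsto_intros integral_tail_tendsto_0 f g)
    then have "eventually (\<lambda>n. (1 / \<kappa>) powr p * (LINT x|lborel. g x * ?I n x)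
        + (1 / \<kappa>) powr r * (LINT x|lborel. f x * ?I n x) < e / 2) sequentially"
      using e by (intro order_tendstoD(2)) auto
    then obtain n0 where n0: "\<And>n. n \<ge> n0 \<Longrightarrow> (1 / \<kappa>) powr p * (LINT x|lborel. g x * ?I n x)
        + (1 / \<kappa>) powr r * (LINT x|lborel. f x * ?I n x) < e / 2"
      by (auto simp: eventually_sequentially)
    have "norm (potential V (\<lambda>x. u (?z n + x)) - 0) < e" if "n \<ge> n0" for n
      using bound[OF \<kappa>(2), of n] n0[OF that] \<kappa>(1) by simp
    then show "\<exists>n0. \<forall>n\<ge>n0. norm (potential V (\<lambda>x. u (?z n + x)) - 0) < e" by blast
  qed
qed

subsection \<open>The functional on the Nehari manifold\<close>

definition sq_pos :: "('a \<Rightarrow> real) \<Rightarrow> 'a \<Rightarrow> real" where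
  "sq_pos u x = (pos_part (u x))\<^sup>2"

definition coupling :: "real \<Rightarrow> real \<Rightarrow> real \<Rightarrow> ('a::euclidean_space \<Rightarrow> real) \<Rightarrow> ('a \<Rightarrow> real) \<Rightarrow> real" where
  "coupling \<alpha>1 \<alpha>2 \<beta> u v = (LINT y|lborel. LINT x|lborel.
     (\<alpha>1 * sq_pos u x * sq_pos u y + \<alpha>2 * sq_pos v x * sq_pos v y + 2 * \<beta> * sq_pos u x * sq_pos v y)
     / norm (x - y) ^ 4)"

definition self_energy :: "('a::euclidean_space \<Rightarrow> real) \<Rightarrow> real" where
  "self_energy u = (LINT y|lborel. LINT x|lborel. sq_pos u x * sq_pos u y / norm (x - y) ^ 4)"

definition kinetic :: "('a::euclidean_space \<Rightarrow> real) \<Rightarrow> ('a \<Rightarrow> real) \<Rightarrow> ('a \<Rightarrow> real) \<Rightarrow> ('a \<Rightarrow> real) \<Rightarrow> real" where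
  "kinetic V1 V2 u v = dirichlet u + dirichlet v + potential V1 u + potential V2 v"

lemma sq_pos_nonneg: "sq_pos u x \<ge> 0"
  by (simp add: sq_pos_def)

lemma sq_pos_measurable [measurable]: "u \<in> borel_measurable M \<Longrightarrow> sq_pos u \<in> borel_measurable M"
  unfolding sq_pos_def[abs_def] pos_part_def by measurable

lemma sq_pos_cmult: "c \<ge> 0 \<Longrightarrow> sq_pos (\<lambda>x. c * u x) x = c\<^sup>2 * sq_pos u x"
  by (simp add: sq_pos_def pos_part_def max_def mult_le_0_iff power_mult_distrib)

lemma sq_pos_mono: "u x \<le> v x \<Longrightarrow> sq_pos u x \<le> sq_pos v x"
  unfolding sq_pos_def pos_part_def by (intro power_mono) auto

lemma sq_pos_add_le: "sq_pos (\<lambda>x. u x + f x) x \<le> 2 * (sq_pos u x + (f x)\<^sup>2)"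
proof -
  have "pos_part (u x + f x) \<le> pos_part (u x) + \<bar>f x\<bar>" "0 \<le> pos_part (u x + f x)"
    by (auto simp: pos_part_def)
  then have "(pos_part (u x + f x))\<^sup>2 \<le> (pos_part (u x) + \<bar>f x\<bar>)\<^sup>2"
    by (intro power_mono)
  also have "\<dots> \<le> 2 * ((pos_part (u x))\<^sup>2 + \<bar>f x\<bar>\<^sup>2)"
    using sum_squares_bound[of "pos_part (u x)" "\<bar>f x\<bar>"] by (simp add: power2_sum)
  finally show ?thesis by (simp add: sq_pos_def)
qed

lemma integrable_sq_pos_powr:
  fixes u :: "'a::euclidean_space \<Rightarrow> real"
  assumes N: "DIM('a) \<ge> 5" and u: "u \<in> Lp (crit TYPE('a))"
  shows "integrable lborel (\<lambda>x. sq_pos u x powr (real DIM('a) / (real DIM('a) - 2)))"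
proof (rule Bochner_Integration.integrable_bound[OF Lp_integrable[OF u]])
  have [measurable]: "u \<in> borel_measurable borel" using u by (rule LpD)
  show "(\<lambda>x. sq_pos u x powr (real DIM('a) / (real DIM('a) - 2))) \<in> borel_measurable lborel"
    by measurable
  have "real DIM('a) \<ge> 5" using N by simp
  then have "real DIM('a) / (real DIM('a) - 2) = crit TYPE('a) / 2"
    by (simp add: field_simps)
  moreover have "sq_pos u x powr (crit TYPE('a) / 2) \<le> \<bar>u x\<bar> powr crit TYPE('a)" for x
    unfolding sq_pos_def sq_powr_half using crit_gt_1[OF N]
    by (intro powr_mono2) (auto simp: pos_part_def)
  ultimately have "sq_pos u x powr (real DIM('a) / (real DIM('a) - 2)) \<le> \<bar>u x\<bar> powr crit TYPE('a)" for x
    by (simp only:)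
  then show "AE x in lborel. norm (sq_pos u x powr (real DIM('a) / (real DIM('a) - 2)))
      \<le> norm (\<bar>u x\<bar> powr crit TYPE('a))"
    by (intro AE_I2) simp
qed

text \<open>A divergent Bochner integral is 0 and \<open>enn2real\<close> sends \<open>top\<close>
  to 0, so the outer integrals agree in every case. For the inner ones this convention would break
  the identity; \<open>AE_potential_finite\<close> excludes divergence for almost every y.\<close>

lemma coupling_eq_energy:
  fixes u v :: "'a::euclidean_space \<Rightarrow> real"
  assumes N: "DIM('a) \<ge> 5" and u: "u \<in> Lp (crit TYPE('a))" and v: "v \<in> Lp (crit TYPE('a))"
    and pos: "\<alpha>1 > 0" "\<alpha>2 > 0" "\<beta> > 0"
  shows "coupling \<alpha>1 \<alpha>2 \<beta> u v = enn2real (ennreal \<alpha>1 * energy (sq_pos u) (sq_pos u)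
    + ennreal \<alpha>2 * energy (sq_pos v) (sq_pos v) + ennreal (2 * \<beta>) * energy (sq_pos u) (sq_pos v))"
proof -
  have [measurable]: "u \<in> borel_measurable borel" "v \<in> borel_measurable borel"
    using u v by (auto intro: LpD)
  let ?F = "\<lambda>x y. (\<alpha>1 * sq_pos u x * sq_pos u y + \<alpha>2 * sq_pos v x * sq_pos v y
    + 2 * \<beta> * sq_pos u x * sq_pos v y) / norm (x - y) ^ 4"
  let ?k = "\<lambda>f g x y. f x * g y / norm (x - y) ^ 4"
  define Q where "Q f g y = (\<integral>\<^sup>+x. ennreal (?k f g x y) \<partial>lborel)" for f g :: "'a \<Rightarrow> real" and y
  define P where "P y = ennreal \<alpha>1 * Q (sq_pos u) (sq_pos u) y + ennreal \<alpha>2 * Q (sq_pos v) (sq_pos v) y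
    + ennreal (2 * \<beta>) * Q (sq_pos u) (sq_pos v) y" for y
  have [measurable]: "Q f g \<in> borel_measurable borel"
    if [measurable]: "f \<in> borel_measurable borel" "g \<in> borel_measurable borel" for f g
    unfolding Q_def[abs_def] by measurable
  have [measurable]: "P \<in> borel_measurable borel" unfolding P_def[abs_def] by measurable
  have knn: "?k f g x y \<ge> 0" if "\<And>x. f x \<ge> 0" "\<And>x. g x \<ge> 0" for f g :: "'a \<Rightarrow> real" and x y
    using that by simp
  have F: "ennreal (?F x y) = ennreal \<alpha>1 * ennreal (?k (sq_pos u) (sq_pos u) x y)
      + ennreal \<alpha>2 * ennreal (?k (sq_pos v) (sq_pos v) x y)
      + ennreal (2 * \<beta>) * ennreal (?k (sq_pos u) (sq_pos v) x y)" for x y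
  proof -
    have "?F x y = \<alpha>1 * ?k (sq_pos u) (sq_pos u) x y + \<alpha>2 * ?k (sq_pos v) (sq_pos v) x y
      + (2 * \<beta>) * ?k (sq_pos u) (sq_pos v) x y"
      by (simp add: add_divide_distrib mult.assoc)
    then have "ennreal (?F x y) = ennreal (\<alpha>1 * ?k (sq_pos u) (sq_pos u) x y)
        + ennreal (\<alpha>2 * ?k (sq_pos v) (sq_pos v) x y) + ennreal ((2 * \<beta>) * ?k (sq_pos u) (sq_pos v) x y)"
      using pos by (simp add: sq_pos_nonneg flip: ennreal_plus)
    moreover have "ennreal (a * ?k f g x y) = ennreal a * ennreal (?k f g x y)"
      if "a > 0" "\<And>x. f x \<ge> 0" "\<And>x. g x \<ge> 0" for a and f g :: "'a \<Rightarrow> real"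
      using that by (intro ennreal_mult) auto
    ultimately show ?thesis
      using pos by (simp only: sq_pos_nonneg mult_pos_pos zero_less_numeral)
  qed
  have Fnn: "?F x y \<ge> 0" for x y
    using pos by (auto intro!: divide_nonneg_nonneg add_nonneg_nonneg mult_nonneg_nonneg sq_pos_nonneg)
  have FP: "(\<integral>\<^sup>+x. ennreal (?F x y) \<partial>lborel) = P y" for y
    unfolding F P_def Q_def by (simp add: nn_integral_add nn_integral_cmult)
  have inner: "(LINT x|lborel. ?F x y) = enn2real (P y)" for y
    unfolding FP[symmetric] using Fnn by (intro integral_eq_nn_integral) auto
  have "AE y in lborel. Q (sq_pos u) (sq_pos u) y < \<infinity>" "AE y in lborel. Q (sq_pos v) (sq_pos v) y < \<infinity>"
    "AE y in lborel. Q (sq_pos u) (sq_pos v) y < \<infinity>"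
    unfolding Q_def
    by (intro AE_potential_finite N integrable_sq_pos_powr u v sq_pos_nonneg; measurable)+
  then have "AE y in lborel. ennreal (enn2real (P y)) = P y"
    by eventually_elim (simp add: P_def ennreal_enn2real ennreal_mult_less_top)
  then have "(\<integral>\<^sup>+y. ennreal (enn2real (P y)) \<partial>lborel) = (\<integral>\<^sup>+y. P y \<partial>lborel)"
    by (rule nn_integral_cong_AE)
  also have "\<dots> = ennreal \<alpha>1 * energy (sq_pos u) (sq_pos u)
      + ennreal \<alpha>2 * energy (sq_pos v) (sq_pos v) + ennreal (2 * \<beta>) * energy (sq_pos u) (sq_pos v)"
    unfolding P_def energy_def Q_def[symmetric] by (simp add: nn_integral_add nn_integral_cmult)
  finally have "(\<integral>\<^sup>+y. ennreal (enn2real (P y)) \<partial>lborel) = ennreal \<alpha>1 * energy (sq_pos u) (sq_pos u)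
      + ennreal \<alpha>2 * energy (sq_pos v) (sq_pos v) + ennreal (2 * \<beta>) * energy (sq_pos u) (sq_pos v)" .
  moreover have "coupling \<alpha>1 \<alpha>2 \<beta> u v = enn2real (\<integral>\<^sup>+y. ennreal (enn2real (P y)) \<partial>lborel)"
    unfolding coupling_def inner by (intro integral_eq_nn_integral) auto
  ultimately show ?thesis by simp
qed

lemma energy_cmult:
  assumes [measurable]: "f \<in> borel_measurable borel" "g \<in> borel_measurable borel"
    and "c \<ge> 0" "d \<ge> 0" and nn: "\<And>x. f x \<ge> 0" "\<And>x. g x \<ge> 0"
  shows "energy (\<lambda>x. c * f x) (\<lambda>x. d * g x) = ennreal (c * d) * energy f g"
proof -
  have "ennreal (c * f x * (d * g y) / norm (x - y) ^ 4) =
      ennreal (c * d) * ennreal (f x * g y / norm (x - y) ^ 4)" for x y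
  proof -
    have "c * f x * (d * g y) / norm (x - y) ^ 4 = (c * d) * (f x * g y / norm (x - y) ^ 4)"
      by simp
    then show ?thesis
      using assms by (simp only: ennreal_mult mult_nonneg_nonneg divide_nonneg_nonneg zero_le_power norm_ge_zero)
  qed
  then show ?thesis
    unfolding energy_def by (simp add: nn_integral_cmult)
qed

lemma coupling_commute:
  fixes u v :: "'a::euclidean_space \<Rightarrow> real"
  assumes "DIM('a) \<ge> 5" "u \<in> Lp (crit TYPE('a))" "v \<in> Lp (crit TYPE('a))" "\<alpha>1 > 0" "\<alpha>2 > 0" "\<beta> > 0"
  shows "coupling \<alpha>1 \<alpha>2 \<beta> u v = coupling \<alpha>2 \<alpha>1 \<beta> v u"
  using LpD[OF assms(2)] LpD[OF assms(3)]
  by (simp add: coupling_eq_energy[OF assms] coupling_eq_energy[OF assms(1,3,2,5,4,6)]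
      energy_commute[of "sq_pos u" "sq_pos v"] add_ac)

text \<open>Adding a nonnegative test function does not make the energy infinite, in which case the
  iterated integral would collapse to \<open>0\<close>.\<close>

lemma coupling_add_test_function:
  fixes u v :: "'a::euclidean_space \<Rightarrow> real"
  assumes N: "DIM('a) \<ge> 5" and u: "u \<in> Lp (crit TYPE('a))" and v: "v \<in> Lp (crit TYPE('a))"
    and pos: "\<alpha>1 > 0" "\<alpha>2 > 0" "\<beta> > 0" and C: "coupling \<alpha>1 \<alpha>2 \<beta> u v > 0"
    and \<phi>: "test_function \<phi>" "\<And>x. \<phi> x \<ge> 0" and t: "t \<ge> 0"
  shows "coupling \<alpha>1 \<alpha>2 \<beta> u v \<le> coupling \<alpha>1 \<alpha>2 \<beta> (\<lambda>x. u x + t * \<phi> x) v"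
proof -
  let ?u' = "\<lambda>x. u x + t * \<phi> x"
  define f where "f x = (t * \<phi> x)\<^sup>2" for x
  define g where "g x = sq_pos u x + f x" for x
  have u': "?u' \<in> Lp (crit TYPE('a))"
    using Lp_add_test_function[OF u \<phi>(1)] crit_gt_1[OF N] by simp
  have [measurable]: "u \<in> borel_measurable borel" "v \<in> borel_measurable borel" "\<phi> \<in> borel_measurable borel"
    using u v \<phi> by (auto intro: LpD test_function_measurable)
  have [measurable]: "f \<in> borel_measurable borel" "g \<in> borel_measurable borel"
    unfolding f_def[abs_def] g_def[abs_def] by measurable
  have fnn: "f x \<ge> 0" and gnn: "g x \<ge> 0" for x
    by (auto simp: f_def g_def sq_pos_nonneg)
  let ?S = "\<lambda>u. ennreal \<alpha>1 * energy (sq_pos u) (sq_pos u)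
    + ennreal \<alpha>2 * energy (sq_pos v) (sq_pos v) + ennreal (2 * \<beta>) * energy (sq_pos u) (sq_pos v)"
  \<comment> \<open>\<open>enn2real\<close> of \<open>top\<close> is 0, whereas the coupling is
    positive.\<close>
  have "?S u \<noteq> top"
    using C unfolding coupling_eq_energy[OF N u v pos] by auto
  then have fin: "energy (sq_pos u) (sq_pos u) < top" "energy (sq_pos v) (sq_pos v) < top"
    "energy (sq_pos u) (sq_pos v) < top"
    using pos by (auto simp: ennreal_mult_eq_top_iff less_top)
  obtain B where B: "B \<ge> 0" "\<And>x. \<bar>\<phi> x\<bar> \<le> B" using test_function_bounded[OF \<phi>(1)] by blast
  obtain R where R: "\<And>x. norm x > R \<Longrightarrow> \<phi> x = 0" using test_function_support[OF \<phi>(1)] by blast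
  have fB: "f x \<le> (t * B)\<^sup>2" for x
    using B(2)[of x] \<phi>(2)[of x] t unfolding f_def by (intro power_mono mult_left_mono) auto
  have fR: "f x = 0" if "norm x > R" for x
    using R[OF that] by (simp add: f_def)
  have f_int: "integrable lborel (\<lambda>x. f x powr (real DIM('a) / (real DIM('a) - 2)))"
    using N fB fR fnn
    by (intro integrable_bounded_support[of _ "(t * B)\<^sup>2 powr (real DIM('a) / (real DIM('a) - 2))" R])
      (auto intro!: powr_mono2)
  \<comment> \<open>\<open>f\<close> is bounded with bounded support, so
    \<open>energy_finite\<close> covers its energy against both squared positive parts and against
    itself.\<close>
  have finite_f: "energy w f < top"
    if "w \<in> borel_measurable borel" "\<And>x. w x \<ge> 0"
      "integrable lborel (\<lambda>x. w x powr (real DIM('a) / (real DIM('a) - 2)))" for w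
    using energy_finite[OF N that(1) _ that(2,3) fnn fB fR] by simp
  have fu: "energy (sq_pos u) f < top" and fv: "energy (sq_pos v) f < top" and ff: "energy f f < top"
    using finite_f integrable_sq_pos_powr[OF N u] integrable_sq_pos_powr[OF N v] f_int fnn
    by (auto simp: sq_pos_nonneg)
  have "energy g g = energy (sq_pos u) (sq_pos u) + energy (sq_pos u) f + (energy f (sq_pos u) + energy f f)"
    unfolding g_def[abs_def]
    by (simp add: energy_add_left energy_add_right sq_pos_nonneg fnn)
  then have gg: "energy g g < top"
    using fin(1) fu ff by (simp add: energy_commute[of f "sq_pos u"])
  have "energy g (sq_pos v) = energy (sq_pos u) (sq_pos v) + energy f (sq_pos v)"
    unfolding g_def[abs_def] by (simp add: energy_add_left sq_pos_nonneg fnn)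
  then have gv: "energy g (sq_pos v) < top"
    using fin(3) fv by (simp add: energy_commute[of f "sq_pos v"])
  have le: "sq_pos ?u' x \<le> 2 * g x" for x
    using sq_pos_add_le[of u "\<lambda>x. t * \<phi> x" x] by (simp add: g_def f_def)
  have "energy (sq_pos ?u') (sq_pos ?u') \<le> energy (\<lambda>x. 2 * g x) (\<lambda>x. 2 * g x)"
    by (intro energy_mono le sq_pos_nonneg)
  also have "\<dots> = ennreal (2 * 2) * energy g g"
    by (rule energy_cmult) (auto simp: gnn)
  also have "\<dots> < top"
    using gg by (simp add: ennreal_mult_less_top)
  finally have 1: "energy (sq_pos ?u') (sq_pos ?u') < top" .
  have "energy (sq_pos ?u') (sq_pos v) \<le> energy (\<lambda>x. 2 * g x) (\<lambda>x. 1 * sq_pos v x)"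
    by (intro energy_mono le) (auto simp: sq_pos_nonneg)
  also have "\<dots> = ennreal (2 * 1) * energy g (sq_pos v)"
    by (rule energy_cmult) (auto simp: gnn sq_pos_nonneg)
  also have "\<dots> < top"
    using gv by (simp add: ennreal_mult_less_top)
  finally have 2: "energy (sq_pos ?u') (sq_pos v) < top" .
  have "?S ?u' < top"
    using 1 2 fin(2) by (simp add: ennreal_mult_less_top)
  moreover have "?S u \<le> ?S ?u'"
    using \<phi>(2) t by (intro add_mono mult_left_mono energy_mono sq_pos_mono) (auto simp: sq_pos_nonneg)
  ultimately show ?thesis
    unfolding coupling_eq_energy[OF N u v pos] coupling_eq_energy[OF N u' v pos]
    by (intro enn2real_mono)
qed

lemma coupling_cmult:
  assumes "c \<ge> 0"
  shows "coupling \<alpha>1 \<alpha>2 \<beta> (\<lambda>x. c * u x) (\<lambda>x. c * v x) = c ^ 4 * coupling \<alpha>1 \<alpha>2 \<beta> u v"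
proof -
  have "(\<alpha>1 * sq_pos (\<lambda>x. c * u x) x * sq_pos (\<lambda>x. c * u x) y
      + \<alpha>2 * sq_pos (\<lambda>x. c * v x) x * sq_pos (\<lambda>x. c * v x) y
      + 2 * \<beta> * sq_pos (\<lambda>x. c * u x) x * sq_pos (\<lambda>x. c * v x) y) / norm (x - y) ^ 4 =
    c ^ 4 * ((\<alpha>1 * sq_pos u x * sq_pos u y + \<alpha>2 * sq_pos v x * sq_pos v y
      + 2 * \<beta> * sq_pos u x * sq_pos v y) / norm (x - y) ^ 4)" for x y
    unfolding sq_pos_cmult[OF assms] times_divide_eq_right
    by (intro arg_cong2[of _ _ _ _ "(/)"] refl) (simp add: algebra_simps power4_eq_xxxx power2_eq_square)
  then show ?thesis
    unfolding coupling_def by (simp only: integral_mult_right_zero)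
qed

lemma coupling_proportional:
  assumes "a \<ge> 0" "b \<ge> 0"
  shows "coupling \<alpha>1 \<alpha>2 \<beta> (\<lambda>x. a * v x) (\<lambda>x. b * v x) =
    (\<alpha>1 * a ^ 4 + \<alpha>2 * b ^ 4 + 2 * \<beta> * a\<^sup>2 * b\<^sup>2) * self_energy v"
proof -
  have "(\<alpha>1 * sq_pos (\<lambda>x. a * v x) x * sq_pos (\<lambda>x. a * v x) y
      + \<alpha>2 * sq_pos (\<lambda>x. b * v x) x * sq_pos (\<lambda>x. b * v x) y
      + 2 * \<beta> * sq_pos (\<lambda>x. a * v x) x * sq_pos (\<lambda>x. b * v x) y) / norm (x - y) ^ 4 =
    (\<alpha>1 * a ^ 4 + \<alpha>2 * b ^ 4 + 2 * \<beta> * a\<^sup>2 * b\<^sup>2) * (sq_pos v x * sq_pos v y / norm (x - y) ^ 4)" for x y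
    unfolding sq_pos_cmult[OF assms(1)] sq_pos_cmult[OF assms(2)] times_divide_eq_right
    by (intro arg_cong2[of _ _ _ _ "(/)"] refl) (simp add: algebra_simps power4_eq_xxxx power2_eq_square)
  then show ?thesis
    unfolding coupling_def self_energy_def by (simp only: integral_mult_right_zero)
qed

lemma coupling_semitrivial:
  assumes [measurable]: "u \<in> borel_measurable borel" "v \<in> borel_measurable borel"
    and 0: "AE x in lborel. u x = 0"
  shows "coupling \<alpha>1 \<alpha>2 \<beta> u v = \<alpha>2 * self_energy v"
proof -
  have inner: "(LINT x|lborel. (\<alpha>1 * sq_pos u x * sq_pos u y + \<alpha>2 * sq_pos v x * sq_pos v y
      + 2 * \<beta> * sq_pos u x * sq_pos v y) / norm (x - y) ^ 4) =
    \<alpha>2 * (LINT x|lborel. sq_pos v x * sq_pos v y / norm (x - y) ^ 4)" for y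
  proof -
    \<comment> \<open>Every term involving u carries the factor \<open>sq_pos u x\<close>, so a null
      set in x suffices for each fixed y.\<close>
    have "AE x in lborel. (\<alpha>1 * sq_pos u x * sq_pos u y + \<alpha>2 * sq_pos v x * sq_pos v y
      + 2 * \<beta> * sq_pos u x * sq_pos v y) / norm (x - y) ^ 4 =
      \<alpha>2 * (sq_pos v x * sq_pos v y / norm (x - y) ^ 4)"
      using 0 by eventually_elim (simp add: sq_pos_def pos_part_def)
    then have "(LINT x|lborel. (\<alpha>1 * sq_pos u x * sq_pos u y + \<alpha>2 * sq_pos v x * sq_pos v y
      + 2 * \<beta> * sq_pos u x * sq_pos v y) / norm (x - y) ^ 4) =
      (LINT x|lborel. \<alpha>2 * (sq_pos v x * sq_pos v y / norm (x - y) ^ 4))"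
      by (intro integral_cong_AE) auto
    then show ?thesis by (simp only: integral_mult_right_zero)
  qed
  show ?thesis
    unfolding coupling_def self_energy_def inner by (simp only: integral_mult_right_zero)
qed

lemma coupling_eq_0:
  fixes u v :: "'a::euclidean_space \<Rightarrow> real"
  assumes [measurable]: "u \<in> borel_measurable borel" "v \<in> borel_measurable borel"
    and "AE x in lborel. u x = 0" "AE x in lborel. v x = 0"
  shows "coupling \<alpha>1 \<alpha>2 \<beta> u v = 0"
proof -
  have "AE x in lborel. sq_pos v x * sq_pos v y / norm (x - y) ^ 4 = 0" for y
    using assms(4) by eventually_elim (simp add: sq_pos_def pos_part_def)
  then have "(LINT x|lborel. sq_pos v x * sq_pos v y / norm (x - y) ^ 4) = 0" for y
    by (rule integral_eq_zero_AE)
  then show ?thesis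
    using coupling_semitrivial[OF assms(1-3)] by (simp add: self_energy_def)
qed

lemma coupling_translate:
  fixes u v :: "'a::euclidean_space \<Rightarrow> real"
  assumes [measurable]: "u \<in> borel_measurable borel" "v \<in> borel_measurable borel"
  shows "coupling \<alpha>1 \<alpha>2 \<beta> (\<lambda>x. u (z + x)) (\<lambda>x. v (z + x)) = coupling \<alpha>1 \<alpha>2 \<beta> u v"
proof -
  let ?F = "\<lambda>x y. (\<alpha>1 * sq_pos u x * sq_pos u y + \<alpha>2 * sq_pos v x * sq_pos v y
    + 2 * \<beta> * sq_pos u x * sq_pos v y) / norm (x - y) ^ 4"
  have "coupling \<alpha>1 \<alpha>2 \<beta> (\<lambda>x. u (z + x)) (\<lambda>x. v (z + x)) =
      (LINT y|lborel. LINT x|lborel. ?F (z + x) (z + y))"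
    by (simp add: coupling_def sq_pos_def)
  also have "\<dots> = (LINT y|lborel. LINT x|lborel. ?F x (z + y))"
    by (intro Bochner_Integration.integral_cong refl integral_translate(1)) measurable
  also have "\<dots> = (LINT y|lborel. LINT x|lborel. ?F x y)"
    by (rule integral_translate(1)[where f="\<lambda>y. LINT x|lborel. ?F x y"]) measurable
  finally show ?thesis by (simp add: coupling_def)
qed

lemma zero_Lp: "(\<lambda>x. 0) \<in> Lp q"
  by (simp add: Lp_def)

section \<open>The Nehari manifold and radial projection\<close>

locale hartree_system =
  fixes \<alpha>1 \<alpha>2 \<beta> :: real and V1 V2 :: "'a::euclidean_space \<Rightarrow> real"
  assumes N: "DIM('a) \<ge> 5"
    and pos: "\<alpha>1 > 0" "\<alpha>2 > 0" and \<beta>: "\<beta> > \<alpha>1" "\<beta> > \<alpha>2"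
    and V: "V1 \<in> Lp (real DIM('a) / 2)" "V2 \<in> Lp (real DIM('a) / 2)"
    and V_nonneg: "AE x in lborel. V1 x \<ge> 0" "AE x in lborel. V2 x \<ge> 0"
begin

abbreviation "K \<equiv> kinetic V1 V2"
abbreviation "C \<equiv> coupling \<alpha>1 \<alpha>2 \<beta>"
abbreviation "\<N> \<equiv> Nehari \<alpha>1 \<alpha>2 \<beta> V1 V2"

lemma \<beta>_pos: "\<beta> > 0"
  using pos \<beta> by simp

lemma J_eq:
  assumes u: "u \<in> D12" and v: "v \<in> D12"
  shows "J \<alpha>1 \<alpha>2 \<beta> V1 V2 u v = K u v / 2 - C u v / 4"
proof -
  have ints: "integrable lborel (\<lambda>x. (norm (weak_grad u x))\<^sup>2)" "integrable lborel (\<lambda>x. (norm (weak_grad v x))\<^sup>2)"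
    "integrable lborel (\<lambda>x. V1 x * (u x)\<^sup>2)" "integrable lborel (\<lambda>x. V2 x * (v x)\<^sup>2)"
    using u v by (auto intro: D12_integrable integrable_potential[OF N] V D12_Lp)
  have "(LINT x|lborel. (norm (weak_grad u x))\<^sup>2 + (norm (weak_grad v x))\<^sup>2
      + V1 x * (u x)\<^sup>2 + V2 x * (v x)\<^sup>2) = K u v"
    by (simp add: kinetic_def dirichlet_def potential_def ints)
  then show ?thesis
    unfolding J_def coupling_def sq_pos_def by simp
qed

lemma kinetic_cmult:
  assumes "u \<in> D12" "v \<in> D12"
  shows "K (\<lambda>x. c * u x) (\<lambda>x. c * v x) = c\<^sup>2 * K u v"
  using assms by (simp add: kinetic_def dirichlet_cmult potential_cmult distrib_left)

lemma J_cmult: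
  assumes "u \<in> D12" "v \<in> D12" "c \<ge> 0"
  shows "J \<alpha>1 \<alpha>2 \<beta> V1 V2 (\<lambda>x. c * u x) (\<lambda>x. c * v x) = c\<^sup>2 * K u v / 2 - c ^ 4 * C u v / 4"
  using assms by (simp add: J_eq D12_cmult kinetic_cmult coupling_cmult)

text \<open>Along the ray through (u, v), J is the polynomial (1 + t)^2 K/2 - (1 + t)^4 C/4 as long
  as t > -1; positive parts are homogeneous under nonnegative factors only.\<close>

lemma J_deriv_radial:
  assumes u: "u \<in> D12" and v: "v \<in> D12"
  shows "J_deriv \<alpha>1 \<alpha>2 \<beta> V1 V2 u v u v d \<longleftrightarrow> d = K u v - C u v"
proof -
  have "((\<lambda>t. (1 + t)\<^sup>2 * K u v / 2 - (1 + t) ^ 4 * C u v / 4) has_real_derivative K u v - C u v) (at 0)"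
    by (auto intro!: derivative_eq_intros)
  then have "((\<lambda>t. J \<alpha>1 \<alpha>2 \<beta> V1 V2 (\<lambda>x. u x + t * u x) (\<lambda>x. v x + t * v x))
      has_real_derivative K u v - C u v) (at 0)"
  proof (rule has_field_derivative_transform_within_open[where S="{-1<..}"])
    fix t :: real assume t: "t \<in> {-1<..}"
    have "(\<lambda>x. f x + t * f x) = (\<lambda>x. (1 + t) * f x)" for f :: "'a \<Rightarrow> real"
      by (simp add: distrib_right)
    then show "(1 + t)\<^sup>2 * K u v / 2 - (1 + t) ^ 4 * C u v / 4 =
        J \<alpha>1 \<alpha>2 \<beta> V1 V2 (\<lambda>x. u x + t * u x) (\<lambda>x. v x + t * v x)"
      using J_cmult[OF u v, of "1 + t"] t by simp
  qed auto
  then show ?thesis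
    unfolding J_deriv_def using DERIV_unique by blast
qed

lemma Nehari_iff:
  "(u, v) \<in> \<N> \<longleftrightarrow> u \<in> D12 \<and> v \<in> D12 \<and>
    \<not> ((AE x in lborel. u x = 0) \<and> (AE x in lborel. v x = 0)) \<and> K u v = C u v"
  using J_deriv_radial[of u v 0] by (auto simp: Nehari_def)

lemma dirichlet_le_kinetic: "dirichlet u + dirichlet v \<le> K u v"
  using potential_nonneg[OF V_nonneg(1), of u] potential_nonneg[OF V_nonneg(2), of v]
  by (simp add: kinetic_def)

lemma dirichlet_pos:
  fixes u v :: "'a \<Rightarrow> real"
  assumes "u \<in> D12" "v \<in> D12" "\<not> ((AE x in lborel. u x = 0) \<and> (AE x in lborel. v x = 0))"
  shows "dirichlet u + dirichlet v > 0"
proof (rule ccontr)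
  assume "\<not> dirichlet u + dirichlet v > 0"
  then have "dirichlet u = 0" "dirichlet v = 0"
    using dirichlet_nonneg[of u] dirichlet_nonneg[of v] by linarith+
  with assms show False
    using dirichlet_eq_0D[OF N] by blast
qed

lemma kinetic_nonneg: "K u v \<ge> 0"
  using dirichlet_le_kinetic[of u v] dirichlet_nonneg[of u] dirichlet_nonneg[of v] by linarith

lemma nontrivial_of_coupling_pos:
  assumes "u \<in> D12" "v \<in> D12" "C u v > 0"
  shows "\<not> ((AE x in lborel. u x = 0) \<and> (AE x in lborel. v x = 0))"
  using assms coupling_eq_0[of u v \<alpha>1 \<alpha>2 \<beta>] D12_measurable by auto

lemma Nehari_J:
  assumes "(u, v) \<in> \<N>"
  shows "J \<alpha>1 \<alpha>2 \<beta> V1 V2 u v = K u v / 4" "C u v > 0"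
proof -
  have *: "u \<in> D12" "v \<in> D12" "K u v = C u v" using assms by (auto simp: Nehari_iff)
  then show "J \<alpha>1 \<alpha>2 \<beta> V1 V2 u v = K u v / 4" by (simp add: J_eq)
  have "dirichlet u + dirichlet v > 0" using assms by (intro dirichlet_pos) (auto simp: Nehari_iff)
  then show "C u v > 0" using dirichlet_le_kinetic[of u v] * by linarith
qed

lemma bdd_below_J: "bdd_below ((\<lambda>(u, v). J \<alpha>1 \<alpha>2 \<beta> V1 V2 u v) ` \<N>)"
  by (rule bdd_belowI2[where m=0]) (auto simp: Nehari_J(1) kinetic_nonneg)

text \<open>The factor solves s^2 K = s^4 C; the common value is K^2/C, and J is a quarter of
  it.\<close>

lemma Nehari_projection:
  assumes u: "u \<in> D12" and v: "v \<in> D12" and C: "C u v > 0"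
  defines "s \<equiv> sqrt (K u v / C u v)"
  shows "((\<lambda>x. s * u x), (\<lambda>x. s * v x)) \<in> \<N>"
    and "J \<alpha>1 \<alpha>2 \<beta> V1 V2 (\<lambda>x. s * u x) (\<lambda>x. s * v x) = (K u v)\<^sup>2 / (4 * C u v)"
proof -
  have K: "K u v > 0"
    using dirichlet_pos[OF u v nontrivial_of_coupling_pos[OF u v C]] dirichlet_le_kinetic[of u v] by linarith
  then have s: "s > 0" "s\<^sup>2 = K u v / C u v" using C by (auto simp: s_def)
  have s4: "s ^ 4 = (K u v / C u v)\<^sup>2"
    using s(2) by (metis mult_2_right numeral_Bit0 power_add power2_eq_square)
  have "C (\<lambda>x. s * u x) (\<lambda>x. s * v x) = s ^ 4 * C u v" using s by (intro coupling_cmult) simp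
  also have "\<dots> = s\<^sup>2 * K u v" unfolding s4 s(2) using C by (simp add: power2_eq_square)
  also have "\<dots> = K (\<lambda>x. s * u x) (\<lambda>x. s * v x)" using u v by (simp add: kinetic_cmult)
  finally have eq: "C (\<lambda>x. s * u x) (\<lambda>x. s * v x) = K (\<lambda>x. s * u x) (\<lambda>x. s * v x)" .
  have "(AE x in lborel. s * f x = 0) \<longleftrightarrow> (AE x in lborel. f x = 0)" for f :: "'a \<Rightarrow> real"
    using s(1) by simp
  then show N: "((\<lambda>x. s * u x), (\<lambda>x. s * v x)) \<in> \<N>"
    using u v eq nontrivial_of_coupling_pos[OF u v C] by (simp add: Nehari_iff D12_cmult)
  show "J \<alpha>1 \<alpha>2 \<beta> V1 V2 (\<lambda>x. s * u x) (\<lambda>x. s * v x) = (K u v)\<^sup>2 / (4 * C u v)"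
    unfolding Nehari_J(1)[OF N] kinetic_cmult[OF u v] s(2) by (simp add: power2_eq_square)
qed

lemma c_level_le:
  assumes "u \<in> D12" "v \<in> D12" "C u v > 0"
  shows "c_level \<alpha>1 \<alpha>2 \<beta> V1 V2 \<le> (K u v)\<^sup>2 / (4 * C u v)"
  using cINF_lower[OF bdd_below_J Nehari_projection(1)[OF assms]] Nehari_projection(2)[OF assms]
  by (simp add: c_level_def)

end

subsection \<open>Minimizers are positive\<close>

text \<open>The hypothesis \<open>min\<close> says that (u, v) minimizes the squared Dirichlet sum
  divided by the coupling, with denominators cleared. This form is invariant under exchanging the
  two components together with \<open>\<alpha>1\<close> and \<open>\<alpha>2\<close>, so the lemma
  serves for v as well.\<close>

lemma minimizer_pos:
  fixes u v :: "'a::euclidean_space \<Rightarrow> real"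
  assumes N: "DIM('a) \<ge> 5" and \<alpha>: "\<alpha>1 > 0" "\<alpha>2 > 0" and \<beta>: "\<beta> > \<alpha>1" "\<beta> > \<alpha>2"
    and u: "u \<in> D12" and v: "v \<in> D12" and C: "coupling \<alpha>1 \<alpha>2 \<beta> u v > 0"
    and D: "dirichlet u + dirichlet v > 0"
    and min: "\<And>\<phi> \<psi> :: 'a \<Rightarrow> real. \<phi> \<in> D12 \<Longrightarrow> \<psi> \<in> D12 \<Longrightarrow> coupling \<alpha>1 \<alpha>2 \<beta> \<phi> \<psi> > 0 \<Longrightarrow>
      (dirichlet u + dirichlet v)\<^sup>2 * coupling \<alpha>1 \<alpha>2 \<beta> \<phi> \<psi>
        \<le> (dirichlet \<phi> + dirichlet \<psi>)\<^sup>2 * coupling \<alpha>1 \<alpha>2 \<beta> u v"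
  shows "AE x in lborel. u x > 0"
proof -
  have \<beta>0: "\<beta> > 0" using \<alpha> \<beta> by simp
  have "superharmonic u"
  proof (rule superharmonic_I[OF u])
    fix \<phi> :: "'a \<Rightarrow> real" assume \<phi>: "test_function \<phi>" "\<And>x. \<phi> x \<ge> 0"
    define I where "I = (LINT x|lborel. weak_grad u x \<bullet> grad \<phi> x)"
    define G where "G = (LINT x|lborel. (norm (grad \<phi> x))\<^sup>2)"
    \<comment> \<open>The perturbed pair has no smaller coupling, so by minimality its Dirichlet sum
      is no smaller either. The increment is t (2 I + t G); dividing by t and letting t tend to 0
      isolates I.\<close>
    have "0 \<le> 2 * I + t * G" if t: "t > 0" for t
    proof -
      let ?u = "\<lambda>x. u x + t * \<phi> x"
      have u': "?u \<in> D12" and du: "dirichlet ?u = dirichlet u + 2 * t * I + t\<^sup>2 * G"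
        unfolding I_def G_def by (rule D12_add_test_function[OF N u \<phi>(1)])+
      have le: "coupling \<alpha>1 \<alpha>2 \<beta> u v \<le> coupling \<alpha>1 \<alpha>2 \<beta> ?u v"
        using t by (intro coupling_add_test_function[OF N D12_Lp[OF u] D12_Lp[OF v] \<alpha> \<beta>0 C \<phi>]) simp
      then have "(dirichlet u + dirichlet v)\<^sup>2 * coupling \<alpha>1 \<alpha>2 \<beta> u v
          \<le> (dirichlet u + dirichlet v)\<^sup>2 * coupling \<alpha>1 \<alpha>2 \<beta> ?u v"
        by (rule mult_left_mono) simp
      also have "\<dots> \<le> (dirichlet ?u + dirichlet v)\<^sup>2 * coupling \<alpha>1 \<alpha>2 \<beta> u v"
        by (rule min[OF u' v]) (use C le in linarith)
      finally have "(dirichlet u + dirichlet v)\<^sup>2 \<le> (dirichlet ?u + dirichlet v)\<^sup>2"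
        using C by simp
      then have "dirichlet u + dirichlet v \<le> dirichlet ?u + dirichlet v"
        by (rule power2_le_imp_le) (simp add: dirichlet_nonneg)
      then have "0 \<le> t * (2 * I + t * G)"
        unfolding du by (simp add: power2_eq_square algebra_simps)
      then show ?thesis using t by (simp add: zero_le_mult_iff)
    qed
    then have "eventually (\<lambda>t. 0 \<le> 2 * I + t * G) (at_right 0)"
      by (auto simp: eventually_at_right_field intro!: exI[of _ 1])
    moreover have "((\<lambda>t. 2 * I + t * G) \<longlongrightarrow> 2 * I + 0 * G) (at_right 0)"
      by (intro tendsto_intros)
    ultimately have "0 \<le> 2 * I + 0 * G"
      by (intro tendsto_lowerbound[of _ _ "at_right 0"]) auto
    then show "0 \<le> (LINT x|lborel. weak_grad u x \<bullet> grad \<phi> x)" by (simp add: I_def)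
  qed
  then have "(AE x in lborel. u x = 0) \<or> (AE x in lborel. u x > 0)"
    by (rule superharmonic.strong_maximum_principle[OF _ crit_gt_1[OF N] Lp_integrable[OF D12_Lp[OF u]]])
  moreover have "\<not> (AE x in lborel. u x = 0)"
  proof
    assume 0: "AE x in lborel. u x = 0"
    have Cv: "coupling \<alpha>1 \<alpha>2 \<beta> u v = \<alpha>2 * self_energy v"
      using 0 u v by (intro coupling_semitrivial D12_measurable)
    then have E: "self_energy v > 0" using C \<alpha> by (simp add: zero_less_mult_iff)
    \<comment> \<open>With \<open>\<sigma>\<close> = a^2, \<open>\<theta>\<close> is a concave
      quadratic in \<open>\<sigma>\<close> that equals \<open>\<alpha>2\<close> at 0. This
      \<open>\<sigma>\<close> is its vertex, where \<open>\<theta>\<close> takes the value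
      \<open>\<alpha>2 + \<sigma> * (\<beta> - \<alpha>2)\<close>.\<close>
    define \<sigma> where "\<sigma> = (\<beta> - \<alpha>2) / ((\<beta> - \<alpha>1) + (\<beta> - \<alpha>2))"
    have \<sigma>: "0 < \<sigma>" "\<sigma> < 1" using \<beta> by (auto simp: \<sigma>_def)
    define a where "a = sqrt \<sigma>"
    define b where "b = sqrt (1 - \<sigma>)"
    have ab: "a \<ge> 0" "b \<ge> 0" "a\<^sup>2 = \<sigma>" "b\<^sup>2 = 1 - \<sigma>" using \<sigma> by (auto simp: a_def b_def)
    define \<theta> where "\<theta> = \<alpha>1 * a ^ 4 + \<alpha>2 * b ^ 4 + 2 * \<beta> * a\<^sup>2 * b\<^sup>2"
    have "a ^ 4 = (a\<^sup>2)\<^sup>2" "b ^ 4 = (b\<^sup>2)\<^sup>2"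
      by (simp_all flip: power_mult)
    then have ab4: "a ^ 4 = \<sigma>\<^sup>2" "b ^ 4 = (1 - \<sigma>)\<^sup>2"
      by (simp_all only: ab)
    have "\<theta> = \<alpha>2 + \<sigma> * (2 * (\<beta> - \<alpha>2) - \<sigma> * ((\<beta> - \<alpha>1) + (\<beta> - \<alpha>2)))"
      unfolding \<theta>_def ab4 ab(3,4) by (simp add: algebra_simps power2_eq_square)
    also have "\<sigma> * ((\<beta> - \<alpha>1) + (\<beta> - \<alpha>2)) = \<beta> - \<alpha>2"
      using \<beta> by (simp add: \<sigma>_def)
    finally have \<theta>: "\<theta> > \<alpha>2" using \<sigma> \<beta> by simp
    have Cab: "coupling \<alpha>1 \<alpha>2 \<beta> (\<lambda>x. a * v x) (\<lambda>x. b * v x) = \<theta> * self_energy v"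
      unfolding \<theta>_def using ab by (intro coupling_proportional)
    \<comment> \<open>Because a^2 + b^2 = 1 the Dirichlet sum stays that of v, while the factor in
      front of \<open>self_energy v\<close> rises from \<open>\<alpha>2\<close> to
      \<open>\<theta>\<close>.\<close>
    have Dab: "dirichlet (\<lambda>x. a * v x) + dirichlet (\<lambda>x. b * v x) = dirichlet v"
      unfolding dirichlet_cmult[OF v] ab(3,4) by (simp add: algebra_simps)
    have "(dirichlet u + dirichlet v)\<^sup>2 * (\<theta> * self_energy v) \<le> (dirichlet v)\<^sup>2 * (\<alpha>2 * self_energy v)"
      using min[of "\<lambda>x. a * v x" "\<lambda>x. b * v x"] \<theta> \<alpha> E v by (simp add: D12_cmult Cab Dab Cv)
    also have "\<dots> \<le> (dirichlet u + dirichlet v)\<^sup>2 * (\<alpha>2 * self_energy v)"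
      using dirichlet_nonneg[of u] dirichlet_nonneg[of v] \<alpha> E
      by (intro mult_right_mono power_mono) auto
    finally have "\<theta> \<le> \<alpha>2" using D E by simp
    with \<theta> show False by simp
  qed
  ultimately show ?thesis by blast
qed

subsection \<open>Comparison with the problem at infinity\<close>

context hartree_system
begin

interpretation Z: hartree_system \<alpha>1 \<alpha>2 \<beta> "\<lambda>x::'a. 0" "\<lambda>x. 0"
  by unfold_locales (use N pos \<beta> in \<open>auto simp: zero_Lp\<close>)

abbreviation c :: real where "c \<equiv> c_level \<alpha>1 \<alpha>2 \<beta> V1 V2"

lemma kinetic_zero: "Z.K u v = dirichlet u + dirichlet v"
  by (simp add: kinetic_def potential_def)

text \<open>C does not involve the potentials, and by projection either set is nonempty as soon as
  some pair in \<open>D12\<close> has C > 0. This settles the case in which the infima are taken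
  over the empty set.\<close>

lemma Nehari_empty_iff: "\<N> = {} \<longleftrightarrow> Z.\<N> = {}"
proof -
  have "Z.\<N> \<noteq> {}" if "(u, v) \<in> \<N>" for u v
    using Z.Nehari_projection(1)[of u v] that Nehari_J(2)[OF that] by (auto simp: Nehari_iff)
  moreover have "\<N> \<noteq> {}" if "(u, v) \<in> Z.\<N>" for u v
    using Nehari_projection(1)[of u v] that Z.Nehari_J(2)[OF that] by (auto simp: Z.Nehari_iff)
  ultimately show ?thesis by auto
qed

text \<open>The numerator keeps the Dirichlet integrals alone. This is sharper than a comparison
  with J and carries the equality case.\<close>

lemma c_inf_le_J:
  assumes "(u, v) \<in> \<N>"
  shows "c_level \<alpha>1 \<alpha>2 \<beta> (\<lambda>x::'a. 0) (\<lambda>x. 0) \<le> (dirichlet u + dirichlet v)\<^sup>2 / (4 * C u v)"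
  using Z.c_level_le[of u v] assms Nehari_J(2)[OF assms] by (simp add: Nehari_iff kinetic_zero)

lemma c_inf_le: "\<N> \<noteq> {} \<Longrightarrow> c_level \<alpha>1 \<alpha>2 \<beta> (\<lambda>x::'a. 0) (\<lambda>x. 0) \<le> c"
  unfolding c_level_def[of \<alpha>1 \<alpha>2 \<beta> V1 V2]
proof (rule cINF_greatest)
  fix p assume "p \<in> \<N>"
  then obtain u v where p: "p = (u, v)" and uv: "(u, v) \<in> \<N>" by (cases p) auto
  have KC: "K u v = C u v" "C u v > 0" using uv Nehari_J(2) by (auto simp: Nehari_iff)
  have "c_level \<alpha>1 \<alpha>2 \<beta> (\<lambda>x::'a. 0) (\<lambda>x. 0) \<le> (dirichlet u + dirichlet v)\<^sup>2 / (4 * C u v)" using uv by (rule c_inf_le_J)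
  also have "\<dots> \<le> (K u v)\<^sup>2 / (4 * C u v)"
    using KC dirichlet_le_kinetic[of u v] dirichlet_nonneg[of u] dirichlet_nonneg[of v]
    by (intro divide_right_mono power_mono) auto
  also have "\<dots> = J \<alpha>1 \<alpha>2 \<beta> V1 V2 u v"
    using KC by (simp add: Nehari_J(1)[OF uv] power2_eq_square)
  finally show "c_level \<alpha>1 \<alpha>2 \<beta> (\<lambda>x::'a. 0) (\<lambda>x. 0) \<le> (case p of (u, v) \<Rightarrow> J \<alpha>1 \<alpha>2 \<beta> V1 V2 u v)" by (simp add: p)
qed

lemma c_le_inf:
  assumes "Z.\<N> \<noteq> {}"
  shows "c \<le> c_level \<alpha>1 \<alpha>2 \<beta> (\<lambda>x::'a. 0) (\<lambda>x. 0)"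
  unfolding c_level_def[of \<alpha>1 \<alpha>2 \<beta> "\<lambda>x. 0" "\<lambda>x. 0"]
proof (rule cINF_greatest[OF assms])
  fix p assume "p \<in> Z.\<N>"
  then obtain u v where p: "p = (u, v)" and uv: "(u, v) \<in> Z.\<N>" by (cases p) auto
  have uD: "u \<in> D12" and vD: "v \<in> D12" and C: "C u v > 0" and KC: "dirichlet u + dirichlet v = C u v"
    using uv Z.Nehari_J(2)[OF uv] by (auto simp: Z.Nehari_iff kinetic_zero)
  obtain b :: 'a where b: "b \<in> Basis" using nonempty_Basis by blast
  let ?u = "\<lambda>n x. u (real n *\<^sub>R b + x)" and ?v = "\<lambda>n x. v (real n *\<^sub>R b + x)"
  \<comment> \<open>Translation preserves C and the Dirichlet integrals, so along the sequence only
    the potential terms change.\<close>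
  have Cn: "C (?u n) (?v n) = C u v" for n
    using uD vD by (intro coupling_translate D12_measurable)
  have "c \<le> (K (?u n) (?v n))\<^sup>2 / (4 * C u v)" for n
    using c_level_le[of "?u n" "?v n"] uD vD C by (simp add: Cn D12_translate)
  moreover have "(\<lambda>n. (K (?u n) (?v n))\<^sup>2 / (4 * C u v)) \<longlonglongrightarrow>
      (dirichlet u + dirichlet v + 0 + 0)\<^sup>2 / (4 * C u v)"
    unfolding kinetic_def dirichlet_translate[OF uD] dirichlet_translate[OF vD]
    using C uD vD b by (intro tendsto_intros potential_translate_tendsto_0 N V D12_Lp) auto
  ultimately have "c \<le> (dirichlet u + dirichlet v + 0 + 0)\<^sup>2 / (4 * C u v)"
    by (intro LIMSEQ_le_const) auto
  also have "\<dots> = J \<alpha>1 \<alpha>2 \<beta> (\<lambda>x. 0) (\<lambda>x. 0) u v"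
    using C by (simp add: Z.Nehari_J(1)[OF uv] kinetic_zero KC power2_eq_square)
  finally show "c \<le> (case p of (u, v) \<Rightarrow> J \<alpha>1 \<alpha>2 \<beta> (\<lambda>x. 0) (\<lambda>x. 0) u v)" by (simp add: p)
qed

lemma c_eq_c_inf: "c = c_level \<alpha>1 \<alpha>2 \<beta> (\<lambda>x::'a. 0) (\<lambda>x. 0)"
proof (cases "\<N> = {}")
  case True
  \<comment> \<open>Both levels are then the infimum of the empty set.\<close>
  then show ?thesis using Nehari_empty_iff by (simp add: c_level_def)
next
  case False
  then show ?thesis using Nehari_empty_iff c_inf_le c_le_inf by (simp add: antisym)
qed

lemma AE_potential_eq_0:
  fixes W u :: "'a \<Rightarrow> real"
  assumes "W \<in> Lp (real DIM('a) / 2)" "AE x in lborel. W x \<ge> 0" "u \<in> D12"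
    and "potential W u = 0" "AE x in lborel. u x > 0"
  shows "AE x in lborel. W x = 0"
proof -
  have "AE x in lborel. 0 \<le> W x * (u x)\<^sup>2" using assms(2) by eventually_elim simp
  then have "AE x in lborel. W x * (u x)\<^sup>2 = 0"
    using integral_nonneg_eq_0_iff_AE[OF integrable_potential[OF N assms(1) D12_Lp[OF assms(3)]]] assms(4)
    by (simp add: potential_def)
  with assms(5) show ?thesis by eventually_elim simp
qed

lemma potentials_vanish_if_achieved:
  assumes "c_achieved \<alpha>1 \<alpha>2 \<beta> V1 V2"
  shows "(AE x in lborel. V1 x = 0) \<and> (AE x in lborel. V2 x = 0)"
proof -
  obtain u v where uv: "(u, v) \<in> \<N>" and Jc: "J \<alpha>1 \<alpha>2 \<beta> V1 V2 u v = c"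
    using assms by (auto simp: c_achieved_def)
  have uD: "u \<in> D12" and vD: "v \<in> D12" and KC: "K u v = C u v" and C: "C u v > 0"
    and nontriv: "\<not> ((AE x in lborel. u x = 0) \<and> (AE x in lborel. v x = 0))"
    using uv Nehari_J(2)[OF uv] by (auto simp: Nehari_iff)
  define D where "D = dirichlet u + dirichlet v"
  have D0: "D > 0" unfolding D_def using uD vD nontriv by (rule dirichlet_pos)
  have c4: "c_level \<alpha>1 \<alpha>2 \<beta> (\<lambda>x::'a. 0) (\<lambda>x. 0) = C u v / 4" using Jc Nehari_J(1)[OF uv] KC c_eq_c_inf by simp
  \<comment> \<open>The level at infinity is C/4, so its bound by the Dirichlet quotient forces C <=
    D. Together with D <= K = C this leaves nothing for the two potential terms.\<close>
  have "C u v / 4 \<le> D\<^sup>2 / (4 * C u v)" using c_inf_le_J[OF uv] by (simp add: c4 D_def)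
  then have "(C u v)\<^sup>2 \<le> D\<^sup>2" using C by (simp add: field_simps power2_eq_square)
  then have "C u v \<le> D" by (rule power2_le_imp_le) (use D0 in simp)
  moreover have "D \<le> C u v" using dirichlet_le_kinetic[of u v] by (simp add: D_def KC)
  ultimately have DC: "D = C u v" by simp
  have pot: "potential V1 u = 0" "potential V2 v = 0"
    using KC DC potential_nonneg[OF V_nonneg(1), of u] potential_nonneg[OF V_nonneg(2), of v]
    by (auto simp: kinetic_def D_def)
  have min: "D\<^sup>2 * C \<phi> \<psi> \<le> (dirichlet \<phi> + dirichlet \<psi>)\<^sup>2 * C u v"
    if "\<phi> \<in> D12" "\<psi> \<in> D12" "C \<phi> \<psi> > 0" for \<phi> \<psi> :: "'a \<Rightarrow> real"
  proof -
    \<comment> \<open>The level is D/4 by \<open>c4\<close> and \<open>DC\<close>; clearing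
      denominators and multiplying by D = \<open>C u v\<close> gives the homogeneous form that
      \<open>minimizer_pos\<close> expects.\<close>
    have "D / 4 \<le> (dirichlet \<phi> + dirichlet \<psi>)\<^sup>2 / (4 * C \<phi> \<psi>)"
      using Z.c_level_le[OF that] by (simp add: c4 DC kinetic_zero)
    then have "D * C \<phi> \<psi> \<le> (dirichlet \<phi> + dirichlet \<psi>)\<^sup>2"
      using that(3) by (simp add: field_simps)
    from mult_left_mono[OF this, of D] show ?thesis
      using D0 by (simp add: DC power2_eq_square mult_ac)
  qed
  have "AE x in lborel. u x > 0"
    using min D0 by (intro minimizer_pos[OF N pos \<beta> uD vD C]) (auto simp: D_def)
  \<comment> \<open>The two components change roles together with their coefficients;
    \<open>coupling_commute\<close> carries the minimality over.\<close>
  moreover have "AE x in lborel. v x > 0"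
  proof (rule minimizer_pos[OF N pos(2,1) \<beta>(2,1) vD uD])
    note comm = coupling_commute[OF N D12_Lp D12_Lp pos(2,1) \<beta>_pos]
    show "coupling \<alpha>2 \<alpha>1 \<beta> v u > 0" using C by (simp add: comm vD uD)
    show "dirichlet v + dirichlet u > 0" using D0 by (simp add: D_def)
    show "(dirichlet v + dirichlet u)\<^sup>2 * coupling \<alpha>2 \<alpha>1 \<beta> \<phi> \<psi>
        \<le> (dirichlet \<phi> + dirichlet \<psi>)\<^sup>2 * coupling \<alpha>2 \<alpha>1 \<beta> v u"
      if "\<phi> \<in> D12" "\<psi> \<in> D12" "coupling \<alpha>2 \<alpha>1 \<beta> \<phi> \<psi> > 0"
      for \<phi> \<psi> :: "'a \<Rightarrow> real"
      using min[of \<psi> \<phi>] that by (simp add: comm vD uD D_def add.commute)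
  qed
  ultimately show ?thesis
    using AE_potential_eq_0[OF V(1) V_nonneg(1) uD pot(1)] AE_potential_eq_0[OF V(2) V_nonneg(2) vD pot(2)]
    by blast
qed

end

lemma Lp_norm_eq_0:
  assumes "AE x in lborel. f x = 0"
  shows "Lp_norm q f = 0"
proof -
  have "AE x in lborel. \<bar>f x\<bar> powr q = 0" using assms by eventually_elim simp
  then show ?thesis by (simp add: Lp_norm_def integral_eq_zero_AE)
qed

theorem lemma2p4:
  fixes V1 V2 :: "real ^ 'n \<Rightarrow> real" and \<alpha>1 \<alpha>2 \<beta> :: real
  assumes "CARD('n) \<ge> 5"
    and "\<alpha>1 > 0" and "\<alpha>2 > 0" and "\<beta> > max \<alpha>1 \<alpha>2"
    and "V1 \<in> Lp (real CARD('n) / 2)" and "V2 \<in> Lp (real CARD('n) / 2)"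
    and "AE x in lborel. V1 x \<ge> 0" and "AE x in lborel. V2 x \<ge> 0"
    and "Lp_norm (real CARD('n) / 2) V1 + Lp_norm (real CARD('n) / 2) V2 > 0"
  shows "c_level \<alpha>1 \<alpha>2 \<beta> V1 V2
           = c_level \<alpha>1 \<alpha>2 \<beta> (\<lambda>x::real ^ 'n. 0) (\<lambda>x. 0)
         \<and> \<not> c_achieved \<alpha>1 \<alpha>2 \<beta> V1 V2"
proof -
  interpret hartree_system \<alpha>1 \<alpha>2 \<beta> V1 V2
    by unfold_locales (use assms in auto)
  have "\<not> c_achieved \<alpha>1 \<alpha>2 \<beta> V1 V2"
  proof
    assume "c_achieved \<alpha>1 \<alpha>2 \<beta> V1 V2"
    then have "AE x in lborel. V1 x = 0" "AE x in lborel. V2 x = 0"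
      using potentials_vanish_if_achieved by auto
    then have "Lp_norm (real CARD('n) / 2) V1 = 0" "Lp_norm (real CARD('n) / 2) V2 = 0"
      by (auto intro: Lp_norm_eq_0)
    with assms(9) show False by simp
  qed
  with c_eq_c_inf show ?thesis by (rule conjI)
qed

end
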